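(* Let $\underline{\mathrm P}=(P_j(u))_{j\in I}$ be any tuple of Drinfeld polynomials (monic polynomials in $\mathbb C[u]$), and fix $w\in W$. Let $w=s_{j_1}s_{j_2}\cdots s_{j_p}$ be any reduced expression for $w$. For each $0<r\le p$, set $w_r:=s_{j_{r+1}}\cdots s_{j_p}$, where $w_p=\mathrm{Id}$. Then for each $i\in I$ $$\mathcal Q^w_{i,\underline{\mathrm P}}(u)=\prod_{r:\,j_r=i}\tau^{\mathscr M}_{w_r}(\underline{\mathrm P})_i .$$ Moreover, $\tau^{\mathscr M}_{w_r}(\underline{\mathrm P})_{j_r}$ is a monic polynomial in $u$ for each $r$.
   Context: Lie algebra. $\mathfrak g$ is a simple Lie algebra over $\mathbb C$ with Cartan matrix $(a_{ij})_{i,j\in I}$, Chevalley generators $e_i,h_i,f_i$, fundamental weights $\varpi_i$, minimal symmetrizing integers $d_i$ ($d_ia_{ij}=d_ja_{ji}$), Weyl group $W=\langle s_i\rangle$. $\mathscr B_{\mathfrak g}$ is the braid group with generators $\tau_i$ ($i\in I$) and relations $\tau_i\tau_j\tau_i\cdots=\tau_j\tau_i\tau_j\cdots$ ($m_{ij}$ factors on each side, $i\ne j$; $m_{ij}=2,3,4,6$ for $a_{ij}a_{ji}=0,1,2,3$). For $w=s_{i_1}\cdots s_{i_\ell}$ reduced, $\tau_w=\tau_{i_1}\cdots\tau_{i_\ell}$. Yangian. Fix $\hbar\in\mathbb C^\times$. $Y=Y_\hbar(\mathfrak g)$ is the unital associative $\mathbb C$-algebra generated by $\xi_{i,r},x^\pm_{i,r}$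 ($i\in I,r\ge0$) with relations: $[\xi_{i,r},\xi_{j,s}]=0$; $[\xi_{i,0},x^\pm_{j,s}]=\pm d_ia_{ij}x^\pm_{j,s}$; $[\xi_{i,r+1},x^\pm_{j,s}]-[\xi_{i,r},x^\pm_{j,s+1}]=\pm\hbar\frac{d_ia_{ij}}2(\xi_{i,r}x^\pm_{j,s}+x^\pm_{j,s}\xi_{i,r})$; $[x^\pm_{i,r+1},x^\pm_{j,s}]-[x^\pm_{i,r},x^\pm_{j,s+1}]=\pm\hbar\frac{d_ia_{ij}}2(x^\pm_{i,r}x^\pm_{j,s}+x^\pm_{j,s}x^\pm_{i,r})$; $[x^+_{i,r},x^-_{j,s}]=\delta_{ij}\xi_{i,r+s}$; and for $i\ne j$, $m=1-a_{ij}$: $\sum_{\pi\in S_m}[x^\pm_{i,r_{\pi(1)}},[x^\pm_{i,r_{\pi(2)}},\cdots[x^\pm_{i,r_{\pi(m)}},x^\pm_{j,s}]\cdots]]=0$. Set $\xi_i(u)=1+\hbar\sum_{r\ge0}\xi_{i,r}u^{-r-1}$, $x_i^\pm(u)=\hbar\sum_{r\ge0}x^\pm_{i,r}u^{-r-1}$. $U(\mathfrak g)\subset Y$ via $e_i\mapsto d_i^{-1/2}x^+_{i,0}$, $h_i\mapsto d_i^{-1}\xi_{i,0}$, $f_i\mapsto d_i^{-1/2}x^-_{i,0}$. The series $A_i(u)\in1+u^{-1}Y[[u^{-1}]]$, with coefficients in the commutative subalgebra generated by the $\xi_{j,r}$, are uniquely determined by $\xi_i(u)=\frac{\prod_{j\ne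 i}\prod_{r=1}^{-a_{ji}}A_j(u-\frac{\hbar d_j}2(2r+a_{ji}))}{A_i(u)A_i(u-\hbar d_i)}$ for all $i\in I$. Representations. $V=L(\underline{\mathrm P})$ is the finite-dimensional irreducible $Y$-module generated by a highest weight vector $v$ with $x_i^+(u)v=0$, $\xi_i(u)v=\frac{P_i(u+\hbar d_i)}{P_i(u)}v$ for all $i$; its $\mathfrak g$-highest weight is $\lambda=\sum_i\deg(P_i)\varpi_i$, and $V_\mu$ denotes the $\mathfrak g$-weight space of weight $\mu$. Let $\lambda_i^A(u)$ be the eigenvalue of $A_i(u)$ on $V_\lambda$, and $A_i^V(u)=\lambda_i^A(u)^{-1}A_i(u)|_V$. There is a unique monic polynomial $T_i(u)\in\mathrm{End}(V)[u]$ (monic on each weight space, degree depending on the weight) with $T_i(u+\hbar d_i)=A_i^V(u)T_i(u)$. $\mathcal Q^w_{i,\underline{\mathrm P}}(u)\in\mathbb C[u]$ is its eigenvalue on the one-dimensional space $V_{w(\lambda)}$; equivalently, it is the unique monic polynomial $Q$ with $\lambda^A_i(u)^{-1}A_i(u)|_{V_{w(\lambda)}}=\frac{Q(u+\hbar d_i)}{Q(u)}\mathrm{Id}$. Braid group action. $\mathscr M=\bigcup_{k\in\mathbb Z}u^k(1+u^{-1}\mathbb C[[u^{-1}]])$. $\mathscr B_{\mathfrak g}$ acts on $\mathscr M^I$ by group automorphisms $\sigma\mapsto\sigma^{\mathscr M}$, where $\tau_j^{\mathscr M}(\underline\mu)_i=\mu_i(u)\prod_{k=0}^{|a_{ij}|-1}\mu_j\big(u-\frac{\hbar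 d_i}2(|a_{ij}|-2k)\big)^{(-1)^{\delta_{ij}}}$ is the $i$-th component. *)

theory Defs
  imports
    "HOL-Computational_Algebra.Computational_Algebra"
    "HOL-Library.Poly_Mapping"
    "HOL-Combinatorics.Permutations"
    Complex_Main
begin

section \<open>Cartan matrices, weights and the Weyl group\<close>

text \<open>
  Cartan matrices of simple complex Lie algebras (indecomposable, finite type), together with their
  minimal symmetrizing integers \<open>d\<close>. The convention is \<open>a i j = \<alpha>\<^sub>j(h\<^sub>i)\<close>.
\<close>

locale simple_cartan_datum =
  fixes a :: "'i::finite \<Rightarrow> 'i \<Rightarrow> int" and d :: "'i \<Rightarrow> int"
  assumes diag: "a i i = 2"
    and off_diag: "i \<noteq> j \<Longrightarrow> a i j \<le> 0"
    and d_pos: "d i > 0"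
    and symmetrized: "d i * a i j = d j * a j i"
    and d_minimal: "\<lbrakk>\<And>i. d' i > 0; \<And>i j. d' i * a i j = d' j * a j i\<rbrakk> \<Longrightarrow> d i \<le> d' i"
    and pos_def: "\<exists>i. x i \<noteq> 0 \<Longrightarrow> (\<Sum>i\<in>UNIV. \<Sum>j\<in>UNIV. of_int (d i * a i j) * x i * x j) > (0::real)"
    and indecomposable: "\<lbrakk>S \<noteq> {}; S \<noteq> UNIV\<rbrakk> \<Longrightarrow> \<exists>i\<in>S. \<exists>j\<in>-S. a i j \<noteq> 0"

text \<open>
  An integral weight \<open>\<mu>\<close> is given by its coordinates \<open>\<mu> j = \<mu>(h\<^sub>j)\<close> in the basis of fundamental
  weights; thus \<open>\<alpha>\<^sub>i\<close> has coordinates \<open>\<lambda>j. a j i\<close>.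
\<close>

type_synonym 'i weight = "'i \<Rightarrow> int"

definition simple_reflection :: "('i \<Rightarrow> 'i \<Rightarrow> int) \<Rightarrow> 'i \<Rightarrow> 'i weight \<Rightarrow> 'i weight" where
  "simple_reflection a i \<mu> = (\<lambda>j. \<mu> j - \<mu> i * a j i)"

definition weyl_word :: "('i \<Rightarrow> 'i \<Rightarrow> int) \<Rightarrow> 'i list \<Rightarrow> 'i weight \<Rightarrow> 'i weight" where
  "weyl_word a js = foldr (\<lambda>j w. simple_reflection a j \<circ> w) js id"

text \<open>The generators are involutions, so products of generators exhaust the group.\<close>

definition weyl_group :: "('i \<Rightarrow> 'i \<Rightarrow> int) \<Rightarrow> ('i weight \<Rightarrow> 'i weight) set" where
  "weyl_group a = range (weyl_word a)"

definition reduced_expression ::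
    "('i \<Rightarrow> 'i \<Rightarrow> int) \<Rightarrow> 'i list \<Rightarrow> ('i weight \<Rightarrow> 'i weight) \<Rightarrow> bool" where
  "reduced_expression a js w \<longleftrightarrow>
     weyl_word a js = w \<and> (\<forall>ks. weyl_word a ks = w \<longrightarrow> length js \<le> length ks)"


section \<open>The Yangian\<close>

text \<open>
  The free algebra on a set of generators is the monoid algebra of the free monoid; the latter
  needs a type of its own, since lists do not instantiate the additive monoid class.
\<close>

datatype 'g word = Word (letters: "'g list")

instantiation word :: (type) monoid_add
begin
definition zero_word :: "'a word" where "0 = Word []"
definition plus_word :: "'a word \<Rightarrow> 'a word \<Rightarrow> 'a word"
  where "v + w = Word (letters v @ letters w)"
instance by standard (auto simp: zero_word_def plus_word_def)
end

type_synonym 'g free_alg = "'g word \<Rightarrow>\<^sub>0 complex"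

definition scalar :: "complex \<Rightarrow> 'g free_alg" where
  "scalar c = Poly_Mapping.single 0 c"

definition gen :: "'g \<Rightarrow> 'g free_alg" where
  "gen g = Poly_Mapping.single (Word [g]) 1"

definition comm :: "'a::ring \<Rightarrow> 'a \<Rightarrow> 'a" where
  "comm x y = x * y - y * x"

datatype pm = Plus | Minus

fun pm_sign :: "pm \<Rightarrow> complex" where
  "pm_sign Plus = 1"
| "pm_sign Minus = - 1"

datatype 'i yangian_gen = Xi 'i nat | X pm 'i nat

abbreviation xi :: "'i \<Rightarrow> nat \<Rightarrow> 'i yangian_gen free_alg" where
  "xi i r \<equiv> gen (Xi i r)"

abbreviation xpm :: "pm \<Rightarrow> 'i \<Rightarrow> nat \<Rightarrow> 'i yangian_gen free_alg" where
  "xpm s i r \<equiv> gen (X s i r)"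

text \<open>Each relation \<open>lhs = rhs\<close> is recorded as the element \<open>lhs - rhs\<close>.\<close>

inductive_set yangian_relators ::
    "('i \<Rightarrow> 'i \<Rightarrow> int) \<Rightarrow> ('i \<Rightarrow> int) \<Rightarrow> complex \<Rightarrow> 'i yangian_gen free_alg set"
  for a d hbar where
  xi_xi: "comm (xi i r) (xi j s) \<in> yangian_relators a d hbar"
| xi0_x: "comm (xi i 0) (xpm \<epsilon> j s) - scalar (pm_sign \<epsilon> * of_int (d i * a i j)) * xpm \<epsilon> j s
     \<in> yangian_relators a d hbar"
| xi_x: "comm (xi i (Suc r)) (xpm \<epsilon> j s) - comm (xi i r) (xpm \<epsilon> j (Suc s))
     - scalar (pm_sign \<epsilon> * hbar * of_int (d i * a i j) / 2) * (xi i r * xpm \<epsilon> j s + xpm \<epsilon> j s * xi i r)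
     \<in> yangian_relators a d hbar"
| x_x: "comm (xpm \<epsilon> i (Suc r)) (xpm \<epsilon> j s) - comm (xpm \<epsilon> i r) (xpm \<epsilon> j (Suc s))
     - scalar (pm_sign \<epsilon> * hbar * of_int (d i * a i j) / 2) * (xpm \<epsilon> i r * xpm \<epsilon> j s + xpm \<epsilon> j s * xpm \<epsilon> i r)
     \<in> yangian_relators a d hbar"
| xp_xm: "comm (xpm Plus i r) (xpm Minus j s) - (if i = j then xi i (r + s) else 0)
     \<in> yangian_relators a d hbar"
| serre: "i \<noteq> j \<Longrightarrow> m = nat (1 - a i j) \<Longrightarrow>
     (\<Sum>\<pi> | \<pi> permutes {1..m}. foldr (\<lambda>k y. comm (xpm \<epsilon> i (r (\<pi> k))) y) [1..<Suc m] (xpm \<epsilon> j s))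
     \<in> yangian_relators a d hbar"

text \<open>
  The Yangian is the quotient of the free algebra by the following two-sided ideal. Its elements
  are represented by elements of the free algebra, and equality in the Yangian is congruence
  modulo the ideal.
\<close>

inductive_set yangian_ideal ::
    "('i \<Rightarrow> 'i \<Rightarrow> int) \<Rightarrow> ('i \<Rightarrow> int) \<Rightarrow> complex \<Rightarrow> 'i yangian_gen free_alg set"
  for a d hbar where
  relator: "p \<in> yangian_relators a d hbar \<Longrightarrow> p \<in> yangian_ideal a d hbar"
| zero: "0 \<in> yangian_ideal a d hbar"
| add: "\<lbrakk>p \<in> yangian_ideal a d hbar; q \<in> yangian_ideal a d hbar\<rbrakk> \<Longrightarrow> p + q \<in> yangian_ideal a d hbar"
| left: "p \<in> yangian_ideal a d hbar \<Longrightarrow> q * p \<in> yangian_ideal a d hbar"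
| right: "p \<in> yangian_ideal a d hbar \<Longrightarrow> p * q \<in> yangian_ideal a d hbar"

definition yangian_eq ::
    "('i \<Rightarrow> 'i \<Rightarrow> int) \<Rightarrow> ('i \<Rightarrow> int) \<Rightarrow> complex \<Rightarrow>
     'i yangian_gen free_alg \<Rightarrow> 'i yangian_gen free_alg \<Rightarrow> bool" where
  "yangian_eq a d hbar p q \<longleftrightarrow> p - q \<in> yangian_ideal a d hbar"

text \<open>
  Modules over the Yangian: representations of the free algebra on the complex vector space \<open>'v\<close>
  (with scalar multiplication \<open>sc\<close>) which vanish on the ideal.
\<close>

locale yangian_module =
  fixes a :: "'i::finite \<Rightarrow> 'i \<Rightarrow> int" and d :: "'i \<Rightarrow> int" and hbar :: complex
    and sc :: "complex \<Rightarrow> 'v::ab_group_add \<Rightarrow> 'v"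
    and \<rho> :: "'i yangian_gen free_alg \<Rightarrow> 'v \<Rightarrow> 'v"
  assumes linear: "Vector_Spaces.linear sc sc (\<rho> p)"
    and scalar: "\<rho> (scalar c) x = sc c x"
    and add: "\<rho> (p + q) x = \<rho> p x + \<rho> q x"
    and mult: "\<rho> (p * q) x = \<rho> p (\<rho> q x)"
    and vanishes: "p \<in> yangian_ideal a d hbar \<Longrightarrow> \<rho> p x = 0"


section \<open>Series in \<open>u\<^sup>-\<^sup>1\<close>\<close>

text \<open>
  In all formal power and Laurent series the formal variable stands for \<open>u\<^sup>-\<^sup>1\<close>. Thus the set
  \<open>\<Union>k. u\<^sup>k (1 + u\<^sup>-\<^sup>1 \<complex>[[u\<^sup>-\<^sup>1]])\<close> is the set of all \<open>f :: complex fls\<close> with leading coefficient 1, and a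
  polynomial \<open>p(u)\<close> is a Laurent series via evaluation at the inverse of the formal variable.
\<close>

definition poly_in_u :: "complex poly \<Rightarrow> complex fls" where
  "poly_in_u p = poly (map_poly fls_const p) fls_X_inv"

definition poly_shift :: "complex \<Rightarrow> complex poly \<Rightarrow> complex poly" where
  "poly_shift c p = pcompose p [:c, 1:]"

text \<open>The expansion of \<open>(u - c)\<^sup>-\<^sup>1\<close>, and the substitution \<open>f(u) \<mapsto> f(u - c)\<close>.\<close>

definition shifted_u_inv :: "complex \<Rightarrow> complex fps" where
  "shifted_u_inv c = Abs_fps (\<lambda>n. if n = 0 then 0 else c ^ (n - 1))"

definition shift_fls :: "complex \<Rightarrow> complex fls \<Rightarrow> complex fls" where
  "shift_fls c f = fls_compose_fps f (shifted_u_inv c)"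

definition shift_series :: "complex \<Rightarrow> 'g free_alg fps \<Rightarrow> 'g free_alg fps" where
  "shift_series c f = fps_compose f (Abs_fps (\<lambda>n. scalar (shifted_u_inv c $ n)))"

definition xi_series :: "complex \<Rightarrow> 'i \<Rightarrow> 'i yangian_gen free_alg fps" where
  "xi_series hbar i = Abs_fps (\<lambda>n. if n = 0 then 1 else scalar hbar * xi i (n - 1))"

definition x_series :: "complex \<Rightarrow> pm \<Rightarrow> 'i \<Rightarrow> 'i yangian_gen free_alg fps" where
  "x_series hbar \<epsilon> i = Abs_fps (\<lambda>n. if n = 0 then 0 else scalar hbar * xpm \<epsilon> i (n - 1))"


section \<open>The series \<open>A\<^sub>i(u)\<close>\<close>

definition cartan_subalgebra :: "'i yangian_gen free_alg set" where
  "cartan_subalgebra = {p. \<forall>w \<in> Poly_Mapping.keys p. set (letters w) \<subseteq> {Xi i r | i r. True}}"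

text \<open>
  A product over a finite set of factors which commute only in the Yangian, not in the free
  algebra; the factors are multiplied in an arbitrary fixed order.
\<close>

definition some_order_prod :: "('b \<Rightarrow> 'a::monoid_mult) \<Rightarrow> 'b set \<Rightarrow> 'a" where
  "some_order_prod f S = prod_list (map f (SOME xs. distinct xs \<and> set xs = S))"

text \<open>
  \<open>A i\<close> represents the series \<open>A\<^sub>i(u)\<close>. The defining equation is multiplied by its denominator,
  which is invertible and commutes with all other terms.
\<close>

definition is_A_series ::
    "('i::finite \<Rightarrow> 'i \<Rightarrow> int) \<Rightarrow> ('i \<Rightarrow> int) \<Rightarrow> complex \<Rightarrow> ('i \<Rightarrow> 'i yangian_gen free_alg fps) \<Rightarrow> bool" where
  "is_A_series a d hbar A \<longleftrightarrow> (\<forall>i.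
      yangian_eq a d hbar (A i $ 0) 1 \<and>
      (\<forall>n. \<exists>p \<in> cartan_subalgebra. yangian_eq a d hbar (A i $ n) p) \<and>
      (\<forall>n. yangian_eq a d hbar
         ((xi_series hbar i * (A i * shift_series (hbar * of_int (d i)) (A i))) $ n)
         (some_order_prod (\<lambda>j. prod_list (map
             (\<lambda>r. shift_series (hbar * of_int (d j) / 2 * of_int (2 * int r + a j i)) (A j))
             [1..<Suc (nat (- a j i))])) (- {i}) $ n)))"


section \<open>Finite-dimensional irreducible modules and the polynomials \<open>Q\<close>\<close>

definition finite_dim_irreducible ::
    "(complex \<Rightarrow> 'v::ab_group_add \<Rightarrow> 'v) \<Rightarrow> ('g free_alg \<Rightarrow> 'v \<Rightarrow> 'v) \<Rightarrow> bool" where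
  "finite_dim_irreducible sc \<rho> \<longleftrightarrow>
     (\<exists>B. finite B \<and> module.span sc B = UNIV) \<and>
     (\<exists>x::'v. x \<noteq> 0) \<and>
     (\<forall>U. module.subspace sc U \<and> (\<forall>p. \<rho> p ` U \<subseteq> U) \<longrightarrow> U = {0} \<or> U = UNIV)"

text \<open>\<open>(sc, \<rho>)\<close> is the module with Drinfeld polynomials \<open>P\<close> and highest weight vector \<open>v\<close>.\<close>

definition drinfeld_module ::
    "('i::finite \<Rightarrow> 'i \<Rightarrow> int) \<Rightarrow> ('i \<Rightarrow> int) \<Rightarrow> complex \<Rightarrow> ('i \<Rightarrow> complex poly) \<Rightarrow>
     (complex \<Rightarrow> 'v::ab_group_add \<Rightarrow> 'v) \<Rightarrow> ('i yangian_gen free_alg \<Rightarrow> 'v \<Rightarrow> 'v) \<Rightarrow> 'v \<Rightarrow> bool" where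
  "drinfeld_module a d hbar P sc \<rho> v \<longleftrightarrow>
     yangian_module a d hbar sc \<rho> \<and> finite_dim_irreducible sc \<rho> \<and>
     v \<noteq> 0 \<and> range (\<lambda>p. \<rho> p v) = UNIV \<and>
     (\<forall>i n. \<rho> (x_series hbar Plus i $ n) v = 0) \<and>
     (\<forall>i n. \<rho> (xi_series hbar i $ n) v =
        sc (fls_nth (poly_in_u (poly_shift (hbar * of_int (d i)) (P i)) / poly_in_u (P i)) (int n)) v)"

text \<open>Here \<open>h\<^sub>i = d\<^sub>i\<^sup>-\<^sup>1 \<xi>\<^sub>i\<^sub>,\<^sub>0\<close>.\<close>

definition weight_space ::
    "('i \<Rightarrow> int) \<Rightarrow> (complex \<Rightarrow> 'v \<Rightarrow> 'v) \<Rightarrow> ('i yangian_gen free_alg \<Rightarrow> 'v \<Rightarrow> 'v) \<Rightarrow>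
     'i weight \<Rightarrow> 'v set" where
  "weight_space d sc \<rho> \<mu> =
     {x. \<forall>i. \<rho> (scalar (1 / of_int (d i)) * xi i 0) x = sc (of_int (\<mu> i)) x}"

definition highest_weight :: "('i \<Rightarrow> complex poly) \<Rightarrow> 'i weight" where
  "highest_weight P = (\<lambda>i. int (degree (P i)))"

definition lambda_A ::
    "('i \<Rightarrow> int) \<Rightarrow> ('i \<Rightarrow> complex poly) \<Rightarrow> (complex \<Rightarrow> 'v \<Rightarrow> 'v) \<Rightarrow>
     ('i yangian_gen free_alg \<Rightarrow> 'v \<Rightarrow> 'v) \<Rightarrow> ('i \<Rightarrow> 'i yangian_gen free_alg fps) \<Rightarrow> 'i \<Rightarrow> complex fps" where
  "lambda_A d P sc \<rho> A i =
     (THE l. \<forall>x \<in> weight_space d sc \<rho> (highest_weight P). \<forall>n. \<rho> (A i $ n) x = sc (l $ n) x)"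

text \<open>The coefficient of \<open>u\<^sup>-\<^sup>n\<close> in the normalized operator \<open>\<lambda>\<^sub>i\<^sup>A(u)\<^sup>-\<^sup>1 A\<^sub>i(u)\<close> on the module.\<close>

definition A_V ::
    "('i \<Rightarrow> int) \<Rightarrow> ('i \<Rightarrow> complex poly) \<Rightarrow> (complex \<Rightarrow> 'v::comm_monoid_add \<Rightarrow> 'v) \<Rightarrow>
     ('i yangian_gen free_alg \<Rightarrow> 'v \<Rightarrow> 'v) \<Rightarrow> ('i \<Rightarrow> 'i yangian_gen free_alg fps) \<Rightarrow> 'i \<Rightarrow>
     nat \<Rightarrow> 'v \<Rightarrow> 'v" where
  "A_V d P sc \<rho> A i n x =
     (\<Sum>k\<le>n. sc (inverse (lambda_A d P sc \<rho> A i) $ k) (\<rho> (A i $ (n - k)) x))"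

definition Q_poly ::
    "('i \<Rightarrow> int) \<Rightarrow> complex \<Rightarrow> ('i \<Rightarrow> complex poly) \<Rightarrow> (complex \<Rightarrow> 'v::comm_monoid_add \<Rightarrow> 'v) \<Rightarrow>
     ('i yangian_gen free_alg \<Rightarrow> 'v \<Rightarrow> 'v) \<Rightarrow> ('i \<Rightarrow> 'i yangian_gen free_alg fps) \<Rightarrow>
     ('i weight \<Rightarrow> 'i weight) \<Rightarrow> 'i \<Rightarrow> complex poly" where
  "Q_poly d hbar P sc \<rho> A w i =
     (THE Q. lead_coeff Q = 1 \<and>
        (\<forall>x \<in> weight_space d sc \<rho> (w (highest_weight P)). \<forall>n.
           A_V d P sc \<rho> A i n x =
             sc (fls_nth (poly_in_u (poly_shift (hbar * of_int (d i)) Q) / poly_in_u Q) (int n)) x))"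


section \<open>The braid group action\<close>

definition tau_gen ::
    "('i \<Rightarrow> 'i \<Rightarrow> int) \<Rightarrow> ('i \<Rightarrow> int) \<Rightarrow> complex \<Rightarrow> 'i \<Rightarrow> ('i \<Rightarrow> complex fls) \<Rightarrow> 'i \<Rightarrow> complex fls" where
  "tau_gen a d hbar j \<mu> = (\<lambda>i. \<mu> i *
     (\<Prod>k<nat \<bar>a i j\<bar>. shift_fls (hbar * of_int (d i) / 2 * of_int (\<bar>a i j\<bar> - 2 * int k)) (\<mu> j)
        powi (if i = j then - 1 else 1)))"

text \<open>The action of the element \<open>\<tau>\<^sub>j\<^sub>1 \<cdots> \<tau>\<^sub>j\<^sub>l\<close> of the braid group.\<close>

definition tau_word ::
    "('i \<Rightarrow> 'i \<Rightarrow> int) \<Rightarrow> ('i \<Rightarrow> int) \<Rightarrow> complex \<Rightarrow> 'i list \<Rightarrow> ('i \<Rightarrow> complex fls) \<Rightarrow> 'i \<Rightarrow> complex fls" where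
  "tau_word a d hbar js = foldr (\<lambda>j \<sigma>. tau_gen a d hbar j \<circ> \<sigma>) js id"

text \<open>
  The action of \<open>\<tau>\<^sub>w\<close>. As the operators \<open>tau_gen\<close> satisfy the braid relations on series with leading
  coefficient 1, it does not depend on the choice of the reduced expression.
\<close>

definition tau ::
    "('i \<Rightarrow> 'i \<Rightarrow> int) \<Rightarrow> ('i \<Rightarrow> int) \<Rightarrow> complex \<Rightarrow> ('i weight \<Rightarrow> 'i weight) \<Rightarrow>
     ('i \<Rightarrow> complex fls) \<Rightarrow> 'i \<Rightarrow> complex fls" where
  "tau a d hbar w = tau_word a d hbar (SOME js. reduced_expression a js w)"

end

theory Submission
  imports Defs
begin

text \<open>
  Let \<open>y\<close> span \<open>V\<close> in weight \<open>w(\<lambda>)\<close>, let \<open>s\<^sub>j w\<close> be longer than \<open>w\<close>, and let \<open>f = x\<^sup>-\<^sub>j\<^sub>,\<^sub>0\<close>,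
  \<open>\<eta> = \<hbar> d\<^sub>j\<close> and \<open>C(u) = \<Sum> x\<^sup>-\<^sub>j\<^sub>,\<^sub>s u\<^sup>-\<^sup>s\<^sup>-\<^sup>1\<close>. Then \<open>[f, C(u)] = \<eta> C(u)\<^sup>2\<close>, so the powers of
  \<open>f\<^sub>n = f + n \<eta> C(u)\<close> satisfy \<open>f\<^sub>n\<^sub>+\<^sub>1\<^sup>m - f\<^sub>n\<^sup>m = m f\<^sub>n\<^sup>m\<^sup>-\<^sup>1 \<eta> C(u)\<close>. Together with
  \<open>e\<^sub>n = x\<^sup>+\<^sub>j\<^sub>,\<^sub>0 - n \<eta> \<Sum> x\<^sup>+\<^sub>j\<^sub>,\<^sub>r (u + n \<eta>)\<^sup>-\<^sup>r\<^sup>-\<^sup>1\<close> the element \<open>f\<^sub>n\<close> generates an \<open>sl\<^sub>2\<close>. If \<open>m\<close> is the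
  weight of \<open>y\<close> at \<open>j\<close> and \<open>\<xi>\<^sub>j(u) y = \<mu>(u + \<eta>) / \<mu>(u) y\<close>, it follows that
  \<open>f\<^sub>n\<^sup>m y = \<mu>(u + n \<eta>) / \<mu>(u) f\<^sup>m y\<close> for all integers \<open>n\<close>. The left-hand side has degree at most \<open>m\<close>
  in \<open>n\<close>, so \<open>\<mu>\<close> is a polynomial. Moreover \<open>\<xi>\<^sub>i(u) f = f\<^sub>n \<xi>\<^sub>i(u)\<close> with \<open>n = - a\<^sub>j\<^sub>i\<close>, up to a shift of
  the variable in \<open>f\<^sub>n\<close>, which gives the eigenvalues of all \<open>\<xi>\<^sub>i(u)\<close> on \<open>f\<^sup>m y\<close>: they are the ones
  predicted by the braid group operator \<open>\<tau>\<^sub>j\<close>. The eigenvalues of the \<open>A\<^sub>i(u)\<close> are determined by those of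
  the \<open>\<xi>\<^sub>i(u)\<close>. Since a series in \<open>M\<close> is determined by the quotient \<open>\<mu>(u + c) / \<mu>(u)\<close>, this also shows
  that \<open>\<tau>\<^sub>w\<close> applied to the Drinfeld polynomials does not depend on the reduced expression, so that the
  braid relations never have to be checked.
\<close>

section \<open>Series in the inverse of the spectral parameter\<close>

text \<open>\<open>C(u)\<close> has infinitely many terms, so all operators act on
  \<open>V[[u^-1]]\<close> and are linear over scalar series; this alone lets them pass through the
  infinite sums that occur. Arguments at different points are handled by series in
  \<open>(u - c)^-1\<close> with a base point \<open>c\<close>. As \<open>shift_fls c\<close> means
  u -> u - c, an argument \<open>u + n \<eta>\<close> appears as the shift by
  \<open>- n * \<eta>\<close>.

  The eigenvalue formula for the m-th power rests on a fact about sl2: a vector of weight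
  \<open>m - 2\<close> killed by \<open>e_n\<close> is killed by the power \<open>m - 1\<close> of
  \<open>f_n\<close>, provided the string of weight spaces stops at weight \<open>- m\<close>. Both
  ends of the string must therefore be known. The upper end is the positivity of the inverse image
  of the simple root j under a reduced word; the lower end follows because the set of weights is
  stable under reflections. Only a positive definite Cartan matrix is given, so positivity of roots
  is derived from the invariant form and the integrality of coroots.

  That the \<open>A_i\<close> are determined comes from comparing coefficients one order at a time:
  shifts are invisible in the first coefficient where two solutions differ, and what remains is the
  transposed Cartan matrix, which is invertible.\<close>

notation fls_nth (infixl "$$" 75)

lemma shifted_u_inv_nth_0 [simp]: "shifted_u_inv c $ 0 = 0"
  by (simp add: shifted_u_inv_def)

lemma shifted_u_inv_eq: "(1 - fps_const c * fps_X) * shifted_u_inv c = fps_X"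
proof (rule fps_ext)
  fix n
  have "n = 0 \<or> n = 1 \<or> (\<exists>m. n = Suc (Suc m))" by presburger
  thus "((1 - fps_const c * fps_X) * shifted_u_inv c) $ n = fps_X $ n"
    by (auto simp: shifted_u_inv_def left_diff_distrib mult.assoc)
qed

lemma shifted_u_inv_0: "shifted_u_inv 0 = fps_X"
  using shifted_u_inv_eq[of 0] by simp

lemma one_minus_cX_nonzero: "1 - fps_const c * fps_X \<noteq> (0 :: complex fps)"
  using shifted_u_inv_eq[of c] by auto

lemma shifted_u_inv_nonzero [simp]: "shifted_u_inv c \<noteq> 0"
  using shifted_u_inv_eq[of c] by auto

lemma subdegree_shifted_u_inv [simp]: "subdegree (shifted_u_inv c) = 1"
  by (rule subdegreeI) (auto simp: shifted_u_inv_def)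

text \<open>This substitutes \<open>u - b\<close> for \<open>u\<close> in
  \<open>1 / (u - c)\<close>. Denominators are cleared on both sides, and the nonzero factor
  \<open>1 - (c + b) X\<close> is cancelled.\<close>

lemma shifted_u_inv_compose: "shifted_u_inv c oo shifted_u_inv b = shifted_u_inv (c + b)"
proof -
  let ?p = "shifted_u_inv b"
  have "((1 - fps_const c * fps_X) * shifted_u_inv c) oo ?p = ?p"
    unfolding shifted_u_inv_eq by simp
  hence 1: "(1 - fps_const c * ?p) * (shifted_u_inv c oo ?p) = ?p"
    by (simp add: fps_compose_mult_distrib fps_compose_sub_distrib)
  have "(1 - fps_const b * fps_X) * ((1 - fps_const c * ?p) * (shifted_u_inv c oo ?p)) =
     ((1 - fps_const b * fps_X) - fps_const c * ((1 - fps_const b * fps_X) * ?p)) * (shifted_u_inv c oo ?p)"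
    by (simp add: algebra_simps)
  hence "(1 - fps_const b * fps_X - fps_const c * fps_X) * (shifted_u_inv c oo ?p) = fps_X"
    unfolding 1 shifted_u_inv_eq by simp
  hence "(1 - fps_const (c + b) * fps_X) * (shifted_u_inv c oo ?p) = fps_X"
    by (simp add: algebra_simps flip: fps_const_add)
  thus ?thesis
    using shifted_u_inv_eq[of "c + b"] one_minus_cX_nonzero mult_left_cancel by metis
qed

lemma shift_fls_add: "shift_fls c (f + g) = shift_fls c f + shift_fls c g"
  and shift_fls_diff: "shift_fls c (f - g) = shift_fls c f - shift_fls c g"
  and shift_fls_mult: "shift_fls c (f * g) = shift_fls c f * shift_fls c g"
  and shift_fls_divide: "shift_fls c (f / g) = shift_fls c f / shift_fls c g"
  and shift_fls_inverse: "shift_fls c (inverse f) = inverse (shift_fls c f)"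
  and shift_fls_const [simp]: "shift_fls c (fls_const z) = fls_const z"
  and shift_fls_1 [simp]: "shift_fls c 1 = 1"
  and shift_fls_0 [simp]: "shift_fls c 0 = 0"
  and shift_fls_eq_0_iff [simp]: "shift_fls c f = 0 \<longleftrightarrow> f = 0"
  and shift_fls_shift_fls [simp]: "shift_fls b (shift_fls c f) = shift_fls (c + b) f"
  by (simp_all add: shift_fls_def fls_compose_fps_add fls_compose_fps_diff fls_compose_fps_mult
      fls_compose_fps_divide fls_compose_fps_inverse fls_compose_fps_eq_0_iff
      fls_compose_fps_assoc shifted_u_inv_compose)

lemma shift_fls_prod: "shift_fls c (\<Prod>i\<in>S. f i) = (\<Prod>i\<in>S. shift_fls c (f i))"
  by (induction S rule: infinite_finite_induct) (auto simp: shift_fls_mult)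

lemma shift_fls_fps_to_fls: "shift_fls c (fps_to_fls f) = fps_to_fls (f oo shifted_u_inv c)"
  by (simp add: shift_fls_def)

lemma shift_fls_zero_shift [simp]: "shift_fls 0 f = f"
  using fls_nth_fls_compose_fps_linear[of 1 f]
  by (intro fls_eqI) (simp add: shift_fls_def shifted_u_inv_0)

lemma fps_mult_nth_Suc_0: "(F * G) $ Suc 0 = F $ 0 * G $ Suc 0 + F $ Suc 0 * G $ 0"
  by (simp add: fps_mult_nth)

lemma fps_unit_power_nth:
  assumes "R $ 0 = (1 :: complex)"
  shows "(R ^ n) $ 0 = 1" "(R ^ n) $ Suc 0 = of_nat n * R $ Suc 0"
proof -
  show *: "(R ^ n) $ 0 = 1" for n using assms by (simp add: fps_power_zeroth)
  show "(R ^ n) $ Suc 0 = of_nat n * R $ Suc 0"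
    by (induction n) (auto simp: fps_mult_nth_Suc_0 assms * algebra_simps)
qed

text \<open>The shift multiplies \<open>X ^ n\<close> by
  \<open>(1 - c X) ^ (- n) = 1 + n c X + ...\<close> and changes the unit factor of \<open>f\<close>
  only from order \<open>X ^ 2\<close> on. The first coefficient of the quotient thus detects the
  degree: it controls shift-invariant series, and later it identifies the highest weight.\<close>

lemma shift_fls_quotient_ex:
  assumes "f \<noteq> 0"
  shows "\<exists>R. shift_fls c f = f * fps_to_fls R \<and> R $ 0 = 1 \<and> R $ Suc 0 = c * of_int (fls_subdegree f)"
proof -
  define P where "P = 1 - fps_const c * fps_X"
  define n where "n = fls_subdegree f"
  define b where "b = fls_base_factor_to_fps f"
  have P: "P $ 0 = 1" "P $ Suc 0 = - c" by (simp_all add: P_def)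
  have "shifted_u_inv c = fps_X * inverse P"
    using shifted_u_inv_eq[of c] P inverse_mult_eq_1[of P]
    by (metis P_def mult.commute mult.left_commute mult.right_neutral zero_neq_one)
  hence p: "fps_to_fls (shifted_u_inv c) = fls_X * fps_to_fls (inverse P)"
    by (simp add: fls_times_fps_to_fls)
  have iP: "inverse P $ 0 = 1" "inverse P $ Suc 0 = c"
  proof -
    show 0: "inverse P $ 0 = 1" using P by simp
    have "(inverse P * P) $ Suc 0 = 0" using inverse_mult_eq_1[of P] P by simp
    thus "inverse P $ Suc 0 = c" using P 0 by (simp add: fps_mult_nth_Suc_0)
  qed
  have "\<exists>S. fps_to_fls (inverse P) powi n = fps_to_fls S \<and> S $ 0 = 1 \<and> S $ Suc 0 = c * of_int n"
  proof (cases "n \<ge> 0")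
    case True
    have "fps_to_fls (inverse P) powi n = fps_to_fls (inverse P ^ nat n)"
      using True by (simp add: power_int_def fps_to_fls_power)
    thus ?thesis using fps_unit_power_nth[OF iP(1), of "nat n"] iP True
      by (intro exI[of _ "inverse P ^ nat n"]) simp
  next
    case False
    have "fps_to_fls (inverse P) powi n = inverse (fps_to_fls (inverse P)) ^ nat (-n)"
      using False by (simp add: power_int_def power_inverse)
    also have "inverse (fps_to_fls (inverse P)) = fps_to_fls P"
      using inverse_mult_eq_1[of P] P
      by (intro inverse_unique) (simp flip: fls_times_fps_to_fls)
    finally have "fps_to_fls (inverse P) powi n = fps_to_fls (P ^ nat (-n))"
      by (simp add: fps_to_fls_power)
    thus ?thesis using fps_unit_power_nth[OF P(1), of "nat (-n)"] P False
      by (intro exI[of _ "P ^ nat (-n)"]) simp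
  qed
  then obtain S where S: "fps_to_fls (inverse P) powi n = fps_to_fls S" "S $ 0 = 1" "S $ Suc 0 = c * of_int n"
    by blast
  have b0: "b $ 0 \<noteq> 0" using assms unfolding b_def by (rule fls_base_factor_to_fps_base)
  define R where "R = inverse b * (b oo shifted_u_inv c) * S"
  \<comment> \<open>Unfolding composition at the identity substitution gives exactly this
    factorization into a unit and a power of \<open>X\<close>.\<close>
  have f: "f = fps_to_fls b * fls_X powi n"
    unfolding b_def n_def
    using shift_fls_zero_shift[of f] unfolding shift_fls_def fls_compose_fps_def shifted_u_inv_0 by (simp del: shift_fls_zero_shift fls_X_power_int)
  have "b * inverse b = 1" using inverse_mult_eq_1[of b] b0 by (simp add: mult.commute)
  hence bb: "fps_to_fls b * fps_to_fls (inverse b) = 1" by (simp flip: fls_times_fps_to_fls)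
  have "shift_fls c f = fps_to_fls (b oo shifted_u_inv c) * (fls_X powi n * fps_to_fls S)"
    unfolding shift_fls_def fls_compose_fps_def b_def[symmetric] n_def[symmetric] p
    by (simp add: power_int_mult_distrib S)
  also have "\<dots> = (fps_to_fls b * fps_to_fls (inverse b)) * (fps_to_fls (b oo shifted_u_inv c) * (fls_X powi n * fps_to_fls S))"
    by (simp add: bb)
  also have "\<dots> = f * fps_to_fls R" by (simp add: f R_def fls_times_fps_to_fls mult_ac)
  finally have 1: "shift_fls c f = f * fps_to_fls R" .
  have bp: "(b oo shifted_u_inv c) $ Suc 0 = b $ Suc 0"
    by (simp add: fps_compose_nth shifted_u_inv_def)
  have "(b * R) = (b oo shifted_u_inv c) * S" unfolding R_def
    using \<open>b * inverse b = 1\<close> by (metis (no_types, opaque_lifting) mult.assoc mult.left_neutral)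
  hence "(b * R) $ 0 = b $ 0" "(b * R) $ Suc 0 = ((b oo shifted_u_inv c) * S) $ Suc 0" by (simp_all add: S)
  hence "R $ 0 = 1" "R $ Suc 0 = c * of_int n" using b0 by (auto simp: fps_mult_nth_Suc_0 S bp)
  with 1 show ?thesis unfolding n_def by blast
qed

section \<open>Laurent series with leading coefficient 1 and their shift quotients\<close>

definition monic_fls :: "complex fls \<Rightarrow> bool" where
  "monic_fls f \<longleftrightarrow> f $$ fls_subdegree f = 1"

lemma monic_fls_nonzero: "monic_fls f \<Longrightarrow> f \<noteq> 0"
  by (auto simp: monic_fls_def)

lemma monic_fls_1 [simp]: "monic_fls 1" by (simp add: monic_fls_def)

lemma monic_fls_mult: "monic_fls f \<Longrightarrow> monic_fls g \<Longrightarrow> monic_fls (f * g)"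
  using monic_fls_nonzero[of f] monic_fls_nonzero[of g] unfolding monic_fls_def by simp

lemma monic_fls_inverse: "monic_fls f \<Longrightarrow> monic_fls (inverse f)"
  using monic_fls_nonzero[of f] unfolding monic_fls_def
  by (simp add: fls_inverse_subdegree' fls_inverse_base)

lemma monic_fls_divide: "monic_fls f \<Longrightarrow> monic_fls g \<Longrightarrow> monic_fls (f / g)"
  by (simp add: divide_inverse monic_fls_mult monic_fls_inverse)

lemma monic_fls_power: "monic_fls f \<Longrightarrow> monic_fls (f ^ n)"
  by (induction n) (auto intro: monic_fls_mult)

lemma monic_fls_powi: "monic_fls f \<Longrightarrow> monic_fls (f powi n)"
  by (simp add: power_int_def monic_fls_power monic_fls_inverse)

lemma monic_fls_prod: "(\<And>i. i \<in> S \<Longrightarrow> monic_fls (f i)) \<Longrightarrow> monic_fls (\<Prod>i\<in>S. f i)"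
  by (induction S rule: infinite_finite_induct) (auto intro: monic_fls_mult)

lemma fls_subdegree_shift_fls [simp]: "fls_subdegree (shift_fls c f) = fls_subdegree f"
  by (simp add: shift_fls_def)

lemma monic_fls_shift: assumes "monic_fls f" shows "monic_fls (shift_fls c f)"
proof -
  have f: "f \<noteq> 0" using assms by (rule monic_fls_nonzero)
  from shift_fls_quotient_ex[OF this, of c] obtain R where
    R: "shift_fls c f = f * fps_to_fls R" "R $ 0 = 1" by blast
  have "fls_subdegree (fps_to_fls R) = 0" using R(2) by (simp add: fls_subdegree_fls_to_fps subdegree_eq_0)
  hence "monic_fls (fps_to_fls R)" using R(2) by (simp add: monic_fls_def)
  thus ?thesis unfolding R(1) using assms by (intro monic_fls_mult)
qed

text \<open>The first coefficient \<open>c * n\<close> of the quotient has to vanish. The zero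
  series is covered because its subdegree is 0 by convention, so the lemma applies to differences
  before they are known to be nonzero.\<close>

lemma shift_fls_invariant_subdegree:
  assumes "shift_fls c f = f" "c \<noteq> 0"
  shows "fls_subdegree f = 0"
proof (cases "f = 0")
  case False
  from shift_fls_quotient_ex[OF this, of c] obtain R where
    R: "shift_fls c f = f * fps_to_fls R" "R $ Suc 0 = c * of_int (fls_subdegree f)" by blast
  hence "fps_to_fls R = fps_to_fls 1" using assms False by simp
  hence "R = 1" by (simp only: fps_to_fls_eq_iff)
  thus ?thesis using R(2) assms by simp
qed simp

text \<open>The ratio \<open>r\<close> is shift-invariant and monic, hence of degree 0 with constant
  term 1. Then \<open>r - 1\<close> is invariant as well but has no constant term, which is
  impossible unless it is zero.\<close>

lemma monic_fls_eqI:
  assumes "monic_fls f" "monic_fls g" "c \<noteq> 0" "shift_fls c f / f = shift_fls c g / g"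
  shows "f = g"
proof -
  have nz: "f \<noteq> 0" "g \<noteq> 0" using assms monic_fls_nonzero by auto
  define r where "r = f / g"
  have "shift_fls c r = r"
    using assms(4) nz by (simp add: r_def shift_fls_divide field_simps)
  moreover have "monic_fls r" using assms by (simp add: r_def monic_fls_divide)
  ultimately have r0: "r $$ 0 = 1"
    using shift_fls_invariant_subdegree[of c r] assms(3) by (simp add: monic_fls_def)
  have "shift_fls c (r - 1) = r - 1" using \<open>shift_fls c r = r\<close> by (simp add: shift_fls_diff)
  hence "fls_subdegree (r - 1) = 0" using shift_fls_invariant_subdegree assms(3) by blast
  hence "r - 1 = 0" using r0 nth_fls_subdegree_zero_iff[of "r - 1"] by auto
  thus ?thesis using nz by (simp add: r_def)
qed

section \<open>Polynomials in \<open>u\<close> as Laurent series\<close>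

lemma poly_in_u_0 [simp]: "poly_in_u 0 = 0"
  by (simp add: poly_in_u_def)

lemma poly_in_u_pCons: "poly_in_u (pCons a p) = fls_const a + fls_X_inv * poly_in_u p"
  by (simp add: poly_in_u_def map_poly_pCons)

lemma poly_in_u_add: "poly_in_u (p + q) = poly_in_u p + poly_in_u q"
  by (induction p q rule: poly_induct2) (auto simp: poly_in_u_pCons algebra_simps fls_plus_const)

lemma poly_in_u_smult: "poly_in_u (smult a p) = fls_const a * poly_in_u p"
  by (induction p) (auto simp: poly_in_u_pCons algebra_simps fls_const_mult_const)

lemma poly_in_u_mult: "poly_in_u (p * q) = poly_in_u p * poly_in_u q"
  by (induction p) (auto simp: poly_in_u_pCons poly_in_u_add poly_in_u_smult algebra_simps)

lemma poly_in_u_1 [simp]: "poly_in_u 1 = 1"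
  by (simp add: poly_in_u_pCons one_pCons)

lemma shift_fls_X_inv: "shift_fls c fls_X_inv = fls_X_inv - fls_const c"
proof -
  have "fps_to_fls ((1 - fps_const c * fps_X) * shifted_u_inv c) = fls_X"
    unfolding shifted_u_inv_eq by simp
  hence 1: "(1 - fls_const c * fls_X) * fps_to_fls (shifted_u_inv c) = fls_X"
    by (simp add: fls_times_fps_to_fls)
  define x :: "complex fls" where "x = fls_X_inv"
  have x: "x * fls_X = 1" by (simp add: x_def flip: fls_inverse_X)
  have "(x - fls_const c) * fps_to_fls (shifted_u_inv c)
      = x * ((1 - fls_const c * fls_X) * fps_to_fls (shifted_u_inv c)) +
        (x * fls_X - 1) * fls_const c * fps_to_fls (shifted_u_inv c)"
    by (simp only: ring_distribs mult.assoc mult_1) (simp add: mult_ac)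
  also have "\<dots> = 1" unfolding 1 x by simp
  finally have "inverse (fps_to_fls (shifted_u_inv c)) = x - fls_const c"
    by (intro inverse_unique) (simp add: mult.commute)
  thus ?thesis by (simp add: x_def shift_fls_def fls_compose_fps_inverse flip: fls_inverse_X)
qed

lemma poly_in_u_poly_shift: "poly_in_u (poly_shift c p) = shift_fls (- c) (poly_in_u p)"
proof (induction p)
  case (pCons a p)
  have "poly_in_u (poly_shift c (pCons a p)) =
      fls_const a + (fls_const c + fls_X_inv) * poly_in_u (poly_shift c p)"
    by (simp add: poly_shift_def pcompose_pCons poly_in_u_add poly_in_u_mult poly_in_u_smult poly_in_u_pCons algebra_simps)
  also have "\<dots> = shift_fls (-c) (poly_in_u (pCons a p))"
    by (simp add: pCons poly_in_u_pCons shift_fls_add shift_fls_mult shift_fls_X_inv)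
  finally show ?case .
qed (simp add: poly_shift_def)

lemma poly_in_u_nth: "poly_in_u p $$ n = (if n \<le> 0 then coeff p (nat (- n)) else 0)"
proof (induction p arbitrary: n)
  case (pCons a p)
  show ?case
    by (auto simp: poly_in_u_pCons pCons.IH fls_X_inv_times_conv_shift coeff_pCons nat_diff_distrib split: nat.splits)
qed simp

lemma poly_in_u_eq_iff [simp]: "poly_in_u p = poly_in_u q \<longleftrightarrow> p = q"
proof
  assume *: "poly_in_u p = poly_in_u q"
  have "coeff p n = coeff q n" for n
    using arg_cong[OF *, of "\<lambda>f. f $$ (- int n)"] by (simp add: poly_in_u_nth)
  thus "p = q" by (rule poly_eqI)
qed simp

lemma fls_subdegree_poly_in_u: "p \<noteq> 0 \<Longrightarrow> fls_subdegree (poly_in_u p) = - int (degree p)"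
  by (intro fls_subdegree_eqI) (auto simp: poly_in_u_nth coeff_eq_0)

lemma monic_fls_poly_in_u: "monic_fls (poly_in_u p) \<longleftrightarrow> lead_coeff p = 1"
proof (cases "p = 0")
  case False
  thus ?thesis by (simp add: monic_fls_def fls_subdegree_poly_in_u poly_in_u_nth)
qed (simp add: monic_fls_def)

lemma fls_decompose: "\<exists>p h. f = poly_in_u p + fps_to_fls h \<and> h $ 0 = 0"
proof -
  define p where "p = (\<Sum>k\<le>nat (- fls_subdegree f). monom (f $$ (- int k)) k)"
  define h where "h = Abs_fps (\<lambda>n. if n = 0 then 0 else f $$ int n)"
  have c: "coeff p k = f $$ (- int k)" for k
  proof (cases "k \<le> nat (- fls_subdegree f)")
    case False
    hence "f $$ (- int k) = 0" by (intro fls_eq0_below_subdegree) auto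
    thus ?thesis using False by (simp add: p_def coeff_sum sum.delta if_distrib cong: if_cong)
  qed (simp add: p_def coeff_sum)
  have "f = poly_in_u p + fps_to_fls h"
    by (intro fls_eqI) (auto simp: poly_in_u_nth c h_def)
  thus ?thesis by (intro exI[of _ p] exI[of _ h]) (simp add: h_def)
qed

text \<open>A shift respects the splitting into a polynomial and a tail of strictly negative powers
  of \<open>u\<close>. If the difference of \<open>f\<close> is a polynomial, the tail is
  shift-invariant, and without constant term it must vanish.\<close>

lemma iterated_difference_zero_imp_polynomial:
  assumes "c \<noteq> 0" "((\<lambda>f. shift_fls c f - f) ^^ n) f = 0"
  shows "\<exists>p. f = poly_in_u p"
  using assms(2)
proof (induction n arbitrary: f)
  case 0
  thus ?case by (intro exI[of _ 0]) simp
next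
  case (Suc n)
  hence "((\<lambda>f. shift_fls c f - f) ^^ n) (shift_fls c f - f) = 0"
    by (simp only: funpow_Suc_right comp_apply)
  from Suc.IH[OF this] obtain q where q: "shift_fls c f - f = poly_in_u q" by blast
  obtain p h where f: "f = poly_in_u p + fps_to_fls h" and h0: "h $ 0 = 0"
    using fls_decompose by blast
  have "shift_fls c (poly_in_u p) = poly_in_u (poly_shift (- c) p)" by (simp add: poly_in_u_poly_shift)
  hence "poly_in_u (poly_shift (- c) p) + fps_to_fls (h oo shifted_u_inv c) = poly_in_u p + poly_in_u q + fps_to_fls h"
    using q by (simp add: f shift_fls_add shift_fls_fps_to_fls algebra_simps)
  moreover have "poly_in_u (poly_shift (- c) p) = poly_in_u (poly_shift (- c) p - p - q) + (poly_in_u p + poly_in_u q)"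
    by (simp flip: poly_in_u_add)
  moreover have "fps_to_fls (h oo shifted_u_inv c) = fps_to_fls ((h oo shifted_u_inv c) - h) + fps_to_fls h"
    by simp
  moreover have "X + Y = 0" if "X + (P + Q) + (Y + H) = P + Q + H" for X Y P Q H :: "complex fls"
    using that by (simp add: algebra_simps)
  ultimately have "poly_in_u (poly_shift (- c) p - p - q) + fps_to_fls ((h oo shifted_u_inv c) - h) = 0"
    by metis
  moreover define g where "g = (h oo shifted_u_inv c) - h"
  ultimately have *: "poly_in_u (poly_shift (- c) p - p - q) $$ int k + fps_to_fls g $$ int k = 0" for k
    by (metis fls_plus_nth fls_zero_nth)
  have "g $ k = 0" for k
  proof (cases "k = 0")
    case False
    thus ?thesis using *[of k] by (simp add: poly_in_u_nth)
  qed (simp add: g_def h0)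
  hence "g = 0" by (intro fps_ext) simp
  hence "h oo shifted_u_inv c = h" by (simp add: g_def)
  hence "shift_fls c (fps_to_fls h) = fps_to_fls h" by (simp add: shift_fls_fps_to_fls)
  hence "fls_subdegree (fps_to_fls h) = 0" using shift_fls_invariant_subdegree assms(1) by blast
  hence "fps_to_fls h = 0" using h0 nth_fls_subdegree_zero_iff[of "fps_to_fls h"] by auto
  thus ?case using f by auto
qed

section \<open>Series with coefficients in a vector space\<close>

locale complex_space = vector_space sc for sc :: "complex \<Rightarrow> 'v::ab_group_add \<Rightarrow> 'v"
begin

text \<open>The Cauchy product for which \<open>V[[u^-1]]\<close> is a module over scalar series; on
  \<open>'v\<close> itself only addition and \<open>sc\<close> are given.\<close>

definition smult :: "complex fps \<Rightarrow> 'v fps \<Rightarrow> 'v fps" (infixr "\<star>" 75) where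
  "s \<star> \<phi> = Abs_fps (\<lambda>n. \<Sum>i\<le>n. sc (s $ i) (\<phi> $ (n - i)))"

lemma smult_nth: "(s \<star> \<phi>) $ n = (\<Sum>i\<le>n. sc (s $ i) (\<phi> $ (n - i)))"
  by (simp add: smult_def)

lemma smult_const_nth [simp]: "(fps_const c \<star> \<phi>) $ n = sc c (\<phi> $ n)"
proof -
  have "(fps_const c \<star> \<phi>) $ n = (\<Sum>i\<le>n. if i = 0 then sc c (\<phi> $ n) else 0)"
    unfolding smult_nth by (intro sum.cong) auto
  thus ?thesis by simp
qed

lemma smult_fps_const_nth [simp]: "(s \<star> fps_const x) $ n = sc (s $ n) x"
proof -
  have "(s \<star> fps_const x) $ n = (\<Sum>i\<le>n. if i = n then sc (s $ n) x else 0)"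
    unfolding smult_nth by (intro sum.cong) auto
  thus ?thesis by simp
qed

lemma smult_assoc: "s \<star> (t \<star> \<phi>) = (s * t) \<star> \<phi>"
proof (rule fps_ext)
  fix n
  have "(s \<star> (t \<star> \<phi>)) $ n = (\<Sum>i\<le>n. \<Sum>j\<le>n - i. sc (s $ i * t $ j) (\<phi> $ (n - i - j)))"
    by (simp add: smult_nth scale_sum_right)
  also have "\<dots> = (\<Sum>(i, j)\<in>{(i, j). i + j \<le> n}. sc (s $ i * t $ j) (\<phi> $ (n - i - j)))"
    by (subst sum.Sigma) (auto intro!: sum.cong)
  also have "\<dots> = (\<Sum>k\<le>n. \<Sum>i\<le>k. sc (s $ i * t $ (k - i)) (\<phi> $ (n - k)))"
    by (subst sum.triangle_reindex_eq) (auto intro!: sum.cong)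
  also have "\<dots> = ((s * t) \<star> \<phi>) $ n"
    by (simp add: smult_nth fps_mult_nth scale_sum_left atLeast0AtMost)
  finally show "(s \<star> (t \<star> \<phi>)) $ n = ((s * t) \<star> \<phi>) $ n" .
qed

sublocale series: module smult
proof
  show "s \<star> (\<phi> + \<psi>) = s \<star> \<phi> + s \<star> \<psi>" for s \<phi> \<psi>
    by (rule fps_ext) (simp add: smult_nth scale_right_distrib sum.distrib)
  show "(s + t) \<star> \<phi> = s \<star> \<phi> + t \<star> \<phi>" for s t \<phi>
    by (rule fps_ext) (simp add: smult_nth scale_left_distrib sum.distrib)
  show "s \<star> t \<star> \<phi> = (s * t) \<star> \<phi>" for s t \<phi> by (rule smult_assoc)
  show "1 \<star> \<phi> = \<phi>" for \<phi>
    using smult_const_nth[of 1 \<phi>] by (intro fps_ext) simp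
qed

lemma smult_X_power_nth: "(fps_X ^ m \<star> \<phi>) $ n = (if n < m then 0 else \<phi> $ (n - m))"
proof -
  have "(fps_X ^ m \<star> \<phi>) $ n = (\<Sum>i\<le>n. if i = m then \<phi> $ (n - m) else 0)"
    unfolding smult_nth by (intro sum.cong) (auto simp: fps_X_power_nth)
  thus ?thesis by simp
qed

lemma smult_X_cancel: "fps_X \<star> \<phi> = fps_X \<star> \<psi> \<Longrightarrow> \<phi> = \<psi>"
proof (rule fps_ext)
  fix n assume "fps_X \<star> \<phi> = fps_X \<star> \<psi>"
  hence "(fps_X ^ 1 \<star> \<phi>) $ Suc n = (fps_X ^ 1 \<star> \<psi>) $ Suc n" by simp
  thus "\<phi> $ n = \<psi> $ n" unfolding smult_X_power_nth by simp
qed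

lemma smult_const_cancel:
  assumes "fps_const c \<star> \<phi> = fps_const c \<star> \<psi>" "c \<noteq> 0"
  shows "\<phi> = \<psi>"
proof -
  have "fps_const (inverse c) \<star> fps_const c \<star> \<phi> = fps_const (inverse c) \<star> fps_const c \<star> \<psi>"
    using assms by simp
  thus ?thesis using assms(2) by (simp add: fps_const_1_eq_1[symmetric] del: fps_const_1_eq_1 fps_const_mult) (simp add: smult_assoc)
qed

lemma smult_fps_const_eq_iff:
  assumes "x \<noteq> 0" shows "s \<star> fps_const x = t \<star> fps_const x \<longleftrightarrow> s = t"
  using assms by (auto simp: fps_eq_iff scale_cancel_right)

definition flin :: "('v fps \<Rightarrow> 'v fps) \<Rightarrow> bool" where
  "flin T \<longleftrightarrow> (\<forall>\<phi> \<psi>. T (\<phi> + \<psi>) = T \<phi> + T \<psi>) \<and> (\<forall>s \<phi>. T (s \<star> \<phi>) = s \<star> T \<phi>)"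

lemma flinD:
  assumes "flin T"
  shows "T (\<phi> + \<psi>) = T \<phi> + T \<psi>" "T (s \<star> \<phi>) = s \<star> T \<phi>" "T (\<phi> - \<psi>) = T \<phi> - T \<psi>" "T 0 = 0" "T (- \<phi>) = - T \<phi>"
proof -
  show *: "T (\<phi> + \<psi>) = T \<phi> + T \<psi>" "T (s \<star> \<phi>) = s \<star> T \<phi>" for s \<phi> \<psi> using assms by (auto simp: flin_def)
  show "T (\<phi> - \<psi>) = T \<phi> - T \<psi>" using *(1)[of "\<phi> - \<psi>" \<psi>] by (simp add: eq_diff_eq)
  show "T 0 = 0" using *(2)[of 0 0] by simp
  show "T (- \<phi>) = - T \<phi>" using *(2)[of "- 1" \<phi>] by simp
qed

lemma flin_sum: assumes "flin T" shows "T (sum f S) = (\<Sum>x\<in>S. T (f x))"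
  by (induction S rule: infinite_finite_induct) (auto simp: flinD[OF assms])

lemma flin_funpow: "flin T \<Longrightarrow> flin (T ^^ n)"
  by (induction n) (auto simp: flin_def)

lemma flin_smult: "flin T \<Longrightarrow> flin (\<lambda>\<phi>. s \<star> T \<phi>)"
  by (auto simp: flin_def series.scale_right_distrib mult_ac)

lemma flin_add: "flin T \<Longrightarrow> flin U \<Longrightarrow> flin (\<lambda>\<phi>. T \<phi> + U \<phi>)"
  by (auto simp: flin_def series.scale_right_distrib)

lemma flin_diff: "flin T \<Longrightarrow> flin U \<Longrightarrow> flin (\<lambda>\<phi>. T \<phi> - U \<phi>)"
  by (auto simp: flin_def series.scale_right_diff_distrib)

lemma flin_id: "flin (\<lambda>\<phi>. \<phi>)"
  by (auto simp: flin_def)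

text \<open>Linearity over scalar series implies continuity: series agreeing up to order
  \<open>k\<close> differ by a multiple of \<open>X ^ (k + 1)\<close>, and this factor can be pulled
  out of \<open>T\<close>. This is what justifies applying \<open>T\<close> termwise to infinite
  sums.\<close>

lemma flin_nth_cong:
  assumes "flin T" "\<And>i. i \<le> k \<Longrightarrow> \<phi> $ i = \<psi> $ i"
  shows "T \<phi> $ k = T \<psi> $ k"
proof -
  define \<omega> where "\<omega> = Abs_fps (\<lambda>n. (\<phi> - \<psi>) $ (n + Suc k))"
  have "\<phi> = \<psi> + fps_X ^ Suc k \<star> \<omega>"
    using assms(2) by (intro fps_ext) (auto simp: smult_X_power_nth \<omega>_def simp del: power_Suc)
  hence "T \<phi> = T \<psi> + fps_X ^ Suc k \<star> T \<omega>" by (simp only: flinD[OF assms(1)])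
  thus ?thesis by (simp add: smult_X_power_nth del: power_Suc)
qed

lemma smult_nth_cong:
  assumes "\<And>i. i \<le> k \<Longrightarrow> \<phi> $ i = \<psi> $ i"
  shows "(s \<star> \<phi>) $ k = (s \<star> \<psi>) $ k"
  using assms by (simp add: smult_nth)

definition lift :: "('v \<Rightarrow> 'v) \<Rightarrow> 'v fps \<Rightarrow> 'v fps" where
  "lift T \<phi> = Abs_fps (\<lambda>n. T (\<phi> $ n))"

lemma lift_nth [simp]: "lift T \<phi> $ n = T (\<phi> $ n)"
  by (simp add: lift_def)

lemma lift_fps_const: "T 0 = 0 \<Longrightarrow> lift T (fps_const x) = fps_const (T x)"
  by (rule fps_ext) simp

definition lin :: "('v \<Rightarrow> 'v) \<Rightarrow> bool" where
  "lin T \<longleftrightarrow> (\<forall>x y. T (x + y) = T x + T y) \<and> (\<forall>c x. T (sc c x) = sc c (T x))"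

lemma linD:
  assumes "lin T"
  shows "T (x + y) = T x + T y" "T (sc c x) = sc c (T x)" "T 0 = 0" "T (x - y) = T x - T y"
proof -
  show *: "T (x + y) = T x + T y" "T (sc c x) = sc c (T x)" for x y c using assms by (auto simp: lin_def)
  show "T 0 = 0" using *(2)[of 0 0] by simp
  show "T (x - y) = T x - T y" using *(1)[of "x - y" y] by (simp add: eq_diff_eq)
qed

lemma lin_sum: assumes "lin T" shows "T (sum f S) = (\<Sum>x\<in>S. T (f x))"
  by (induction S rule: infinite_finite_induct) (auto simp: linD[OF assms])

lemma flin_lift: assumes "lin T" shows "flin (lift T)"
  unfolding flin_def
  by (auto intro!: fps_ext simp: linD[OF assms] smult_nth lin_sum[OF assms])

text \<open>\<open>E\<close> maps the power \<open>k + 1\<close> of \<open>F\<close> on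
  \<open>y\<close> to \<open>\<delta> (k + 1) (N - k)\<close> times the power \<open>k\<close>, and
  this factor is nonzero for \<open>k < N\<close>. The roles of \<open>E\<close> and
  \<open>F\<close> are left open, so that strings can be followed in either direction.\<close>

lemma sl2_string_nonzero:
  assumes "lin E" "\<And>x. E (F x) = F (E x) + H x" "lin F"
    and "E y = 0" "y \<noteq> 0" "\<And>q. H ((F ^^ q) y) = sc (\<delta> * (of_nat N - 2 * of_nat q)) ((F ^^ q) y)"
    and "\<delta> \<noteq> 0" "q \<le> N"
  shows "(F ^^ q) y \<noteq> 0"
proof -
  have EF: "E ((F ^^ Suc k) y) = sc (\<delta> * (of_nat k + 1) * (of_nat N - of_nat k)) ((F ^^ k) y)" for k
  proof (induction k)
    case 0
    show ?case using assms(2)[of y] assms(4) assms(6)[of 0] linD(3)[OF assms(3)] by simp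
  next
    case (Suc k)
    have "E ((F ^^ Suc (Suc k)) y) = F (E ((F ^^ Suc k) y)) + H ((F ^^ Suc k) y)"
      using assms(2) by simp
    also have "\<dots> = sc (\<delta> * (of_nat k + 1) * (of_nat N - of_nat k)) ((F ^^ Suc k) y) +
       sc (\<delta> * (of_nat N - 2 * of_nat (Suc k))) ((F ^^ Suc k) y)"
      unfolding Suc.IH assms(6) by (simp add: linD[OF assms(3)])
    also have "\<dots> = sc (\<delta> * (of_nat (Suc k) + 1) * (of_nat N - of_nat (Suc k))) ((F ^^ Suc k) y)"
      unfolding scale_left_distrib[symmetric]
      by (rule arg_cong[where f = "\<lambda>s. sc s _"]) (simp add: algebra_simps)
    finally show ?case .
  qed
  show ?thesis using assms(8)
  proof (induction q)
    case (Suc k)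
    have "of_nat k + 1 \<noteq> (0::complex)" by (metis of_nat_Suc of_nat_eq_0_iff nat.distinct(1) add.commute)
    moreover have "of_nat N - of_nat k \<noteq> (0::complex)" using Suc.prems by simp
    ultimately have "E ((F ^^ Suc k) y) \<noteq> 0" unfolding EF using Suc assms(7) by simp
    thus ?case using linD(3)[OF assms(1)] by auto
  qed (simp add: assms(5))
qed

text \<open>
  The infinite sum of \<open>(u - c)\<^sup>-\<^sup>N\<^sup>-\<^sup>1 \<psi>\<^sub>N\<close>; its terms with \<open>N \<ge> k\<close> do not contribute to the
  coefficient of \<open>u\<^sup>-\<^sup>k\<close>.
\<close>

definition gen_series :: "complex \<Rightarrow> (nat \<Rightarrow> 'v fps) \<Rightarrow> 'v fps" where
  "gen_series c \<psi> = Abs_fps (\<lambda>k. (\<Sum>N\<le>k. shifted_u_inv c ^ Suc N \<star> \<psi> N) $ k)"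

lemma shifted_u_inv_power_nth: "n < m \<Longrightarrow> (shifted_u_inv c ^ m) $ n = 0"
  by (rule startsby_zero_power_prefix[rule_format]) auto

lemma gen_series_nth:
  assumes "k \<le> K"
  shows "gen_series c \<psi> $ k = (\<Sum>N\<le>K. shifted_u_inv c ^ Suc N \<star> \<psi> N) $ k"
proof -
  have "(shifted_u_inv c ^ Suc N \<star> \<psi> N) $ k = 0" if "N \<in> {..K} - {..k}" for N
    using that unfolding smult_nth
    by (intro sum.neutral ballI) (simp add: shifted_u_inv_power_nth del: power_Suc)
  thus ?thesis using assms
    by (auto simp: gen_series_def fps_sum_nth simp del: power_Suc intro!: sum.mono_neutral_left)
qed

lemma gen_series_rec: "gen_series c \<psi> = shifted_u_inv c \<star> (\<psi> 0 + gen_series c (\<lambda>n. \<psi> (Suc n)))"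
proof (rule fps_ext)
  fix k
  let ?p = "shifted_u_inv c"
  have "gen_series c \<psi> $ k = (\<Sum>N\<le>Suc k. ?p ^ Suc N \<star> \<psi> N) $ k"
    by (rule gen_series_nth) simp
  also have "(\<Sum>N\<le>Suc k. ?p ^ Suc N \<star> \<psi> N) = ?p \<star> \<psi> 0 + (\<Sum>N\<le>k. ?p ^ Suc (Suc N) \<star> \<psi> (Suc N))"
    by (subst sum.atMost_Suc_shift) simp
  also have "\<dots> = ?p \<star> (\<psi> 0 + (\<Sum>N\<le>k. ?p ^ Suc N \<star> \<psi> (Suc N)))"
    by (simp add: series.scale_right_distrib series.scale_sum_right)
  also have "\<dots> $ k = (?p \<star> (\<psi> 0 + gen_series c (\<lambda>n. \<psi> (Suc n)))) $ k"
    by (intro smult_nth_cong) (simp add: gen_series_nth del: power_Suc)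
  finally show "gen_series c \<psi> $ k = (?p \<star> (\<psi> 0 + gen_series c (\<lambda>n. \<psi> (Suc n)))) $ k" .
qed

lemma gen_series_rec': "(1 - fps_const c * fps_X) \<star> gen_series c \<psi> = fps_X \<star> (\<psi> 0 + gen_series c (\<lambda>n. \<psi> (Suc n)))"
  by (subst gen_series_rec) (simp only: smult_assoc shifted_u_inv_eq)

lemma gen_series_add: "gen_series c (\<lambda>n. \<psi> n + \<chi> n) = gen_series c \<psi> + gen_series c \<chi>"
  by (rule fps_ext) (simp add: gen_series_def series.scale_right_distrib sum.distrib)

lemma gen_series_flin: assumes "flin T" shows "T (gen_series c \<psi>) = gen_series c (\<lambda>n. T (\<psi> n))"
proof (rule fps_ext)
  fix k
  have "T (gen_series c \<psi>) $ k = T (\<Sum>N\<le>k. shifted_u_inv c ^ Suc N \<star> \<psi> N) $ k"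
    by (rule flin_nth_cong[OF assms]) (rule gen_series_nth)
  thus "T (gen_series c \<psi>) $ k = gen_series c (\<lambda>n. T (\<psi> n)) $ k"
    by (simp add: flin_sum[OF assms] flinD[OF assms] gen_series_def)
qed

lemma gen_series_smult: "gen_series c (\<lambda>n. s \<star> \<psi> n) = s \<star> gen_series c \<psi>"
  using gen_series_flin[OF flin_smult[OF flin_id], of s c \<psi>] by simp

lemma gen_series_diff: "gen_series c (\<lambda>n. \<psi> n - \<chi> n) = gen_series c \<psi> - gen_series c \<chi>"
  using gen_series_add[of c "\<lambda>n. \<psi> n - \<chi> n" \<chi>] by (simp add: eq_diff_eq)

lemma gen_series_0 [simp]: "gen_series c (\<lambda>n. 0) = 0"
  using gen_series_diff[of c "\<lambda>n. 0" "\<lambda>n. 0"] by simp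

text \<open>For scalar terms the infinite sum is an ordinary substitution. The index moves by one
  because \<open>b n\<close> belongs to the exponent \<open>n + 1\<close>.\<close>

lemma gen_series_scalar:
  "fps_const \<eta> \<star> gen_series c (\<lambda>n. fps_const (b n) \<star> \<phi>)
     = (Abs_fps (\<lambda>n. if n = 0 then 0 else \<eta> * b (n - 1)) oo shifted_u_inv c) \<star> \<phi>"
proof (rule fps_ext)
  fix k
  let ?p = "shifted_u_inv c" and ?G = "Abs_fps (\<lambda>n. if n = 0 then 0 else \<eta> * b (n - 1))"
  have "(fps_const \<eta> \<star> gen_series c (\<lambda>n. fps_const (b n) \<star> \<phi>)) $ k
      = (fps_const \<eta> \<star> (\<Sum>N\<le>k. ?p ^ Suc N \<star> fps_const (b N) \<star> \<phi>)) $ k"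
    by (intro smult_nth_cong gen_series_nth)
  also have "fps_const \<eta> \<star> (\<Sum>N\<le>k. ?p ^ Suc N \<star> fps_const (b N) \<star> \<phi>)
      = (\<Sum>N\<le>k. fps_const (\<eta> * b N) * ?p ^ Suc N) \<star> \<phi>"
    by (simp add: series.scale_sum_left series.scale_sum_right mult_ac flip: fps_const_mult)
  also have "\<dots> $ k = ((?G oo ?p) \<star> \<phi>) $ k"
    unfolding smult_nth
  proof (intro sum.cong refl, goal_cases)
    case (1 i)
    have "(\<Sum>N\<le>k. fps_const (\<eta> * b N) * ?p ^ Suc N) $ i = (\<Sum>N\<le>k. \<eta> * b N * (?p ^ Suc N) $ i)"
      by (simp add: fps_sum_nth del: power_Suc)
    also have "\<dots> = (\<Sum>N\<le>Suc k. ?G $ N * (?p ^ N) $ i)"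
      by (subst sum.atMost_Suc_shift) (simp del: power_Suc)
    also have "\<dots> = (\<Sum>N\<in>{0..i}. ?G $ N * (?p ^ N) $ i)"
      using 1 by (intro sum.mono_neutral_right) (auto simp: shifted_u_inv_power_nth)
    finally show ?case by (simp add: fps_compose_nth)
  qed
  finally show "(fps_const \<eta> \<star> gen_series c (\<lambda>n. fps_const (b n) \<star> \<phi>)) $ k = ((?G oo ?p) \<star> \<phi>) $ k" .
qed

text \<open>
  All defining relations of the Yangian compare \<open>z\<^sub>r\<^sub>+\<^sub>1\<^sub>,\<^sub>s\<close> with \<open>z\<^sub>r\<^sub>,\<^sub>s\<^sub>+\<^sub>1\<close>. In the double series
  these shifts are multiplications by \<open>u - c\<close> and by \<open>u - d\<close>, up to boundary terms.
\<close>

lemma gen_series_telescope: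
  fixes z :: "nat \<Rightarrow> nat \<Rightarrow> 'v fps" and c d :: complex
  defines "Z \<equiv> \<lambda>z. gen_series c (\<lambda>r. gen_series d (\<lambda>s. z r s))"
  assumes "\<And>r s. z (Suc r) s - z r (Suc s) = t r s"
  shows "fps_const (d - c) \<star> Z z = gen_series d (\<lambda>s. z 0 s) - gen_series c (\<lambda>r. z r 0) + Z t"
proof -
  let ?A = "gen_series d (\<lambda>s. z 0 s)" and ?B = "gen_series c (\<lambda>r. z r 0)"
  let ?Z1 = "Z (\<lambda>r s. z (Suc r) s)" and ?Z2 = "Z (\<lambda>r s. z r (Suc s))"
  have 1: "(1 - fps_const c * fps_X) \<star> Z z = fps_X \<star> (?A + ?Z1)"
    unfolding Z_def by (rule gen_series_rec')
  have "Z z = shifted_u_inv d \<star> gen_series c (\<lambda>r. z r 0 + gen_series d (\<lambda>s. z r (Suc s)))"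
    unfolding Z_def by (subst gen_series_rec[of d]) (rule gen_series_smult)
  hence 2: "(1 - fps_const d * fps_X) \<star> Z z = fps_X \<star> (?B + ?Z2)"
    by (simp only: smult_assoc shifted_u_inv_eq gen_series_add Z_def)
  have 3: "?Z1 - ?Z2 = Z t" by (simp add: Z_def assms flip: gen_series_diff)
  \<comment> \<open>The factors \<open>1 - c X\<close> and \<open>1 - d X\<close> differ by
    \<open>(d - c) X\<close>, so the difference of the two recursions isolates \<open>Z z\<close> up
    to a factor \<open>X\<close>, which can be cancelled.\<close>
  have "fps_X \<star> (fps_const (d - c) \<star> Z z) = (1 - fps_const c * fps_X) \<star> Z z - (1 - fps_const d * fps_X) \<star> Z z"
    by (simp add: algebra_simps flip: fps_const_sub series.scale_left_diff_distrib)
  also have "\<dots> = fps_X \<star> (?A - ?B + (?Z1 - ?Z2))"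
    unfolding 1 2 series.scale_right_diff_distrib[symmetric] by (simp only: add_diff_add)
  finally show ?thesis unfolding 3 by (rule smult_X_cancel)
qed

text \<open>This is the generating series of the \<open>T r\<close> in powers of
  \<open>(u - c)^-1\<close>. The base point \<open>c\<close> allows several spectral parameters
  within one formal variable.\<close>

definition op_series :: "complex \<Rightarrow> (nat \<Rightarrow> 'v \<Rightarrow> 'v) \<Rightarrow> 'v fps \<Rightarrow> 'v fps" where
  "op_series c T \<phi> = gen_series c (\<lambda>r. lift (T r) \<phi>)"

lemma flin_op_series:
  assumes "\<And>r. lin (T r)" shows "flin (op_series c T)"
  using flinD[OF flin_lift[OF assms]]
  by (simp add: flin_def op_series_def gen_series_add gen_series_smult)

text \<open>Both orders of composition are written with the same nesting of sums, so that
  commutators can be formed termwise and fed into \<open>gen_series_telescope\<close>.\<close>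

lemma op_series_op_series:
  assumes "\<And>r. lin (T r)" "\<And>r. lin (U r)"
  shows "op_series c T (op_series d U \<phi>) = gen_series c (\<lambda>r. gen_series d (\<lambda>s. lift (T r) (lift (U s) \<phi>)))"
    and "op_series d U (op_series c T \<phi>) = gen_series c (\<lambda>r. gen_series d (\<lambda>s. lift (U s) (lift (T r) \<phi>)))"
proof -
  show "op_series c T (op_series d U \<phi>) = gen_series c (\<lambda>r. gen_series d (\<lambda>s. lift (T r) (lift (U s) \<phi>)))"
    by (simp add: op_series_def gen_series_flin[OF flin_lift[OF assms(1)]])
  show "op_series d U (op_series c T \<phi>) = gen_series c (\<lambda>r. gen_series d (\<lambda>s. lift (U s) (lift (T r) \<phi>)))"
    unfolding op_series_def[of c] gen_series_flin[OF flin_op_series[OF assms(2)]]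
    by (simp add: op_series_def)
qed

lemma lift_op_series:
  assumes "lin U"
  shows "lift U (op_series c T \<phi>) = gen_series c (\<lambda>r. lift U (lift (T r) \<phi>))"
  by (simp add: op_series_def gen_series_flin[OF flin_lift[OF assms]])

end

section \<open>Extremal strings of weight spaces\<close>

text \<open>
  The Yangian of \<open>sl\<^sub>2\<close> attached to a simple root, acting on a string of weight spaces
  \<open>S 0, S 1, \<dots>\<close> of weights \<open>\<mu>, \<mu> - \<alpha>, \<dots>\<close>, where \<open>\<mu>\<close> is extremal.
\<close>

locale extremal_string = complex_space sc for sc :: "complex \<Rightarrow> 'v::ab_group_add \<Rightarrow> 'v" +
  fixes xp xm xi :: "nat \<Rightarrow> 'v \<Rightarrow> 'v" and \<delta> hbar :: complex and S :: "nat \<Rightarrow> 'v set" and m :: nat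
    and y :: 'v and \<gamma> :: "nat \<Rightarrow> complex"
  assumes lin_xp: "lin (xp r)" and lin_xm: "lin (xm r)" and lin_xi: "lin (xi r)"
    and hbar: "hbar \<noteq> 0" and \<delta>: "\<delta> \<noteq> 0"
    and mm: "xm (Suc r) (xm s x) - xm s (xm (Suc r) x) - (xm r (xm (Suc s) x) - xm (Suc s) (xm r x))
               = sc (- (hbar * \<delta>)) (xm r (xm s x) + xm s (xm r x))"
    and pm: "xp r (xm s x) - xm s (xp r x) = xi (r + s) x"
    and S_subspace: "subspace (S k)"
    and xm_S: "x \<in> S k \<Longrightarrow> xm r x \<in> S (Suc k)"
    and xp_S: "x \<in> S (Suc k) \<Longrightarrow> xp r x \<in> S k"
    and xi0_S: "x \<in> S k \<Longrightarrow> xi 0 x = sc (\<delta> * (of_nat m - 2 * of_nat k)) x"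
    and S_bottom: "x \<in> S (Suc m) \<Longrightarrow> x = 0"
    and S_top: "x \<in> S 0 \<Longrightarrow> \<exists>c. x = sc c y"
    and y_S: "y \<in> S 0" and y_nz: "y \<noteq> 0"
    and xp_y: "xp r y = 0" and xi_y: "xi r y = sc (\<gamma> r) y"
begin

section \<open>Commutation relations of the generating series\<close>

abbreviation "\<eta> \<equiv> hbar * \<delta>"
abbreviation "C c \<equiv> op_series c xm"
abbreviation "D c \<equiv> op_series c xp"
abbreviation "B c \<equiv> op_series c xi"
abbreviation "f \<equiv> lift (xm 0)"
abbreviation "e \<equiv> lift (xp 0)"
abbreviation "h \<equiv> lift (xi 0)"

lemmas fl = flin_lift[OF lin_xm] flin_lift[OF lin_xp] flin_lift[OF lin_xi]
  flin_op_series[of xm, OF lin_xm] flin_op_series[of xp, OF lin_xp] flin_op_series[of xi, OF lin_xi]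

lemmas fl_simps = flinD(1)[OF fl(1)] flinD(1)[OF fl(2)] flinD(1)[OF fl(3)] flinD(1)[OF fl(4)] flinD(1)[OF fl(5)] flinD(1)[OF fl(6)]
   flinD(2)[OF fl(1)] flinD(2)[OF fl(2)] flinD(2)[OF fl(3)] flinD(2)[OF fl(4)] flinD(2)[OF fl(5)] flinD(2)[OF fl(6)]
   flinD(3)[OF fl(1)] flinD(3)[OF fl(2)] flinD(3)[OF fl(3)] flinD(3)[OF fl(4)] flinD(3)[OF fl(5)] flinD(3)[OF fl(6)]
   flinD(4)[OF fl(1)] flinD(4)[OF fl(2)] flinD(4)[OF fl(3)] flinD(4)[OF fl(4)] flinD(4)[OF fl(5)] flinD(4)[OF fl(6)]

text \<open>Telescoping with equal base points makes the left-hand side zero. The two boundary terms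
  are the commutator of \<open>f\<close> and \<open>C\<close> and its negative, so the relation
  first appears with a factor 2.\<close>

lemma comm_f_C: "f (C c \<phi>) = C c (f \<phi>) + fps_const \<eta> \<star> C c (C c \<phi>)"
proof -
  let ?z = "\<lambda>r s. lift (xm r) (lift (xm s) \<phi>) - lift (xm s) (lift (xm r) \<phi>)"
  let ?t = "\<lambda>r s. fps_const (- \<eta>) \<star> (lift (xm r) (lift (xm s) \<phi>) + lift (xm s) (lift (xm r) \<phi>))"
  have "fps_const (c - c) \<star> gen_series c (\<lambda>r. gen_series c (?z r)) =
     gen_series c (?z 0) - gen_series c (\<lambda>r. ?z r 0) + gen_series c (\<lambda>r. gen_series c (?t r))"
    by (rule gen_series_telescope) (rule fps_ext, simp add: mm)
  moreover have "gen_series c (?z 0) = f (C c \<phi>) - C c (f \<phi>)"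
    by (simp add: gen_series_diff lift_op_series[OF lin_xm]) (simp add: op_series_def)
  moreover have "gen_series c (\<lambda>r. ?z r 0) = C c (f \<phi>) - f (C c \<phi>)"
    by (simp add: gen_series_diff lift_op_series[OF lin_xm]) (simp add: op_series_def)
  moreover have "gen_series c (\<lambda>r. gen_series c (?t r)) = fps_const (- \<eta>) \<star> (C c (C c \<phi>) + C c (C c \<phi>))"
    unfolding gen_series_smult gen_series_add op_series_op_series(1)[OF lin_xm lin_xm, symmetric]
      op_series_op_series(2)[OF lin_xm lin_xm, symmetric] by simp
  ultimately have "0 = (f (C c \<phi>) - C c (f \<phi>)) - (C c (f \<phi>) - f (C c \<phi>)) + fps_const (- \<eta>) \<star> (C c (C c \<phi>) + C c (C c \<phi>))"
    by simp
  hence "fps_const 2 \<star> f (C c \<phi>) = fps_const 2 \<star> (C c (f \<phi>) + fps_const \<eta> \<star> C c (C c \<phi>))"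
  proof -
    have two: "fps_const 2 \<star> \<psi> = \<psi> + \<psi>" for \<psi>
      by (rule fps_ext) (metis fps_add_nth one_add_one scale_left_distrib scale_one smult_const_nth)
    have neg: "fps_const (- \<eta>) \<star> \<psi> = - (fps_const \<eta> \<star> \<psi>)" for \<psi>
      by (rule fps_ext) simp
    assume "0 = (f (C c \<phi>) - C c (f \<phi>)) - (C c (f \<phi>) - f (C c \<phi>)) + fps_const (- \<eta>) \<star> (C c (C c \<phi>) + C c (C c \<phi>))"
    thus ?thesis unfolding two neg by (simp add: algebra_simps)
  qed
  thus ?thesis by (rule smult_const_cancel) simp
qed

lemma comm_e_C: "e (C c \<phi>) = C c (e \<phi>) + B c \<phi>"
proof -
  have "e (C c \<phi>) - C c (e \<phi>) = gen_series c (\<lambda>s. e (lift (xm s) \<phi>) - lift (xm s) (e \<phi>))"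
    by (simp add: gen_series_diff lift_op_series[OF lin_xp]) (simp add: op_series_def)
  also have "(\<lambda>s. e (lift (xm s) \<phi>) - lift (xm s) (e \<phi>)) = (\<lambda>s. lift (xi s) \<phi>)"
    by (rule ext, rule fps_ext) (simp add: pm)
  finally show ?thesis by (simp add: op_series_def diff_eq_eq add.commute)
qed

lemma comm_D_f: "D c (f \<phi>) = f (D c \<phi>) + B c \<phi>"
proof -
  have "D c (f \<phi>) - f (D c \<phi>) = gen_series c (\<lambda>s. lift (xp s) (f \<phi>) - f (lift (xp s) \<phi>))"
    by (simp add: gen_series_diff lift_op_series[OF lin_xm]) (simp add: op_series_def)
  also have "(\<lambda>s. lift (xp s) (f \<phi>) - f (lift (xp s) \<phi>)) = (\<lambda>s. lift (xi s) \<phi>)"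
    by (rule ext, rule fps_ext) (simp add: pm)
  finally show ?thesis by (simp add: op_series_def diff_eq_eq add.commute)
qed

lemma comm_e_f: "e (f \<phi>) = f (e \<phi>) + h \<phi>"
proof (rule fps_ext)
  fix n show "e (f \<phi>) $ n = (f (e \<phi>) + h \<phi>) $ n"
    using pm[of 0 0 "\<phi> $ n"] by (simp add: diff_eq_eq add.commute)
qed

text \<open>The commutator of \<open>xp r\<close> and \<open>xm s\<close> depends only on
  \<open>r + s\<close>, so telescoping leaves only the boundary terms.\<close>

lemma comm_D_C: "fps_const (d - c) \<star> (D c (C d \<phi>) - C d (D c \<phi>)) = B d \<phi> - B c \<phi>"
proof -
  let ?z = "\<lambda>r s. lift (xp r) (lift (xm s) \<phi>) - lift (xm s) (lift (xp r) \<phi>)"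
  have z: "?z r s = lift (xi (r + s)) \<phi>" for r s
    by (rule fps_ext) (simp add: pm)
  have "fps_const (d - c) \<star> gen_series c (\<lambda>r. gen_series d (?z r)) =
     gen_series d (?z 0) - gen_series c (\<lambda>r. ?z r 0) + gen_series c (\<lambda>r. gen_series d (\<lambda>s. 0))"
    by (rule gen_series_telescope) (simp only: z add_Suc add_Suc_right diff_self)
  moreover have "gen_series c (\<lambda>r. gen_series d (?z r)) = D c (C d \<phi>) - C d (D c \<phi>)"
    unfolding gen_series_diff op_series_op_series(1)[OF lin_xp lin_xm, symmetric]
      op_series_op_series(2)[OF lin_xp lin_xm, symmetric] by simp
  moreover have "gen_series d (?z 0) = B d \<phi>" "gen_series c (\<lambda>r. ?z r 0) = B c \<phi>"
    by (simp_all only: z op_series_def add_0 add_0_right)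
  ultimately show ?thesis by simp
qed

text \<open>For every \<open>n\<close> the operators \<open>E c n\<close>, \<open>F c n\<close> and \<open>h\<close> form an \<open>sl\<^sub>2\<close>-triple.\<close>

definition F :: "complex \<Rightarrow> complex \<Rightarrow> 'v fps \<Rightarrow> 'v fps" where
  "F c n \<phi> = f \<phi> + fps_const (n * \<eta>) \<star> C c \<phi>"

definition E :: "complex \<Rightarrow> complex \<Rightarrow> 'v fps \<Rightarrow> 'v fps" where
  "E c n \<phi> = e \<phi> - fps_const (n * \<eta>) \<star> D (c - n * \<eta>) \<phi>"

lemma flin_F: "flin (F c n)"
  unfolding F_def[abs_def] by (intro flin_add flin_smult fl)

lemma flin_E: "flin (E c n)"
  unfolding E_def[abs_def] by (intro flin_diff flin_smult fl)

text \<open>The base points of \<open>C\<close> and of the \<open>D\<close> inside \<open>E\<close>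
  differ by \<open>n * \<eta>\<close>, which is also the coefficient of \<open>D\<close>. Hence
  \<open>comm_D_C\<close> applies without division, and its term \<open>B c\<close> cancels the one
  produced by \<open>e\<close>.\<close>

lemma comm_E_C: "E c n (C c \<phi>) = C c (E c n \<phi>) + B (c - n * \<eta>) \<phi>"
proof -
  have "fps_const (n * \<eta>) \<star> D (c - n * \<eta>) (C c \<phi>) = fps_const (n * \<eta>) \<star> C c (D (c - n * \<eta>) \<phi>) + (B c \<phi> - B (c - n * \<eta>) \<phi>)"
    using comm_D_C[of c "c - n * \<eta>" \<phi>] by (simp add: series.scale_right_diff_distrib algebra_simps)
  thus ?thesis by (simp add: E_def comm_e_C fl_simps del: fps_const_mult)
qed

text \<open>The remaining multiples of \<open>B (c - n * \<eta>)\<close>, one from \<open>C\<close>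
  and one from the commutator of \<open>D\<close> with \<open>f\<close>, have opposite
  signs.\<close>

lemma comm_E_F: "E c n (F c n \<phi>) = F c n (E c n \<phi>) + h \<phi>"
proof -
  let ?k = "fps_const (n * \<eta>)"
  have "E c n (F c n \<phi>) = E c n (f \<phi>) + ?k \<star> E c n (C c \<phi>)"
    by (simp only: F_def flinD[OF flin_E])
  also have "E c n (f \<phi>) = f (E c n \<phi>) + h \<phi> - ?k \<star> B (c - n * \<eta>) \<phi>"
    by (simp add: E_def comm_e_f comm_D_f fl_simps series.scale_right_distrib del: fps_const_mult)
  finally show ?thesis
    by (simp add: comm_E_C F_def series.scale_right_distrib algebra_simps del: fps_const_mult)
qed

lemma F_Suc: "F c (n + 1) \<phi> = F c n \<phi> + fps_const \<eta> \<star> C c \<phi>"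
proof -
  have "fps_const ((n + 1) * \<eta>) = fps_const (n * \<eta>) + fps_const \<eta>" by (simp add: algebra_simps)
  thus ?thesis by (simp only: F_def series.scale_left_distrib add.assoc)
qed

text \<open>This is \<open>comm_f_C\<close> read as an exchange rule: moving \<open>C\<close> across
  \<open>F\<close> lowers the parameter by one.\<close>

lemma C_F_Suc: "C c (F c (n + 1) \<phi>) = F c n (C c \<phi>)"
proof -
  have "C c (f \<phi>) + fps_const \<eta> \<star> C c (C c \<phi>) = f (C c \<phi>)" by (simp add: comm_f_C)
  thus ?thesis unfolding F_Suc
    by (simp add: F_def fl_simps algebra_simps del: fps_const_mult)
qed

text \<open>\<open>f\<close> and \<open>C\<close> generate a Jordan plane, so the powers of \<open>f + n \<eta> C\<close> telescope in \<open>n\<close>.\<close>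

lemma F_Suc_power:
  "(F c (n + 1) ^^ k) \<phi> = (F c n ^^ k) \<phi> + fps_const (of_nat k * \<eta>) \<star> (F c n ^^ (k - 1)) (C c \<phi>)"
proof (induction k arbitrary: \<phi>)
  case (Suc k)
  have "(F c (n + 1) ^^ Suc k) \<phi> = (F c (n + 1) ^^ k) (F c (n + 1) \<phi>)"
    by (simp only: funpow_Suc_right comp_apply)
  also have "\<dots> = (F c n ^^ k) (F c (n + 1) \<phi>) + fps_const (of_nat k * \<eta>) \<star> (F c n ^^ (k - 1)) (C c (F c (n + 1) \<phi>))"
    by (rule Suc.IH)
  also have "(F c n ^^ k) (F c (n + 1) \<phi>) = (F c n ^^ Suc k) \<phi> + fps_const \<eta> \<star> (F c n ^^ k) (C c \<phi>)"
    unfolding F_Suc flinD[OF flin_funpow[OF flin_F]] by (simp only: funpow_Suc_right comp_apply)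
  also have "fps_const (of_nat k * \<eta>) \<star> (F c n ^^ (k - 1)) (C c (F c (n + 1) \<phi>))
      = fps_const (of_nat k * \<eta>) \<star> (F c n ^^ k) (C c \<phi>)"
    unfolding C_F_Suc
  \<comment> \<open>For \<open>k = 0\<close> the truncated exponent \<open>k - 1\<close> is
    harmless, since its coefficient \<open>of_nat k\<close> vanishes.\<close>
  proof (cases k)
    case (Suc l)
    have "(F c n ^^ (k - 1)) (F c n (C c \<phi>)) = (F c n ^^ k) (C c \<phi>)"
      unfolding Suc by (simp only: funpow_Suc_right comp_apply diff_Suc_1)
    thus "fps_const (of_nat k * \<eta>) \<star> (F c n ^^ (k - 1)) (F c n (C c \<phi>)) = fps_const (of_nat k * \<eta>) \<star> (F c n ^^ k) (C c \<phi>)"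
      by simp
  qed simp
  finally show ?case
    by (simp only: add.assoc series.scale_left_distrib[symmetric] fps_const_add diff_Suc_1) (simp add: algebra_simps)
qed simp

section \<open>The string of weight spaces and the powers of \<open>F\<close>\<close>

definition MS :: "nat \<Rightarrow> 'v fps \<Rightarrow> bool" where
  "MS k \<phi> \<longleftrightarrow> (\<forall>n. \<phi> $ n \<in> S k)"

lemma MS_add: "MS k \<phi> \<Longrightarrow> MS k \<psi> \<Longrightarrow> MS k (\<phi> + \<psi>)"
  and MS_diff: "MS k \<phi> \<Longrightarrow> MS k \<psi> \<Longrightarrow> MS k (\<phi> - \<psi>)"
  and MS_smult: "MS k \<phi> \<Longrightarrow> MS k (s \<star> \<phi>)"
  using S_subspace[of k]
  by (auto simp: MS_def smult_nth intro!: subspace_add subspace_diff subspace_sum subspace_scale)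

lemma MS_gen_series: "(\<And>r. MS k (\<psi> r)) \<Longrightarrow> MS k (gen_series c \<psi>)"
  using S_subspace[of k] MS_smult[of k]
  by (auto simp: MS_def gen_series_def fps_sum_nth intro!: subspace_sum simp del: power_Suc)

lemma MS_F: "MS k \<phi> \<Longrightarrow> MS (Suc k) (F c n \<phi>)"
  and MS_C: "MS k \<phi> \<Longrightarrow> MS (Suc k) (C c \<phi>)"
proof -
  show C: "MS k \<phi> \<Longrightarrow> MS (Suc k) (C c \<phi>)"
    unfolding op_series_def by (intro MS_gen_series) (auto simp: MS_def xm_S)
  show "MS k \<phi> \<Longrightarrow> MS (Suc k) (F c n \<phi>)"
    unfolding F_def by (intro MS_add MS_smult C) (auto simp: MS_def xm_S)
qed

lemma MS_F_power: "MS j \<phi> \<Longrightarrow> MS (j + k) ((F c n ^^ k) \<phi>)"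
  by (induction k) (auto intro: MS_F)

lemma h_MS: "MS k \<phi> \<Longrightarrow> h \<phi> = fps_const (\<delta> * (of_nat m - 2 * of_nat k)) \<star> \<phi>"
  by (rule fps_ext) (simp add: MS_def xi0_S)

lemma E_F_power:
  assumes "MS j \<phi>" "E c n \<phi> = 0"
  shows "E c n ((F c n ^^ Suc k) \<phi>) = fps_const (\<delta> * (of_nat k + 1) * (of_nat m - 2 * of_nat j - of_nat k)) \<star> (F c n ^^ k) \<phi>"
proof (induction k)
  case 0
  show ?case using comm_E_F[of c n \<phi>] assms h_MS[OF assms(1)] by (simp add: flinD[OF flin_F] algebra_simps)
next
  case (Suc k)
  have "E c n ((F c n ^^ Suc (Suc k)) \<phi>) = F c n (E c n ((F c n ^^ Suc k) \<phi>)) + h ((F c n ^^ Suc k) \<phi>)"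
    using comm_E_F[of c n "(F c n ^^ Suc k) \<phi>"] by simp
  also have "\<dots> = fps_const (\<delta> * (of_nat k + 1) * (of_nat m - 2 * of_nat j - of_nat k)) \<star> (F c n ^^ Suc k) \<phi> +
      fps_const (\<delta> * (of_nat m - 2 * of_nat (j + Suc k))) \<star> (F c n ^^ Suc k) \<phi>"
    unfolding Suc.IH h_MS[OF MS_F_power[OF assms(1)]] by (simp add: flinD[OF flin_F])
  also have "\<dots> = fps_const (\<delta> * (of_nat (Suc k) + 1) * (of_nat m - 2 * of_nat j - of_nat (Suc k))) \<star> (F c n ^^ Suc k) \<phi>"
    unfolding series.scale_left_distrib[symmetric] fps_const_add
    by (rule arg_cong[where f = "\<lambda>s. fps_const s \<star> _"]) (simp add: algebra_simps)
  finally show ?case .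
qed

lemma MS_bottom: assumes "MS (Suc m) \<phi>" shows "\<phi> = 0"
  using assms S_bottom by (intro fps_ext) (simp add: MS_def)

abbreviation "yc \<equiv> fps_const y"

text \<open>The eigenvalue of the full series of the node, including its constant term 1, on
  \<open>y\<close>.\<close>

definition g :: "complex fps" where
  "g = Abs_fps (\<lambda>n. if n = 0 then 1 else hbar * \<gamma> (n - 1))"

lemma MS_y: "MS 0 yc"
  using y_S S_subspace[of 0] by (auto simp: MS_def subspace_0)

lemma E_y: "E c n yc = 0"
proof -
  have "lift (xp r) yc = 0" for r by (rule fps_ext) (simp add: xp_y linD[OF lin_xp])
  thus ?thesis by (simp add: E_def op_series_def)
qed

lemma B_y: "fps_const hbar \<star> B c yc = ((g oo shifted_u_inv c) - 1) \<star> yc"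
proof -
  have "lift (xi r) yc = fps_const (\<gamma> r) \<star> yc" for r
    by (rule fps_ext) (simp add: xi_y linD[OF lin_xi])
  hence "fps_const hbar \<star> B c yc = ((Abs_fps (\<lambda>n. if n = 0 then 0 else hbar * \<gamma> (n - 1))) oo shifted_u_inv c) \<star> yc"
    by (simp add: op_series_def gen_series_scalar)
  also have "Abs_fps (\<lambda>n. if n = 0 then 0 else hbar * \<gamma> (n - 1)) = g - 1"
    by (rule fps_ext) (simp add: g_def)
  finally show ?thesis by (simp add: fps_compose_sub_distrib)
qed

text \<open>By \<open>F_Suc_power\<close> the claim says that the power \<open>m - 1\<close> of
  \<open>F c n\<close> kills the vector \<open>\<chi>\<close> below. This \<open>\<chi>\<close> is a
  highest weight vector of weight \<open>m - 2\<close> for the sl2-triple with parameter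
  \<open>n\<close>, and the string has no room for more than \<open>m - 2\<close> steps down from
  it.\<close>

lemma F_power_step: "(F c (n + 1) ^^ m) yc = (g oo shifted_u_inv (c - n * \<eta>)) \<star> (F c n ^^ m) yc"
proof -
  let ?g = "g oo shifted_u_inv (c - n * \<eta>)"
  \<comment> \<open>The combination is chosen to be killed by \<open>E\<close>: up to the common
    factor \<open>\<delta> m (g - 1)\<close>, both summands are mapped to \<open>yc\<close>.\<close>
  define \<chi> where "\<chi> = fps_const (of_nat m * \<eta>) \<star> C c yc - (?g - 1) \<star> F c n yc"
  have EC: "E c n (fps_const \<eta> \<star> C c yc) = fps_const \<delta> \<star> (?g - 1) \<star> yc"
  proof -
    have "E c n (C c yc) = B (c - n * \<eta>) yc" by (simp add: comm_E_C E_y fl_simps)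
    hence "E c n (fps_const \<eta> \<star> C c yc) = fps_const \<delta> \<star> fps_const hbar \<star> B (c - n * \<eta>) yc"
      by (simp add: flinD[OF flin_E] mult_ac)
    thus ?thesis by (simp only: B_y)
  qed
  have EF: "E c n (F c n yc) = fps_const (\<delta> * of_nat m) \<star> yc"
    using E_F_power[OF MS_y E_y, of c n 0] by simp
  have "E c n \<chi> = fps_const (of_nat m) \<star> E c n (fps_const \<eta> \<star> C c yc) - (?g - 1) \<star> E c n (F c n yc)"
    by (simp add: \<chi>_def flinD[OF flin_E])
  also have "\<dots> = 0"
  proof -
    have "fps_const (\<delta> * of_nat m) = fps_const (of_nat m) * fps_const \<delta>" by (simp add: mult.commute)
    thus ?thesis unfolding EC EF by (simp only: smult_assoc mult_ac diff_self)
  qed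
  finally have E\<chi>: "E c n \<chi> = 0" .
  have M\<chi>: "MS 1 \<chi>" unfolding \<chi>_def
    using MS_y by (intro MS_diff MS_smult) (auto intro: MS_F MS_C simp: numeral_eq_Suc)
  show ?thesis
  proof (cases m)
    \<comment> \<open>For \<open>m = 0\<close> level 1 of the string is already zero, so
      \<open>C c yc\<close> vanishes; applying \<open>E\<close> then forces the shifted
      \<open>g\<close> to act as 1.\<close>
    case 0
    hence "C c yc = 0" using MS_bottom[of "C c yc"] MS_C[OF MS_y] by simp
    hence "fps_const \<delta> \<star> (?g - 1) \<star> yc = fps_const \<delta> \<star> 0" using EC by (simp add: flinD[OF flin_E])
    hence "(?g - 1) \<star> yc = 0" using \<delta> by (rule smult_const_cancel)
    thus ?thesis using 0 by (simp add: series.scale_left_diff_distrib)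
  next
    case (Suc l)
    define x where "x = (F c n ^^ l) \<chi>"
    have Mx: "MS m x" using MS_F_power[OF M\<chi>, of l c n] by (simp add: x_def Suc)
    hence "F c n x = 0" by (intro MS_bottom MS_F)
    \<comment> \<open>For \<open>l = k + 1\<close> one has \<open>m = k + 2\<close>, so the factor
      \<open>m - 2 - k\<close> in \<open>E_F_power\<close> at level 1 is zero.\<close>
    moreover have "E c n x = 0"
    proof (cases l)
      case 0
      thus ?thesis using E\<chi> by (simp add: x_def)
    next
      case (Suc k)
      thus ?thesis using E_F_power[OF M\<chi> E\<chi>, of k] \<open>m = Suc l\<close> by (simp add: x_def)
    qed
    \<comment> \<open>Killed by \<open>E\<close> and \<open>F\<close>, the vector \<open>x\<close>
      is killed by \<open>h\<close>, but it has the nonzero weight \<open>- m\<close>.\<close>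
    ultimately have "h x = 0" using comm_E_F[of c n x] by (simp add: flinD[OF flin_E] flinD[OF flin_F])
    hence "fps_const (- \<delta> * of_nat m) \<star> x = fps_const (- \<delta> * of_nat m) \<star> 0"
      unfolding h_MS[OF Mx] by (simp add: algebra_simps)
    hence "x = 0" by (rule smult_const_cancel) (use \<delta> Suc in \<open>simp del: of_nat_Suc\<close>)
    moreover have "x = fps_const (of_nat m * \<eta>) \<star> (F c n ^^ l) (C c yc) - (?g - 1) \<star> (F c n ^^ m) yc"
      unfolding x_def \<chi>_def flinD[OF flin_funpow[OF flin_F]] Suc by (simp only: funpow_Suc_right comp_apply)
    ultimately have "fps_const (of_nat m * \<eta>) \<star> (F c n ^^ (m - 1)) (C c yc) = (?g - 1) \<star> (F c n ^^ m) yc"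
      by (simp add: Suc)
    thus ?thesis unfolding F_Suc_power by (simp add: series.scale_left_diff_distrib)
  qed
qed

definition z :: 'v where "z = (xm 0 ^^ m) y"

lemma F_0: "F c 0 = f"
  by (simp add: F_def fun_eq_iff)

lemma f_power_const: "(f ^^ k) (fps_const x) = fps_const ((xm 0 ^^ k) x)"
  by (induction k) (simp_all add: lift_fps_const linD[OF lin_xm])

lemma xm_power_S: "(xm 0 ^^ k) y \<in> S k"
  by (induction k) (auto simp: y_S xm_S)

lemma z_S: "z \<in> S m"
  unfolding z_def by (rule xm_power_S)

lemma z_nz: "z \<noteq> 0"
  unfolding z_def
proof (rule sl2_string_nonzero[where E = "xp 0" and H = "xi 0" and \<delta> = \<delta> and N = m])
  show "xp 0 (xm 0 x) = xm 0 (xp 0 x) + xi 0 x" for x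
    using pm[of 0 0 x] by (simp add: diff_eq_eq add.commute)
  show "xi 0 ((xm 0 ^^ q) y) = sc (\<delta> * (of_nat m - 2 * of_nat q)) ((xm 0 ^^ q) y)" for q
    by (rule xi0_S[OF xm_power_S])
qed (use \<delta> y_nz xp_y in \<open>auto simp: lin_xp lin_xm\<close>)

text \<open>Raising a vector of \<open>S m\<close> by \<open>m\<close> steps lands on the line of
  \<open>y\<close>; lowering it again returns a nonzero multiple of the vector, by the ladder
  computation started at the bottom.\<close>

lemma bottom_span: assumes "x \<in> S m" shows "\<exists>c. x = sc c z"
proof -
  have S: "(xp 0 ^^ k) x \<in> S (m - k)" if "k \<le> m" for k
    using that
  proof (induction k)
    case (Suc k)
    hence "(xp 0 ^^ k) x \<in> S (Suc (m - Suc k))" by (simp add: Suc_diff_Suc)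
    thus ?case by (simp add: xp_S)
  qed (simp add: assms)
  have fe: "xm 0 ((xp 0 ^^ Suc k) x) = sc (\<delta> * (of_nat k + 1) * (of_nat m - of_nat k)) ((xp 0 ^^ k) x)" if "k \<le> m" for k
    using that
  proof (induction k)
    case 0
    have "xm 0 x = 0" using xm_S[OF assms] S_bottom by blast
    thus ?case using pm[of 0 0 x] xi0_S[OF assms] by (simp add: linD[OF lin_xp] algebra_simps scale_left_diff_distrib)
  next
    case (Suc k)
    let ?x = "(xp 0 ^^ Suc k) x"
    have "xm 0 (xp 0 ?x) = xp 0 (xm 0 ?x) - xi 0 ?x" using pm[of 0 0 ?x] by (simp add: algebra_simps)
    also have "\<dots> = sc (\<delta> * (of_nat k + 1) * (of_nat m - of_nat k)) ?x - sc (\<delta> * (of_nat m - 2 * of_nat (m - Suc k))) ?x"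
      using Suc xi0_S[OF S[OF Suc.prems]] by (simp add: linD[OF lin_xp])
    also have "\<dots> = sc (\<delta> * (of_nat (Suc k) + 1) * (of_nat m - of_nat (Suc k))) ?x"
      unfolding scale_left_diff_distrib[symmetric] using Suc.prems
      by (intro arg_cong[where f = "\<lambda>s. sc s _"]) (simp add: of_nat_diff algebra_simps)
    finally show ?case by simp
  qed
  have lin_f: "(xm 0 ^^ k) (sc c x) = sc c ((xm 0 ^^ k) x)" for k c x
    by (induction k) (auto simp: linD[OF lin_xm])
  have "\<exists>c. c \<noteq> 0 \<and> (xm 0 ^^ k) ((xp 0 ^^ k) x) = sc c x" if "k \<le> m" for k
    using that
  proof (induction k)
    case 0
    show ?case by (intro exI[of _ 1]) simp
  next
    case (Suc k)
    then obtain c where c: "c \<noteq> 0" "(xm 0 ^^ k) ((xp 0 ^^ k) x) = sc c x" by auto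
    have "(xm 0 ^^ Suc k) ((xp 0 ^^ Suc k) x) = (xm 0 ^^ k) (xm 0 ((xp 0 ^^ Suc k) x))"
      by (simp only: funpow_Suc_right comp_apply)
    also have "\<dots> = sc (\<delta> * (of_nat k + 1) * (of_nat m - of_nat k) * c) x"
      unfolding fe[OF Suc_leD[OF Suc.prems]] lin_f c by simp
    finally have 1: "(xm 0 ^^ Suc k) ((xp 0 ^^ Suc k) x) = sc (\<delta> * (of_nat k + 1) * (of_nat m - of_nat k) * c) x" .
    have "of_nat k + 1 \<noteq> (0::complex)" by (metis of_nat_Suc of_nat_eq_0_iff nat.distinct(1) add.commute)
    moreover have "of_nat m - of_nat k \<noteq> (0::complex)" using Suc.prems by simp
    ultimately show ?case using 1 c \<delta> by (metis mult_eq_0_iff)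
  qed
  then obtain c where c: "c \<noteq> 0" "(xm 0 ^^ m) ((xp 0 ^^ m) x) = sc c x" by auto
  obtain b where "(xp 0 ^^ m) x = sc b y" using S[of m] S_top by auto
  hence "sc c x = sc b z" using c(2) lin_f by (simp add: z_def)
  hence "x = sc (inverse c * b) z" using c(1) by (metis scale_scale left_inverse scale_one)
  thus ?thesis by blast
qed

context
  fixes \<nu> :: "complex fls"
  assumes \<nu>_nz: "\<nu> \<noteq> 0" and \<nu>: "fps_to_fls g = shift_fls (- \<eta>) \<nu> / \<nu>"
begin

lemma g_shift: "fps_to_fls (g oo shifted_u_inv c) = shift_fls (c - \<eta>) \<nu> / shift_fls c \<nu>"
  unfolding shift_fls_fps_to_fls[symmetric] \<nu> by (simp add: shift_fls_divide)

text \<open>The factors \<open>g\<close> supplied by \<open>F_power_step\<close> telescope, starting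
  from \<open>F c 0 = f\<close>. Negative \<open>n\<close> are needed because the node itself has
  Cartan integer 2; there the step is inverted, which is possible since \<open>g\<close> has
  constant term 1.\<close>

lemma F_power_eigenvalue:
  "\<exists>\<phi>. (F c (of_int n) ^^ m) yc = \<phi> \<star> fps_const z \<and> fps_to_fls \<phi> = shift_fls (c - of_int n * \<eta>) \<nu> / shift_fls c \<nu>"
proof (induction n rule: int_induct[where k = 0])
  case base
  show ?case using \<nu>_nz by (intro exI[of _ 1]) (simp add: F_0 f_power_const z_def)
next
  case (step1 n)
  let ?g = "g oo shifted_u_inv (c - of_int n * \<eta>)"
  from step1 obtain \<phi> where \<phi>: "(F c (of_int n) ^^ m) yc = \<phi> \<star> fps_const z"
    "fps_to_fls \<phi> = shift_fls (c - of_int n * \<eta>) \<nu> / shift_fls c \<nu>" by blast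
  have "(F c (of_int (n + 1)) ^^ m) yc = (?g * \<phi>) \<star> fps_const z"
    using F_power_step[of c "of_int n"] \<phi>(1) by simp
  moreover have "fps_to_fls (?g * \<phi>) = shift_fls (c - of_int (n + 1) * \<eta>) \<nu> / shift_fls c \<nu>"
    unfolding fls_times_fps_to_fls \<phi>(2) g_shift using \<nu>_nz by (simp add: algebra_simps)
  ultimately show ?case by blast
next
  case (step2 n)
  let ?g = "g oo shifted_u_inv (c - of_int (n - 1) * \<eta>)"
  from step2 obtain \<phi> where \<phi>: "(F c (of_int n) ^^ m) yc = \<phi> \<star> fps_const z"
    "fps_to_fls \<phi> = shift_fls (c - of_int n * \<eta>) \<nu> / shift_fls c \<nu>" by blast
  have "?g $ 0 = 1" by (simp add: g_def)
  hence ig: "inverse ?g * ?g = 1" by (intro inverse_mult_eq_1) simp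
  have "(F c (of_int n) ^^ m) yc = ?g \<star> (F c (of_int (n - 1)) ^^ m) yc"
    using F_power_step[of c "of_int (n - 1)"] by simp
  hence "inverse ?g \<star> \<phi> \<star> fps_const z = (inverse ?g * ?g) \<star> (F c (of_int (n - 1)) ^^ m) yc"
    by (simp add: \<phi>(1))
  hence "(F c (of_int (n - 1)) ^^ m) yc = (inverse ?g * \<phi>) \<star> fps_const z"
    unfolding ig by simp
  moreover have "fps_to_fls (inverse ?g * \<phi>) = shift_fls (c - of_int (n - 1) * \<eta>) \<nu> / shift_fls c \<nu>"
  proof -
    have "fps_to_fls (inverse ?g) * fps_to_fls ?g = 1" using ig by (simp flip: fls_times_fps_to_fls)
    hence "fps_to_fls (inverse ?g) = inverse (fps_to_fls ?g)"
      by (metis inverse_unique mult.commute)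
    thus ?thesis unfolding fls_times_fps_to_fls \<phi>(2) g_shift using \<nu>_nz
      by (simp add: field_simps)
  qed
  ultimately show ?case by blast
qed

text \<open>Each difference in \<open>n\<close> trades one \<open>F\<close> for one \<open>C\<close>
  and contributes the next factor of a falling factorial; on the eigenvalue it is a difference of
  \<open>\<nu>\<close> with step \<open>\<eta>\<close>.\<close>

lemma F_difference:
  assumes "k \<le> m + 1"
  shows "\<exists>\<sigma>. fps_const ((\<Prod>i<k. of_nat (m - i)) * \<eta> ^ k) \<star> (F 0 (of_nat n) ^^ (m - k)) ((C 0 ^^ k) yc) = \<sigma> \<star> fps_const z \<and>
     fps_to_fls \<sigma> = shift_fls (- of_nat n * \<eta>) (((\<lambda>f. shift_fls (- \<eta>) f - f) ^^ k) \<nu>) / \<nu>"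
  using assms
proof (induction k arbitrary: n)
  case 0
  show ?case using F_power_eigenvalue[of 0 "int n"] by simp
next
  case (Suc k)
  let ?D = "\<lambda>k. ((\<lambda>f. shift_fls (- \<eta>) f - f) ^^ k) \<nu>"
  let ?a = "(\<Prod>i<k. of_nat (m - i)) * \<eta> ^ k"
  let ?\<chi> = "(C 0 ^^ k) yc"
  from Suc.IH[of n] Suc.prems obtain \<sigma> where \<sigma>:
    "fps_const ?a \<star> (F 0 (of_nat n) ^^ (m - k)) ?\<chi> = \<sigma> \<star> fps_const z"
    "fps_to_fls \<sigma> = shift_fls (- of_nat n * \<eta>) (?D k) / \<nu>" by auto
  from Suc.IH[of "Suc n"] Suc.prems obtain \<tau> where \<tau>:
    "fps_const ?a \<star> (F 0 (of_nat (Suc n)) ^^ (m - k)) ?\<chi> = \<tau> \<star> fps_const z"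
    "fps_to_fls \<tau> = shift_fls (- of_nat (Suc n) * \<eta>) (?D k) / \<nu>" by auto
  have "(\<tau> - \<sigma>) \<star> fps_const z = fps_const ?a \<star>
      ((F 0 (of_nat n + 1) ^^ (m - k)) ?\<chi> - (F 0 (of_nat n) ^^ (m - k)) ?\<chi>)"
    using \<sigma>(1) \<tau>(1)
    by (simp add: series.scale_left_diff_distrib series.scale_right_diff_distrib add.commute del: fps_const_mult)
  also have "\<dots> = fps_const (?a * (of_nat (m - k) * \<eta>)) \<star> (F 0 (of_nat n) ^^ (m - k - 1)) (C 0 ?\<chi>)"
    unfolding F_Suc_power by simp
  also have "\<dots> = fps_const ((\<Prod>i<Suc k. of_nat (m - i)) * \<eta> ^ Suc k) \<star> (F 0 (of_nat n) ^^ (m - Suc k)) ((C 0 ^^ Suc k) yc)"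
    by (simp add: mult_ac)
  finally have 1: "fps_const ((\<Prod>i<Suc k. of_nat (m - i)) * \<eta> ^ Suc k) \<star> (F 0 (of_nat n) ^^ (m - Suc k)) ((C 0 ^^ Suc k) yc)
      = (\<tau> - \<sigma>) \<star> fps_const z" ..
  have "fps_to_fls (\<tau> - \<sigma>) = shift_fls (- of_nat n * \<eta>) (?D (Suc k)) / \<nu>"
    using \<sigma>(2) \<tau>(2) by (simp add: shift_fls_diff diff_divide_distrib algebra_simps)
  with 1 show ?case by blast
qed

text \<open>At order \<open>m + 1\<close> the falling factorial contains the factor
  \<open>m - m\<close>. As \<open>z\<close> is nonzero, the difference of order \<open>m + 1\<close>
  of \<open>\<nu>\<close> vanishes.\<close>

lemma eigenvalue_polynomial: "\<exists>p. \<nu> = poly_in_u p"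
proof -
  from F_difference[of "m + 1" 0] obtain \<sigma> where \<sigma>:
    "fps_const ((\<Prod>i<m + 1. of_nat (m - i)) * \<eta> ^ (m + 1)) \<star> (F 0 (of_nat 0) ^^ (m - (m + 1))) ((C 0 ^^ (m + 1)) yc) = \<sigma> \<star> fps_const z"
    "fps_to_fls \<sigma> = shift_fls (- of_nat 0 * \<eta>) (((\<lambda>f. shift_fls (- \<eta>) f - f) ^^ (m + 1)) \<nu>) / \<nu>" by blast
  have "(\<Prod>i<m + 1. of_nat (m - i)) = (0 :: complex)" by simp
  hence "\<sigma> \<star> fps_const z = 0 \<star> fps_const z" using \<sigma>(1) by simp
  hence "\<sigma> = 0" using z_nz smult_fps_const_eq_iff by blast
  hence "((\<lambda>f. shift_fls (- \<eta>) f - f) ^^ (m + 1)) \<nu> = 0" using \<sigma>(2) \<nu>_nz by simp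
  moreover have "- \<eta> \<noteq> 0" using hbar \<delta> by simp
  ultimately show ?thesis using iterated_difference_zero_imp_polynomial by blast
qed

text \<open>
  The series \<open>\<zeta>(u)\<close> of an arbitrary node, whose Cartan integer with the given node is \<open>- N\<close>.
\<close>

lemma bottom_eigenvalue:
  fixes \<zeta> :: "nat \<Rightarrow> 'v \<Rightarrow> 'v" and N :: int
  assumes lin_\<zeta>: "\<And>r. lin (\<zeta> r)"
    and rel0: "\<And>s x. \<zeta> 0 (xm s x) - xm s (\<zeta> 0 x) = sc (\<delta> * of_int N) (xm s x)"
    and rel: "\<And>r s x. \<zeta> (Suc r) (xm s x) - xm s (\<zeta> (Suc r) x) - (\<zeta> r (xm (Suc s) x) - xm (Suc s) (\<zeta> r x))
                = sc (\<eta> * of_int N / 2) (\<zeta> r (xm s x) + xm s (\<zeta> r x))"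
    and \<zeta>_y: "\<And>r. \<zeta> r y = sc (b r) y"
  defines "G \<equiv> Abs_fps (\<lambda>n. if n = 0 then 1 else hbar * b (n - 1))"
  shows "\<exists>G'. (\<forall>r. sc hbar (\<zeta> r z) = sc (G' $ Suc r) z) \<and> G' $ 0 = 1 \<and>
     fps_to_fls G' = fps_to_fls G * shift_fls (- of_int N * \<eta> / 2) \<nu> / shift_fls (of_int N * \<eta> / 2) \<nu>"
proof -
  \<comment> \<open>With base points 0 and \<open>c\<close> the coefficient on the left of the
    telescoping identity equals that of the anticommutator. The terms with \<open>C\<close> applied
    first then cancel, and what is left is exactly \<open>F c N\<close> after
    \<open>Xi\<close>.\<close>
  define c where "c = of_int N * \<eta> / 2"
  define Xi where "Xi = (\<lambda>\<phi>. \<phi> + fps_const hbar \<star> op_series 0 \<zeta> \<phi>)"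
  have fl\<zeta>: "flin (op_series 0 \<zeta>)" by (rule flin_op_series) (rule lin_\<zeta>)
  have flXi: "flin Xi" unfolding Xi_def by (intro flin_add flin_id flin_smult fl\<zeta>)
  have Xi_f: "Xi (f \<phi>) = F c (of_int N) (Xi \<phi>)" for \<phi>
  proof -
    let ?z = "\<lambda>r s. lift (\<zeta> r) (lift (xm s) \<phi>) - lift (xm s) (lift (\<zeta> r) \<phi>)"
    let ?t = "\<lambda>r s. fps_const c \<star> (lift (\<zeta> r) (lift (xm s) \<phi>) + lift (xm s) (lift (\<zeta> r) \<phi>))"
    let ?Z = "op_series 0 \<zeta>"
    have "fps_const (c - 0) \<star> gen_series 0 (\<lambda>r. gen_series c (?z r)) =
       gen_series c (?z 0) - gen_series 0 (\<lambda>r. ?z r 0) + gen_series 0 (\<lambda>r. gen_series c (?t r))"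
      by (rule gen_series_telescope) (rule fps_ext, simp add: rel c_def mult.commute)
    moreover have "gen_series 0 (\<lambda>r. gen_series c (?z r)) = ?Z (C c \<phi>) - C c (?Z \<phi>)"
      unfolding gen_series_diff op_series_op_series(1)[OF lin_\<zeta> lin_xm, symmetric]
        op_series_op_series(2)[OF lin_\<zeta> lin_xm, symmetric] by simp
    moreover have "gen_series c (?z 0) = fps_const (\<delta> * of_int N) \<star> C c \<phi>"
    proof -
      have "?z 0 = (\<lambda>s. fps_const (\<delta> * of_int N) \<star> lift (xm s) \<phi>)"
        by (rule ext, rule fps_ext) (simp add: rel0)
      thus ?thesis unfolding op_series_def gen_series_smult[symmetric] by simp
    qed
    moreover have "gen_series 0 (\<lambda>r. ?z r 0) = ?Z (f \<phi>) - f (?Z \<phi>)"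
      by (simp add: gen_series_diff lift_op_series[OF lin_xm]) (simp add: op_series_def)
    moreover have "gen_series 0 (\<lambda>r. gen_series c (?t r)) = fps_const c \<star> (?Z (C c \<phi>) + C c (?Z \<phi>))"
      unfolding gen_series_smult gen_series_add op_series_op_series(1)[OF lin_\<zeta> lin_xm, symmetric]
        op_series_op_series(2)[OF lin_\<zeta> lin_xm, symmetric] by simp
    ultimately have "fps_const c \<star> (?Z (C c \<phi>) - C c (?Z \<phi>)) =
        fps_const (\<delta> * of_int N) \<star> C c \<phi> - (?Z (f \<phi>) - f (?Z \<phi>)) + fps_const c \<star> (?Z (C c \<phi>) + C c (?Z \<phi>))"
      by simp
    moreover have "fps_const (2 * c) \<star> \<psi> = fps_const c \<star> \<psi> + fps_const c \<star> \<psi>" for \<psi>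
      by (metis fps_const_add mult_2 series.scale_left_distrib)
    ultimately have Z: "?Z (f \<phi>) = f (?Z \<phi>) + fps_const (2 * c) \<star> C c (?Z \<phi>) + fps_const (\<delta> * of_int N) \<star> C c \<phi>"
      by (simp add: series.scale_right_distrib series.scale_right_diff_distrib algebra_simps del: fps_const_mult)
    have N: "of_int N * \<eta> = 2 * c" by (simp add: c_def)
    have hN: "fps_const hbar \<star> fps_const (\<delta> * of_int N) \<star> \<psi> = fps_const (2 * c) \<star> \<psi>" for \<psi>
      by (simp add: c_def mult_ac)
    have comm: "fps_const hbar \<star> fps_const (2 * c) \<star> \<psi> = fps_const (2 * c) \<star> fps_const hbar \<star> \<psi>" for \<psi>
      by (simp only: smult_assoc mult.commute)
    show ?thesis
      unfolding Xi_def F_def Z N by (simp only: fl_simps series.scale_right_distrib hN comm add_ac)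
  qed
  have Xi_pow: "Xi ((f ^^ k) \<phi>) = (F c (of_int N) ^^ k) (Xi \<phi>)" for k \<phi>
    by (induction k) (simp_all add: Xi_f)
  have Xi_y: "Xi yc = G \<star> yc"
  proof -
    have "lift (\<zeta> r) yc = fps_const (b r) \<star> yc" for r
      by (rule fps_ext) (simp add: \<zeta>_y linD[OF lin_\<zeta>])
    hence "Xi yc = yc + ((Abs_fps (\<lambda>n. if n = 0 then 0 else hbar * b (n - 1))) oo shifted_u_inv 0) \<star> yc"
      by (simp add: Xi_def op_series_def gen_series_scalar)
    also have "Abs_fps (\<lambda>n. if n = 0 then 0 else hbar * b (n - 1)) = G - 1"
      by (rule fps_ext) (simp add: G_def)
    finally show ?thesis by (simp add: shifted_u_inv_0 series.scale_left_diff_distrib)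
  qed
  from F_power_eigenvalue[of c N] obtain \<phi> where \<phi>: "(F c (of_int N) ^^ m) yc = \<phi> \<star> fps_const z"
    "fps_to_fls \<phi> = shift_fls (c - of_int N * \<eta>) \<nu> / shift_fls c \<nu>" by blast
  have "Xi (fps_const z) = (G * \<phi>) \<star> fps_const z"
    using Xi_pow[of m yc] Xi_y \<phi>(1) by (simp add: f_power_const z_def flinD[OF flin_funpow[OF flin_F]])
  moreover have "Xi (fps_const z) $ Suc r = sc hbar (\<zeta> r z)" for r
  proof -
    have "op_series 0 \<zeta> (fps_const z) $ Suc r = (\<Sum>N\<le>Suc r. fps_X ^ Suc N \<star> fps_const (\<zeta> N z)) $ Suc r"
      by (simp add: op_series_def lift_fps_const linD[OF lin_\<zeta>] gen_series_nth[OF order_refl] shifted_u_inv_0 del: power_Suc)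
    also have "\<dots> = (\<Sum>N\<le>Suc r. if N = r then \<zeta> N z else 0)"
      unfolding fps_sum_nth smult_X_power_nth by (intro sum.cong) auto
    finally show ?thesis by (simp add: Xi_def)
  qed
  moreover have "Xi (fps_const z) $ 0 = z"
  proof -
    have "op_series 0 \<zeta> (fps_const z) $ 0 = 0"
      by (simp add: op_series_def gen_series_nth[OF order_refl] smult_nth)
    thus ?thesis by (simp add: Xi_def)
  qed
  ultimately have "\<forall>r. sc hbar (\<zeta> r z) = sc ((G * \<phi>) $ Suc r) z" "sc ((G * \<phi>) $ 0) z = sc 1 z"
    by (metis smult_fps_const_nth, metis smult_fps_const_nth scale_one)
  moreover from this(2) have "(G * \<phi>) $ 0 = 1" using z_nz by (metis scale_cancel_right)
  moreover have "fps_to_fls (G * \<phi>) = fps_to_fls G * shift_fls (- of_int N * \<eta> / 2) \<nu> / shift_fls (of_int N * \<eta> / 2) \<nu>"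
    unfolding fls_times_fps_to_fls \<phi>(2) c_def by (simp add: field_simps)
  ultimately show ?thesis by blast
qed

end

end

section \<open>Roots and reduced expressions\<close>

text \<open>
  The action of a simple reflection on coordinates with respect to the simple roots and to the
  simple coroots.
\<close>

definition root_refl :: "('i::finite \<Rightarrow> 'i \<Rightarrow> int) \<Rightarrow> 'i \<Rightarrow> ('i \<Rightarrow> int) \<Rightarrow> ('i \<Rightarrow> int)" where
  "root_refl a i r = r(i := r i - (\<Sum>k\<in>UNIV. a i k * r k))"

definition coroot_refl :: "('i::finite \<Rightarrow> 'i \<Rightarrow> int) \<Rightarrow> 'i \<Rightarrow> ('i \<Rightarrow> int) \<Rightarrow> ('i \<Rightarrow> int)" where
  "coroot_refl a i c = c(i := c i - (\<Sum>k\<in>UNIV. c k * a k i))"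

definition root_weight :: "('i::finite \<Rightarrow> 'i \<Rightarrow> int) \<Rightarrow> ('i \<Rightarrow> int) \<Rightarrow> 'i weight" where
  "root_weight a r = (\<lambda>l. \<Sum>k\<in>UNIV. a l k * r k)"

definition simple_root :: "'i \<Rightarrow> 'i \<Rightarrow> int" where
  "simple_root j = (\<lambda>k. of_bool (k = j))"

lemma root_weight_simple_root: "root_weight a (simple_root j) = (\<lambda>l. a l j)"
  by (simp add: root_weight_def simple_root_def)

lemma root_weight_add: "root_weight a (\<lambda>k. r k + q k) = (\<lambda>l. root_weight a r l + root_weight a q l)"
  by (simp add: root_weight_def algebra_simps sum.distrib)

lemma weyl_word_Nil [simp]: "weyl_word a [] = id"
  and weyl_word_Cons: "weyl_word a (j # js) = simple_reflection a j \<circ> weyl_word a js"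
  by (simp_all add: weyl_word_def)

lemma weyl_word_append: "weyl_word a (ks @ js) = weyl_word a ks \<circ> weyl_word a js"
  by (induction ks) (auto simp: weyl_word_Cons)

lemma simple_reflection_add:
  "simple_reflection a i (\<lambda>l. \<mu> l + \<nu> l) = (\<lambda>l. simple_reflection a i \<mu> l + simple_reflection a i \<nu> l)"
  by (simp add: simple_reflection_def algebra_simps)

lemma simple_reflection_scale:
  "simple_reflection a i (\<lambda>l. s * \<mu> l) = (\<lambda>l. s * simple_reflection a i \<mu> l)"
  by (simp add: simple_reflection_def algebra_simps)

lemma weyl_word_add:
  "weyl_word a ks (\<lambda>l. \<mu> l + \<nu> l) = (\<lambda>l. weyl_word a ks \<mu> l + weyl_word a ks \<nu> l)"
  by (induction ks) (auto simp: weyl_word_Cons simple_reflection_add)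

lemma weyl_word_scale: "weyl_word a ks (\<lambda>l. s * \<mu> l) = (\<lambda>l. s * weyl_word a ks \<mu> l)"
  by (induction ks) (auto simp: weyl_word_Cons simple_reflection_scale)

lemma reduced_expression_tail:
  assumes "reduced_expression a (ks @ js) w"
  shows "reduced_expression a js (weyl_word a js)"
  unfolding reduced_expression_def
proof (intro conjI allI impI)
  fix ls assume "weyl_word a ls = weyl_word a js"
  hence "weyl_word a (ks @ ls) = w"
    using assms by (simp add: reduced_expression_def weyl_word_append)
  hence "length (ks @ js) \<le> length (ks @ ls)"
    using assms unfolding reduced_expression_def by blast
  thus "length js \<le> length ls" by simp
qed simp

lemma pairing_simple_reflection:
  "(\<Sum>k\<in>UNIV. c k * simple_reflection a i \<mu> k) = (\<Sum>k\<in>UNIV. coroot_refl a i c k * \<mu> k)"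
proof -
  have "(\<Sum>k\<in>UNIV. coroot_refl a i c k * \<mu> k)
      = (\<Sum>k\<in>UNIV. c k * \<mu> k - (if k = i then (\<Sum>l\<in>UNIV. c l * a l i) * \<mu> i else 0))"
    by (intro sum.cong) (auto simp: coroot_refl_def algebra_simps)
  also have "\<dots> = (\<Sum>k\<in>UNIV. c k * \<mu> k) - (\<Sum>l\<in>UNIV. c l * a l i) * \<mu> i"
    by (simp add: sum_subtractf)
  also have "\<dots> = (\<Sum>k\<in>UNIV. c k * simple_reflection a i \<mu> k)"
    by (simp add: simple_reflection_def right_diff_distrib sum_subtractf sum_distrib_left sum_distrib_right mult_ac)
  finally show ?thesis ..
qed

text \<open>Moving reflections to the coroot side reverses their order, hence \<open>fold\<close>
  against the \<open>foldr\<close> in \<open>weyl_word\<close>.\<close>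

lemma pairing_weyl_word:
  "(\<Sum>k\<in>UNIV. c k * weyl_word a js \<mu> k) = (\<Sum>k\<in>UNIV. fold (coroot_refl a) js c k * \<mu> k)"
  by (induction js arbitrary: c) (auto simp: weyl_word_Cons pairing_simple_reflection)

lemma weyl_word_coordinate:
  "weyl_word a js \<mu> j = (\<Sum>k\<in>UNIV. fold (coroot_refl a) js (simple_root j) k * \<mu> k)"
  using pairing_weyl_word[of "simple_root j" a js \<mu>] by (simp add: simple_root_def)

lemma even_symmetric_sum:
  assumes "finite S" "\<And>k l. s k l = s l k" "\<And>k. even (s k k)"
  shows "even (\<Sum>k\<in>S. \<Sum>l\<in>S. (s k l :: int))"
  using assms(1)
proof (induction S rule: finite_induct)
  case (insert x S)
  have "(\<Sum>k\<in>insert x S. \<Sum>l\<in>insert x S. s k l)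
     = s x x + (\<Sum>l\<in>S. s x l) + ((\<Sum>k\<in>S. s k x) + (\<Sum>k\<in>S. \<Sum>l\<in>S. s k l))"
    using insert by (simp add: sum.distrib)
  also have "(\<Sum>k\<in>S. s k x) = (\<Sum>l\<in>S. s x l)" by (simp add: assms(2)[of _ x])
  finally show ?case using insert assms(3) by simp
qed simp

context simple_cartan_datum begin

section \<open>The invariant form and the sign of roots\<close>

definition form :: "('i \<Rightarrow> int) \<Rightarrow> ('i \<Rightarrow> int) \<Rightarrow> int" where
  "form r q = (\<Sum>k\<in>UNIV. \<Sum>l\<in>UNIV. d k * a k l * r k * q l)"

lemma form_sym: "form r q = form q r"
proof -
  have "form r q = (\<Sum>l\<in>UNIV. \<Sum>k\<in>UNIV. d k * a k l * r k * q l)"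
    unfolding form_def by (rule sum.swap)
  also have "\<dots> = form q r"
    unfolding form_def by (intro sum.cong refl) (metis symmetrized mult.assoc mult.commute)
  finally show ?thesis .
qed

lemma form_diff: "form (\<lambda>k. r k - s * q k) t = form r t - s * form q t"
  by (simp add: form_def algebra_simps sum_subtractf sum_distrib_left)

lemma form_simple_root: "form (simple_root i) q = d i * (\<Sum>l\<in>UNIV. a i l * q l)"
proof -
  have "form (simple_root i) q = (\<Sum>k\<in>UNIV. if k = i then \<Sum>l\<in>UNIV. d k * a k l * q l else 0)"
    unfolding form_def simple_root_def by (intro sum.cong refl) auto
  thus ?thesis by (simp add: sum_distrib_left mult_ac)
qed

lemma form_root_refl: "form (root_refl a i r) (root_refl a i r) = form r r"
proof -
  define s where "s = (\<Sum>k\<in>UNIV. a i k * r k)"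
  have r: "root_refl a i r = (\<lambda>k. r k - s * simple_root i k)"
    by (auto simp: root_refl_def simple_root_def s_def fun_eq_iff)
  have "form (simple_root i) r = d i * s" by (simp add: form_simple_root s_def)
  moreover have "form (simple_root i) (simple_root i) = 2 * d i"
    unfolding form_simple_root by (simp add: simple_root_def diag)
  ultimately show ?thesis
    unfolding r form_diff form_sym[of _ "\<lambda>k. r k - s * simple_root i k"] form_sym[of r "simple_root i"]
    by (simp add: algebra_simps)
qed

lemma form_fold: "form (fold (root_refl a) js (simple_root j)) (fold (root_refl a) js (simple_root j)) = 2 * d j"
proof -
  have "form (fold (root_refl a) js r) (fold (root_refl a) js r) = form r r" for r
    by (induction js arbitrary: r) (auto simp: form_root_refl)
  thus ?thesis by (simp add: form_simple_root, simp add: simple_root_def diag)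
qed

lemma form_pos: assumes "r k \<noteq> 0" shows "form r r > 0"
proof -
  have "0 < (\<Sum>i\<in>UNIV. \<Sum>j\<in>UNIV. of_int (d i * a i j) * real_of_int (r i) * real_of_int (r j))"
    using assms by (intro pos_def) auto
  also have "\<dots> = of_int (form r r)" by (simp add: form_def)
  finally show ?thesis by simp
qed

text \<open>The coroot of a root \<open>r\<close> is \<open>2 r / (r, r)\<close>, and
  \<open>(r, r) = 2 * d j\<close> along the orbit of the simple root \<open>j\<close>. The proof
  carries the constant \<open>d j\<close> through the reflections.\<close>

lemma coroot_eq_root:
  "d k * fold (root_refl a) js (simple_root j) k = d j * fold (coroot_refl a) js (simple_root j) k"
proof -
  have "\<forall>k. d k * fold (root_refl a) js r k = D * fold (coroot_refl a) js c k"
    if "\<forall>k. d k * r k = D * c k" for r c D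
    using that
  proof (induction js arbitrary: r c)
    case (Cons i js)
    have "d i * (\<Sum>k\<in>UNIV. a i k * r k) = (\<Sum>k\<in>UNIV. (d i * a i k) * r k)"
      by (simp add: sum_distrib_left mult_ac)
    also have "\<dots> = (\<Sum>k\<in>UNIV. a k i * (d k * r k))"
      by (intro sum.cong refl) (simp add: symmetrized[of i] mult_ac)
    also have "\<dots> = D * (\<Sum>k\<in>UNIV. c k * a k i)"
      by (simp add: Cons.prems sum_distrib_left mult_ac)
    finally have "\<forall>k. d k * root_refl a i r k = D * coroot_refl a i c k"
      using Cons.prems by (simp add: root_refl_def coroot_refl_def right_diff_distrib)
    thus ?case using Cons.IH by simp
  qed simp
  moreover have "\<forall>k. d k * simple_root j k = d j * simple_root j k" by (simp add: simple_root_def)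
  ultimately show ?thesis by blast
qed

text \<open>For a root with mixed signs the positive part \<open>p\<close> and negative part
  \<open>q\<close> have disjoint supports, so \<open>form p q \<le> 0\<close>, and the norm is at
  least that of \<open>p\<close> plus that of \<open>q\<close>. This is at least
  \<open>4 * d j\<close>, whereas a root has norm \<open>2 * d j\<close>.\<close>

lemma root_dichotomy:
  fixes js j
  defines "r \<equiv> fold (root_refl a) js (simple_root j)"
  shows "(\<forall>k. r k \<ge> 0) \<or> (\<forall>k. r k \<le> 0)"
proof (rule ccontr)
  assume "\<not> ?thesis"
  then obtain k1 k2 where k: "r k1 < 0" "r k2 > 0" by (auto simp: not_le)
  define c where "c = fold (coroot_refl a) js (simple_root j)"
  have cr: "d k * r k = d j * c k" for k unfolding r_def c_def by (rule coroot_eq_root)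
  define p q where "p = (\<lambda>k. max (r k) 0)" and "q = (\<lambda>k. max (- r k) 0)"
  have r: "r = (\<lambda>k. p k - 1 * q k)" by (auto simp: p_def q_def fun_eq_iff)
  \<comment> \<open>The coroot coordinates \<open>c\<close> being integers, the norm of the positive part of the root is a
      multiple of the norm \<open>2 * d j\<close> of the whole root; the same holds for its negative part.\<close>
  have big: "form t t \<ge> 2 * d j" if t: "t k \<noteq> 0" "\<And>k. t k = 0 \<or> t k = r k \<or> t k = - r k" for t k
  proof -
    define e where "e = (\<lambda>k. if t k = 0 then 0 else if t k = r k then c k else - c k)"
    have et: "d k * t k = d j * e k" for k
      using t(2)[of k] cr[of k] by (auto simp: e_def)
    have "d j * (e k * a k l * t l) = d j * (e l * a l k * t k)" for k l
      using et[of k] et[of l] symmetrized[of k l] by (metis mult.assoc mult.commute)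
    hence sym: "e k * a k l * t l = e l * a l k * t k" for k l
      using d_pos[of j] by (metis less_irrefl mult_left_cancel)
    have "even (\<Sum>k\<in>UNIV. \<Sum>l\<in>UNIV. e k * a k l * t l)"
      by (rule even_symmetric_sum) (auto simp: sym diag)
    then obtain m where m: "(\<Sum>k\<in>UNIV. \<Sum>l\<in>UNIV. e k * a k l * t l) = 2 * m" by (auto elim: evenE)
    have "form t t = (\<Sum>k\<in>UNIV. \<Sum>l\<in>UNIV. d j * (e k * a k l * t l))"
      unfolding form_def by (intro sum.cong refl) (metis et mult.assoc mult.commute)
    hence f: "form t t = 2 * d j * m" using m by (simp flip: sum_distrib_left)
    have "form t t > 0" using t(1) by (rule form_pos)
    hence "m \<ge> 1" using f d_pos[of j] by (auto simp: zero_less_mult_iff)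
    thus ?thesis using f d_pos[of j] by simp
  qed
  have "form p p \<ge> 2 * d j" by (rule big[of p k2]) (use k in \<open>auto simp: p_def max_def\<close>)
  moreover have "form q q \<ge> 2 * d j" by (rule big[of q k1]) (use k in \<open>auto simp: q_def max_def\<close>)
  moreover have "form p q \<le> 0"
    unfolding form_def
  proof (intro sum_nonpos)
    fix k l
    show "d k * a k l * p k * q l \<le> 0"
    proof (cases "k = l")
      case True thus ?thesis by (auto simp: p_def q_def max_def)
    next
      case False
      thus ?thesis using off_diag[of k l] d_pos[of k]
        by (auto simp: p_def q_def max_def mult_le_0_iff zero_le_mult_iff)
    qed
  qed
  moreover have "form r r = form p p - 2 * form p q + form q q"
    by (subst (1 2) r) (simp only: form_diff form_sym[of _ "\<lambda>k. p k - 1 * q k"] form_sym[of q p], simp)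
  moreover have "form r r = 2 * d j" unfolding r_def by (rule form_fold)
  ultimately show False using d_pos[of j] by linarith
qed

lemma simple_reflection_root_weight:
  "simple_reflection a i (root_weight a r) = root_weight a (root_refl a i r)"
proof
  fix l
  have "root_weight a (root_refl a i r) l =
      (\<Sum>k\<in>UNIV. a l k * r k - (if k = i then a l i * (\<Sum>m\<in>UNIV. a i m * r m) else 0))"
    unfolding root_weight_def by (intro sum.cong) (auto simp: root_refl_def algebra_simps)
  thus "simple_reflection a i (root_weight a r) l = root_weight a (root_refl a i r) l"
    by (simp add: sum_subtractf simple_reflection_def root_weight_def mult.commute)
qed

lemma weyl_word_rev_root_weight:
  "weyl_word a (rev js) (root_weight a r) = root_weight a (fold (root_refl a) js r)"
proof -
  have "weyl_word a (rev js) = fold (simple_reflection a) js"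
  proof (induction js)
    case (Cons i js)
    thus ?case by (simp add: weyl_word_append weyl_word_Cons fun_eq_iff)
  qed auto
  moreover have "fold (simple_reflection a) js (root_weight a r) = root_weight a (fold (root_refl a) js r)"
    by (induction js arbitrary: r) (auto simp: simple_reflection_root_weight)
  ultimately show ?thesis by simp
qed

lemma simple_reflection_involution: "simple_reflection a i (simple_reflection a i \<mu>) = \<mu>"
  by (simp add: simple_reflection_def diag fun_eq_iff algebra_simps)

lemma weyl_word_rev: "weyl_word a (rev js) (weyl_word a js \<mu>) = \<mu>"
  "weyl_word a js (weyl_word a (rev js) \<mu>) = \<mu>"
  by (induction js arbitrary: \<mu>)
    (auto simp: weyl_word_append weyl_word_Cons simple_reflection_involution)

text \<open>This is the exchange argument: if the root turns negative at some letter
  \<open>i\<close>, it was the simple root \<open>i\<close> just before. Then the letters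
  \<open>j\<close> and \<open>i\<close> can be deleted from the word without changing its action,
  against minimality.\<close>

lemma reduced_root_nonneg:
  assumes red: "reduced_expression a (j # js) w"
  shows "fold (root_refl a) js (simple_root j) k \<ge> 0"
    and "fold (coroot_refl a) js (simple_root j) k \<ge> 0"
proof -
  let ?R = "\<lambda>ks. fold (root_refl a) ks (simple_root j)"
  let ?C = "\<lambda>ks. fold (coroot_refl a) ks (simple_root j)"
  have "\<forall>k. ?R ks k \<ge> 0" if "js = ks @ ls" for ks ls
    using that
  proof (induction ks arbitrary: ls rule: rev_induct)
    case Nil
    thus ?case by (simp add: simple_root_def)
  next
    case (snoc i ks)
    have pos: "\<forall>k. ?R ks k \<ge> 0" using snoc.IH[of "i # ls"] snoc.prems by simp
    show ?case
    proof (rule ccontr)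
      assume "\<not> ?case"
      hence neg: "\<forall>k. ?R (ks @ [i]) k \<le> 0" "\<exists>k. ?R (ks @ [i]) k \<noteq> 0"
        using root_dichotomy[of "ks @ [i]" j] by fastforce+
      define b where "b = ?R ks i"
      \<comment> \<open>The reflection changes only coordinate \<open>i\<close>, so every other
        coordinate is both nonnegative and nonpositive.\<close>
      have off: "?R ks k = 0" if "k \<noteq> i" for k
        using pos neg(1) that spec[OF neg(1), of k] spec[OF pos, of k] by (simp add: root_refl_def)
      hence R: "?R ks = (\<lambda>k. b * simple_root i k)" by (auto simp: b_def simple_root_def fun_eq_iff)
      have "form (?R ks) (?R ks) = b * b * (2 * d i)"
      proof -
        have "form (\<lambda>k. b * simple_root i k) q = b * form (simple_root i) q" for q
          by (simp add: form_def sum_distrib_left mult_ac)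
        hence "form (?R ks) (?R ks) = b * (b * form (simple_root i) (simple_root i))"
          unfolding R by (metis form_sym)
        also have "form (simple_root i) (simple_root i) = 2 * d i"
          unfolding form_simple_root by (simp add: simple_root_def diag)
        finally show ?thesis by simp
      qed
      hence n: "b * b * d i = d j" using form_fold[of ks j] by simp
      have c: "d i * b = d j * ?C ks i" using coroot_eq_root[of i ks j] by (simp add: b_def)
      have "b \<noteq> 0" using n d_pos[of j] by auto
      \<comment> \<open>Comparing norms and comparing root with coroot shows that \<open>b\<close>
        and the coroot coordinate are integers with product 1; this excludes proper multiples of a
        simple root.\<close>
      have "b * (d i * 1) = b * (d i * (b * ?C ks i))" using c n by (metis mult.assoc mult.commute mult.right_neutral)
      hence "b * ?C ks i = 1" using \<open>b \<noteq> 0\<close> d_pos[of i] by simp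
      moreover have "b \<ge> 0" using pos by (simp add: b_def)
      ultimately have bc: "b = 1" "?C ks i = 1" using zmult_eq_1_iff by force+
      have C: "?C ks = simple_root i"
      proof
        fix k show "?C ks k = simple_root i k"
          using bc coroot_eq_root[of k ks j] off[of k] d_pos[of j] by (cases "k = i") (auto simp: simple_root_def)
      qed
      let ?u = "weyl_word a ks"
      have coord: "?u \<mu> j = \<mu> i" for \<mu>
        unfolding weyl_word_coordinate C by (simp add: simple_root_def)
      have "weyl_word a (rev ks) (root_weight a (simple_root j)) = root_weight a (simple_root i)"
        unfolding weyl_word_rev_root_weight R bc by simp
      hence ui: "?u (root_weight a (simple_root i)) = root_weight a (simple_root j)"
        using weyl_word_rev(2) by metis
      \<comment> \<open>A reflection is fixed by its root and coroot, and \<open>?u\<close> carries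
        those of \<open>i\<close> to those of \<open>j\<close>.\<close>
      have conj: "simple_reflection a j (?u \<mu>) = ?u (simple_reflection a i \<mu>)" for \<mu>
      proof -
        have "simple_reflection a i \<mu> = (\<lambda>l. \<mu> l + (- \<mu> i) * root_weight a (simple_root i) l)"
          by (simp add: simple_reflection_def root_weight_simple_root)
        hence "?u (simple_reflection a i \<mu>) = (\<lambda>l. ?u \<mu> l + (- \<mu> i) * root_weight a (simple_root j) l)"
          by (simp only: weyl_word_add weyl_word_scale ui)
        thus ?thesis by (simp add: simple_reflection_def coord root_weight_simple_root)
      qed
      have "weyl_word a (j # js) = weyl_word a (ks @ ls)"
        using snoc.prems
        by (simp add: fun_eq_iff weyl_word_append weyl_word_Cons conj simple_reflection_involution)
      hence "length (j # js) \<le> length (ks @ ls)"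
        using red unfolding reduced_expression_def by metis
      thus False using snoc.prems by simp
    qed
  qed
  from this[of js "[]"] show 1: "?R js k \<ge> 0" by simp
  have "d j * ?C js k \<ge> 0" unfolding coroot_eq_root[symmetric] using 1 d_pos[of k] by simp
  thus "?C js k \<ge> 0" using d_pos[of j] by (simp add: zero_le_mult_iff)
qed

lemma fold_root_refl_nonzero: "\<exists>k. fold (root_refl a) js (simple_root j) k \<noteq> 0"
proof (rule ccontr)
  assume "\<not> ?thesis"
  hence "form (fold (root_refl a) js (simple_root j)) (fold (root_refl a) js (simple_root j)) = 0"
    by (simp add: form_def)
  thus False using form_fold[of js j] d_pos[of j] by simp
qed

lemma root_weight_inj: assumes "root_weight a r = root_weight a q" shows "r = q"
proof (rule ccontr)
  assume "r \<noteq> q"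
  then obtain k where "r k - q k \<noteq> 0" by (auto simp: fun_eq_iff)
  hence "form (\<lambda>k. r k - q k) (\<lambda>k. r k - q k) > 0" by (rule form_pos)
  moreover have "form (\<lambda>k. r k - q k) (\<lambda>k. r k - q k) =
      (\<Sum>k\<in>UNIV. d k * (r k - q k) * (root_weight a r k - root_weight a q k))"
  proof -
    have "d k * (r k - q k) * (root_weight a r k - root_weight a q k)
        = (\<Sum>l\<in>UNIV. d k * (r k - q k) * (a k l * (r l - q l)))" for k
      by (simp add: root_weight_def flip: sum_distrib_left sum_subtractf right_diff_distrib)
    thus ?thesis by (simp add: form_def mult_ac)
  qed
  ultimately show False using assms by simp
qed

text \<open>Dividing by \<open>d\<close> turns the transposed matrix into the symmetrized one, where
  definiteness applies. Definiteness is a real statement, so real and imaginary parts are treated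
  separately.\<close>

lemma cartan_kernel_trivial:
  fixes x :: "'i \<Rightarrow> complex"
  assumes "\<And>i. (\<Sum>j\<in>UNIV. of_int (a j i) * x j) = 0"
  shows "x j = 0"
proof -
  have real: "y j = 0" if y: "\<And>i. (\<Sum>j\<in>UNIV. of_int (a j i) * y j) = 0" for y :: "'i \<Rightarrow> real"
  proof (rule ccontr)
    assume "y j \<noteq> 0"
    define t where "t = (\<lambda>j. y j / of_int (d j))"
    have dp: "real_of_int (d j) > 0" for j using d_pos by simp
    have "0 < (\<Sum>i\<in>UNIV. \<Sum>j\<in>UNIV. of_int (d i * a i j) * t i * t j)"
      using \<open>y j \<noteq> 0\<close> dp[of j] by (intro pos_def) (auto simp: t_def)
    also have "\<dots> = (\<Sum>i\<in>UNIV. t i * (\<Sum>j\<in>UNIV. of_int (a j i) * y j))"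
    proof -
      have "of_int (d i * a i j) * t i * t j = t i * (of_int (a j i) * y j)" for i j
        using dp[of j] unfolding symmetrized[of i j] by (simp add: t_def)
      thus ?thesis by (simp only: sum_distrib_left)
    qed
    finally show False using y by simp
  qed
  have "Re (\<Sum>j\<in>UNIV. of_int (a j i) * x j) = 0" "Im (\<Sum>j\<in>UNIV. of_int (a j i) * x j) = 0" for i
    using assms by simp_all
  hence "Re (x j) = 0" "Im (x j) = 0"
    by (intro real[of "\<lambda>j. Re (x j)"] real[of "\<lambda>j. Im (x j)"]; simp)+
  thus ?thesis by (simp add: complex_eq_iff)
qed

end

section \<open>Weights of modules over the Yangian\<close>

lemma free_alg_sum_monomials: "p = (\<Sum>w\<in>Poly_Mapping.keys p. Poly_Mapping.single w (Poly_Mapping.lookup p w))"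
  by (rule poly_mapping_eqI) (auto simp: lookup_sum lookup_single when_def in_keys_iff)

lemma single_word: "Poly_Mapping.single (Word gs) c = scalar c * prod_list (map gen gs)"
proof -
  have "prod_list (map gen gs) = Poly_Mapping.single (Word gs) (1::complex)"
    by (induction gs) (auto simp: gen_def mult_single plus_word_def single_one[symmetric] zero_word_def simp del: single_one)
  moreover have "0 + Word gs = Word gs" by simp
  ultimately show ?thesis by (simp add: scalar_def mult_single)
qed

lemma free_alg_expand:
  "p = (\<Sum>w\<in>Poly_Mapping.keys p. scalar (Poly_Mapping.lookup p w) * prod_list (map gen (letters w)))"
  unfolding single_word[symmetric] word.collapse by (rule free_alg_sum_monomials)

locale yangian_rep = cartan: simple_cartan_datum a d + complex_space sc + Y: yangian_module a d hbar sc \<rho>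
  for a :: "'i::finite \<Rightarrow> 'i \<Rightarrow> int" and d :: "'i \<Rightarrow> int" and hbar :: complex
    and sc :: "complex \<Rightarrow> 'v::ab_group_add \<Rightarrow> 'v"
    and \<rho> :: "'i yangian_gen free_alg \<Rightarrow> 'v \<Rightarrow> 'v"
begin

abbreviation X :: "pm \<Rightarrow> 'i \<Rightarrow> nat \<Rightarrow> 'v \<Rightarrow> 'v" where "X \<epsilon> i r \<equiv> \<rho> (xpm \<epsilon> i r)"
abbreviation K :: "'i \<Rightarrow> nat \<Rightarrow> 'v \<Rightarrow> 'v" where "K i r \<equiv> \<rho> (xi i r)"
abbreviation wt :: "'i weight \<Rightarrow> 'v set" where "wt \<mu> \<equiv> weight_space d sc \<rho> \<mu>"

lemma lin_\<rho>: "lin (\<rho> p)"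
proof -
  interpret l: Vector_Spaces.linear sc sc "\<rho> p" by (rule Y.linear)
  show ?thesis by (simp add: lin_def l.add l.scale)
qed

lemma rho_scalar: "\<rho> (scalar c * p) x = sc c (\<rho> p x)"
  by (simp add: Y.mult Y.scalar)

lemma rho_0: "\<rho> 0 x = 0"
  using Y.scalar[of 0 x] by (simp add: scalar_def)

lemma rho_1: "\<rho> 1 x = x"
  using Y.scalar[of 1 x] by (simp add: scalar_def)

lemma rho_diff: "\<rho> (p - q) x = \<rho> p x - \<rho> q x"
  using Y.add[of "p - q" q x] by (simp add: eq_diff_eq)

lemma rho_sum: "\<rho> (sum p S) x = (\<Sum>k\<in>S. \<rho> (p k) x)"
  by (induction S rule: infinite_finite_induct) (auto simp: rho_0 Y.add)

lemma rho_eq: assumes "yangian_eq a d hbar p q" shows "\<rho> p x = \<rho> q x"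
  using Y.vanishes[of "p - q" x] assms by (simp add: yangian_eq_def rho_diff)

lemmas rho_relator = Y.vanishes[OF yangian_ideal.relator]

lemma K0_X: "K i 0 (X \<epsilon> j s x) - X \<epsilon> j s (K i 0 x) = sc (pm_sign \<epsilon> * of_int (d i * a i j)) (X \<epsilon> j s x)"
  using rho_relator[OF yangian_relators.xi0_x, of i \<epsilon> j s x]
  by (simp only: comm_def rho_diff Y.mult Y.scalar right_minus_eq)

lemma K_X: "K i (Suc r) (X \<epsilon> j s x) - X \<epsilon> j s (K i (Suc r) x) - (K i r (X \<epsilon> j (Suc s) x) - X \<epsilon> j (Suc s) (K i r x))
   = sc (pm_sign \<epsilon> * hbar * of_int (d i * a i j) / 2) (K i r (X \<epsilon> j s x) + X \<epsilon> j s (K i r x))"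
  using rho_relator[OF yangian_relators.xi_x, of i r \<epsilon> j s x]
  by (simp only: comm_def rho_diff Y.mult Y.scalar Y.add right_minus_eq)

lemma X_X: "X \<epsilon> i (Suc r) (X \<epsilon> j s x) - X \<epsilon> j s (X \<epsilon> i (Suc r) x) - (X \<epsilon> i r (X \<epsilon> j (Suc s) x) - X \<epsilon> j (Suc s) (X \<epsilon> i r x))
   = sc (pm_sign \<epsilon> * hbar * of_int (d i * a i j) / 2) (X \<epsilon> i r (X \<epsilon> j s x) + X \<epsilon> j s (X \<epsilon> i r x))"
  using rho_relator[OF yangian_relators.x_x, of \<epsilon> i r j s x]
  by (simp only: comm_def rho_diff Y.mult Y.scalar Y.add right_minus_eq)

lemma Xp_Xm: "X Plus i r (X Minus j s x) - X Minus j s (X Plus i r x) = (if i = j then K i (r + s) x else 0)"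
  using rho_relator[OF yangian_relators.xp_xm, of i r j s x]
  by (simp add: comm_def rho_diff Y.mult rho_0 split: if_splits)

lemma d_nz: "(of_int (d i) :: complex) \<noteq> 0"
  using cartan.d_pos[of i] by simp

lemma wt_iff: "x \<in> wt \<mu> \<longleftrightarrow> (\<forall>i. K i 0 x = sc (of_int (d i * \<mu> i)) x)"
proof -
  have "\<rho> (scalar (1 / of_int (d i)) * xi i 0) x = sc (of_int (\<mu> i)) x \<longleftrightarrow> K i 0 x = sc (of_int (d i * \<mu> i)) x" for i
  proof
    assume "\<rho> (scalar (1 / of_int (d i)) * xi i 0) x = sc (of_int (\<mu> i)) x"
    hence "sc (of_int (d i)) (sc (1 / of_int (d i)) (K i 0 x)) = sc (of_int (d i)) (sc (of_int (\<mu> i)) x)"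
      by (simp only: rho_scalar)
    thus "K i 0 x = sc (of_int (d i * \<mu> i)) x" using d_nz[of i] by simp
  next
    assume "K i 0 x = sc (of_int (d i * \<mu> i)) x"
    thus "\<rho> (scalar (1 / of_int (d i)) * xi i 0) x = sc (of_int (\<mu> i)) x"
      using d_nz[of i] by (simp add: rho_scalar)
  qed
  thus ?thesis by (simp add: weight_space_def)
qed

lemma wt_K0: "x \<in> wt \<mu> \<Longrightarrow> K i 0 x = sc (of_int (d i) * of_int (\<mu> i)) x"
  by (simp add: wt_iff)

lemma wt_subspace: "subspace (wt \<mu>)"
  unfolding subspace_def
proof (intro conjI ballI allI)
  show "0 \<in> wt \<mu>" by (simp add: wt_iff linD[OF lin_\<rho>])
next
  fix x y assume "x \<in> wt \<mu>" "y \<in> wt \<mu>"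
  thus "x + y \<in> wt \<mu>" by (simp add: wt_iff linD[OF lin_\<rho>] scale_right_distrib)
next
  fix c x assume "x \<in> wt \<mu>"
  thus "sc c x \<in> wt \<mu>" by (simp add: wt_iff linD[OF lin_\<rho>] mult.commute[of c])
qed

definition raise :: "int \<Rightarrow> 'i \<Rightarrow> 'i weight \<Rightarrow> 'i weight" where
  "raise k j \<mu> = (\<lambda>l. \<mu> l + k * a l j)"

lemma raise_raise [simp]: "raise k j (raise l j \<mu>) = raise (k + l) j \<mu>"
  and raise_0 [simp]: "raise 0 j \<mu> = \<mu>"
  and raise_same: "raise k j \<mu> j = \<mu> j + 2 * k"
  by (auto simp: raise_def algebra_simps cartan.diag)

fun pm_int :: "pm \<Rightarrow> int" where "pm_int Plus = 1" | "pm_int Minus = -1"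

lemma pm_sign_int: "pm_sign \<epsilon> = of_int (pm_int \<epsilon>)"
  by (cases \<epsilon>) auto

lemma X_wt: assumes "x \<in> wt \<mu>" shows "X \<epsilon> j s x \<in> wt (raise (pm_int \<epsilon>) j \<mu>)"
  unfolding wt_iff
proof
  fix i
  have "K i 0 (X \<epsilon> j s x) = X \<epsilon> j s (K i 0 x) + sc (pm_sign \<epsilon> * of_int (d i * a i j)) (X \<epsilon> j s x)"
    using K0_X[of i \<epsilon> j s x] by (simp only: diff_eq_eq add.commute)
  also have "K i 0 x = sc (of_int (d i * \<mu> i)) x" using assms wt_iff by blast
  also have "X \<epsilon> j s (sc (of_int (d i * \<mu> i)) x) = sc (of_int (d i * \<mu> i)) (X \<epsilon> j s x)"
    by (rule linD[OF lin_\<rho>])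
  also have "sc (of_int (d i * \<mu> i)) (X \<epsilon> j s x) + sc (pm_sign \<epsilon> * of_int (d i * a i j)) (X \<epsilon> j s x)
      = sc (of_int (d i * raise (pm_int \<epsilon>) j \<mu> i)) (X \<epsilon> j s x)"
    unfolding scale_left_distrib[symmetric]
    by (rule arg_cong[where f = "\<lambda>s. sc s _"]) (simp add: raise_def pm_sign_int algebra_simps)
  finally show "K i 0 (X \<epsilon> j s x) = sc (of_int (d i * raise (pm_int \<epsilon>) j \<mu> i)) (X \<epsilon> j s x)" .
qed

lemma X_power_wt: assumes "x \<in> wt \<mu>" shows "(X \<epsilon> j s ^^ k) x \<in> wt (raise (pm_int \<epsilon> * int k) j \<mu>)"
proof (induction k)
  case (Suc k)
  from X_wt[OF Suc, of \<epsilon> j s] show ?case by (simp add: algebra_simps)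
qed (simp add: assms)

text \<open>Two weights differ at some \<open>i\<close>; subtracting from \<open>K i 0\<close> its
  eigenvalue at \<open>t\<close> removes the term \<open>t\<close> and multiplies the term
  \<open>s\<close> by a nonzero number.\<close>

lemma weight_vectors_independent:
  assumes "finite S" "inj_on \<omega> S" "\<And>s. s \<in> S \<Longrightarrow> g s \<in> wt (\<omega> s)" "(\<Sum>s\<in>S. g s) = 0"
  shows "\<forall>s\<in>S. g s = 0"
  using assms
proof (induction S arbitrary: g rule: finite_induct)
  case (insert t S)
  have "\<forall>s\<in>S. g s = 0"
  proof
    fix s assume s: "s \<in> S"
    hence "\<omega> s \<noteq> \<omega> t" using insert.hyps insert.prems(1) by (auto simp: inj_on_def)
    then obtain i where i: "\<omega> s i \<noteq> \<omega> t i" by (auto simp: fun_eq_iff)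
    let ?c = "\<lambda>u. of_int (d i * \<omega> u i - d i * \<omega> t i) :: complex"
    have "\<forall>u\<in>S. sc (?c u) (g u) = 0"
    proof (rule insert.IH)
      show "inj_on \<omega> S" using insert.prems by (simp add: inj_on_def)
      show "sc (?c u) (g u) \<in> wt (\<omega> u)" if "u \<in> S" for u
        using insert.prems(2) that wt_subspace by (auto intro: subspace_scale)
      have "0 = K i 0 (\<Sum>u\<in>insert t S. g u) - sc (of_int (d i * \<omega> t i)) (\<Sum>u\<in>insert t S. g u)"
        by (simp add: insert.prems linD[OF lin_\<rho>])
      also have "\<dots> = (\<Sum>u\<in>insert t S. K i 0 (g u) - sc (of_int (d i * \<omega> t i)) (g u))"
        by (simp only: lin_sum[OF lin_\<rho>] scale_sum_right sum_subtractf)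
      also have "\<dots> = (\<Sum>u\<in>insert t S. sc (?c u) (g u))"
      proof (intro sum.cong refl)
        fix u assume "u \<in> insert t S"
        hence "K i 0 (g u) = sc (of_int (d i * \<omega> u i)) (g u)" using insert.prems(2) wt_iff by blast
        thus "K i 0 (g u) - sc (of_int (d i * \<omega> t i)) (g u) = sc (?c u) (g u)"
          by (simp add: scale_left_diff_distrib)
      qed
      also have "\<dots> = (\<Sum>u\<in>S. sc (?c u) (g u))" using insert.hyps by simp
      finally show "(\<Sum>u\<in>S. sc (?c u) (g u)) = 0" ..
    qed
    hence "sc (?c s) (g s) = 0" using s by blast
    moreover have "?c s \<noteq> 0" using i cartan.d_pos[of i] unfolding of_int_eq_0_iff by simp
    ultimately show "g s = 0" by simp
  qed
  moreover from this have "g t = 0" using insert by simp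
  ultimately show ?case by blast
qed simp

end

section \<open>Highest weight theory of the module\<close>

locale drinfeld_rep = yangian_rep a d hbar sc \<rho>
  for a :: "'i::finite \<Rightarrow> 'i \<Rightarrow> int" and d :: "'i \<Rightarrow> int" and hbar :: complex
    and sc :: "complex \<Rightarrow> 'v::ab_group_add \<Rightarrow> 'v"
    and \<rho> :: "'i yangian_gen free_alg \<Rightarrow> 'v \<Rightarrow> 'v" +
  fixes P :: "'i \<Rightarrow> complex poly" and v :: 'v
  assumes hbar: "hbar \<noteq> 0" and monic: "lead_coeff (P j) = 1"
    and finite_dim: "\<exists>B. finite B \<and> span B = UNIV"
    and v_nz: "v \<noteq> 0" and cyclic: "range (\<lambda>p. \<rho> p v) = UNIV"
    and x_v: "\<rho> (x_series hbar Plus i $ n) v = 0"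
    and xi_v: "\<rho> (xi_series hbar i $ n) v =
        sc (fls_nth (poly_in_u (poly_shift (hbar * of_int (d i)) (P i)) / poly_in_u (P i)) (int n)) v"
begin

abbreviation "lam \<equiv> highest_weight P"

lemma Xp_v: "X Plus i r v = 0"
proof -
  have "sc hbar (X Plus i r v) = 0"
    using x_v[of i "Suc r"] by (simp add: x_series_def rho_scalar)
  thus ?thesis using hbar by simp
qed

lemma P_nz: "P i \<noteq> 0"
  using monic[of i] by auto

lemma eigenvalue_quotient:
  assumes "monic_fls f"
  shows "\<exists>G. fps_to_fls G = shift_fls c f / f \<and> G $ 0 = 1 \<and> G $ Suc 0 = c * of_int (fls_subdegree f)"
proof -
  have "f \<noteq> 0" using assms by (rule monic_fls_nonzero)
  with shift_fls_quotient_ex[OF this, of c] show ?thesis by auto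
qed

text \<open>The last conjunct is what identifies the degrees of the Drinfeld polynomials as the
  weight of \<open>v\<close>; the subdegree is minus the degree, so the two signs cancel.\<close>

lemma highest_eigenvalue:
  "\<exists>G. G $ 0 = 1 \<and> (\<forall>r. sc hbar (K i r v) = sc (G $ Suc r) v) \<and>
     fps_to_fls G = shift_fls (- (hbar * of_int (d i))) (poly_in_u (P i)) / poly_in_u (P i) \<and>
     G $ Suc 0 = hbar * of_int (d i) * of_int (lam i)"
proof -
  have "monic_fls (poly_in_u (P i))" using monic by (simp add: monic_fls_poly_in_u)
  from eigenvalue_quotient[OF this] obtain G where G:
    "fps_to_fls G = shift_fls (- (hbar * of_int (d i))) (poly_in_u (P i)) / poly_in_u (P i)"
    "G $ 0 = 1" "G $ Suc 0 = - (hbar * of_int (d i)) * of_int (fls_subdegree (poly_in_u (P i)))" by blast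
  have "sc hbar (K i r v) = sc (G $ Suc r) v" for r
    using xi_v[of i "Suc r"]
    unfolding poly_in_u_poly_shift G(1)[symmetric] by (simp add: xi_series_def rho_scalar del: of_nat_Suc)
  thus ?thesis using G
    by (intro exI[of _ G]) (simp add: fls_subdegree_poly_in_u P_nz highest_weight_def)
qed

lemma K_v: "\<exists>c. K i r v = sc c v"
proof -
  from highest_eigenvalue[of i] obtain G where "sc hbar (K i r v) = sc (G $ Suc r) v" by blast
  hence "sc (inverse hbar) (sc hbar (K i r v)) = sc (inverse hbar * G $ Suc r) v" by simp
  thus ?thesis using hbar by auto
qed

lemma v_wt: "v \<in> wt lam"
  unfolding wt_iff
proof
  fix i
  from highest_eigenvalue[of i] have "sc hbar (K i 0 v) = sc (hbar * of_int (d i) * of_int (lam i)) v" by metis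
  hence "sc hbar (K i 0 v) = sc hbar (sc (of_int (d i * lam i)) v)" by simp
  thus "K i 0 v = sc (of_int (d i * lam i)) v" using hbar by (simp only: scale_cancel_left simp_thms) 
qed

text \<open>Monomials in the lowering generators applied to \<open>v\<close>, graded by how often
  each node occurs. Their span replaces a triangular decomposition of the Yangian.\<close>

inductive lowered :: "('i \<Rightarrow> nat) \<Rightarrow> 'v \<Rightarrow> bool" where
  base: "lowered (\<lambda>_. 0) v"
| step: "lowered n x \<Longrightarrow> lowered (n(j := Suc (n j))) (X Minus j s x)"

abbreviation "L n \<equiv> span {x. lowered n x}"

definition low_wt :: "('i \<Rightarrow> nat) \<Rightarrow> 'i weight" where
  "low_wt n = (\<lambda>l. lam l - root_weight a (\<lambda>k. int (n k)) l)"

lemma low_wt_inj: "low_wt n = low_wt n' \<longleftrightarrow> n = n'"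
proof
  assume "low_wt n = low_wt n'"
  hence "root_weight a (\<lambda>k. int (n k)) = root_weight a (\<lambda>k. int (n' k))"
    by (simp add: low_wt_def fun_eq_iff)
  hence "(\<lambda>k. int (n k)) = (\<lambda>k. int (n' k))" by (rule cartan.root_weight_inj)
  thus "n = n'" by (simp add: fun_eq_iff)
qed simp

lemma root_weight_upd:
  "root_weight a (\<lambda>k. int ((n(j := Suc (n j))) k)) = (\<lambda>l. root_weight a (\<lambda>k. int (n k)) l + a l j)"
proof -
  have "(\<lambda>k. int ((n(j := Suc (n j))) k)) = (\<lambda>k. int (n k) + simple_root j k)"
    by (auto simp: simple_root_def)
  thus ?thesis by (simp only: root_weight_add root_weight_simple_root)
qed

lemma lowered_wt: "lowered n x \<Longrightarrow> x \<in> wt (low_wt n)"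
proof (induction rule: lowered.induct)
  case base
  thus ?case using v_wt by (simp add: low_wt_def root_weight_def)
next
  case (step n x j s)
  have "raise (pm_int Minus) j (low_wt n) = low_wt (n(j := Suc (n j)))"
    unfolding low_wt_def root_weight_upd raise_def by (simp add: fun_eq_iff)
  with X_wt[OF step.IH, of Minus j s] show ?case by (simp only:)
qed

lemma L_wt: "L n \<subseteq> wt (low_wt n)"
  by (rule span_minimal) (auto simp: lowered_wt wt_subspace)

lemma lin_span:
  assumes "lin T" "\<And>x. x \<in> A \<Longrightarrow> T x \<in> span B" "x \<in> span A"
  shows "T x \<in> span B"
proof -
  have "subspace {x. T x \<in> span B}"
    unfolding subspace_def by (auto simp: linD[OF assms(1)] span_zero intro: span_add span_scale)
  hence "span A \<subseteq> {x. T x \<in> span B}" by (intro span_minimal) (auto simp: assms(2))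
  thus ?thesis using assms(3) by blast
qed

lemma Xm_L: "x \<in> L n \<Longrightarrow> X Minus j s x \<in> L (n(j := Suc (n j)))"
proof (rule lin_span[OF lin_\<rho>])
  fix x assume "x \<in> {x. lowered n x}"
  hence "lowered (n(j := Suc (n j))) (X Minus j s x)" by (intro lowered.step) simp
  thus "X Minus j s x \<in> L (n(j := Suc (n j)))" by (intro span_base CollectI)
qed

text \<open>The relation between \<open>K\<close> and \<open>X Minus\<close> lowers the index of
  \<open>K\<close> while raising that of \<open>X\<close>, and all its other terms keep the
  multidegree.\<close>

lemma K_lowered: "lowered n x \<Longrightarrow> K i r x \<in> L n"
proof (induction arbitrary: r rule: lowered.induct)
  case base
  obtain c where "K i r v = sc c v" using K_v by blast
  thus ?case by (simp add: span_scale span_base lowered.base)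
next
  case (step n x j s)
  note IH = Xm_L[OF step.IH]
  have low: "X Minus j s x \<in> L (n(j := Suc (n j)))" for s
    using lowered.step[OF step.hyps] by (intro span_base CollectI)
  \<comment> \<open>The claim is kept for all \<open>s\<close> because the step from
    \<open>r\<close> to \<open>Suc r\<close> uses \<open>Suc s\<close>.\<close>
  have "\<forall>s. K i r (X Minus j s x) \<in> L (n(j := Suc (n j)))"
  proof (induction r)
    case 0
    have "K i 0 (X Minus j s x) = X Minus j s (K i 0 x) + sc (pm_sign Minus * of_int (d i * a i j)) (X Minus j s x)" for s
      using K0_X[of i Minus j s x] by (simp only: diff_eq_eq add.commute)
    thus ?case by (simp only:) (intro allI span_add span_scale IH low)
  next
    case (Suc r)
    show ?case
    proof
      fix s
      let ?c = "pm_sign Minus * hbar * of_int (d i * a i j) / 2"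
      have "K i (Suc r) (X Minus j s x) = X Minus j s (K i (Suc r) x) + (K i r (X Minus j (Suc s) x) - X Minus j (Suc s) (K i r x))
         + sc ?c (K i r (X Minus j s x) + X Minus j s (K i r x))"
        using K_X[of i r Minus j s x] by (simp only: diff_eq_eq add_ac)
      also have "\<dots> \<in> L (n(j := Suc (n j)))"
        by (intro span_add span_scale span_diff IH Suc[rule_format])
      finally show "K i (Suc r) (X Minus j s x) \<in> L (n(j := Suc (n j)))" .
    qed
  qed
  thus ?case by blast
qed

abbreviation "Low \<equiv> {x. \<exists>n. lowered n x}"

lemma L_sub: "L n \<subseteq> span Low"
  by (intro span_mono) auto

lemma Xm_Low: "x \<in> span Low \<Longrightarrow> X Minus j s x \<in> span Low"
proof (rule lin_span[OF lin_\<rho>, where A = Low])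
  fix x assume "x \<in> Low"
  then obtain n where "lowered n x" by blast
  hence "lowered (n(j := Suc (n j))) (X Minus j s x)" by (rule lowered.step)
  thus "X Minus j s x \<in> span Low" by (intro span_base) blast
qed

lemma Xp_Low: assumes "x \<in> span Low" shows "X Plus i r x \<in> span Low"
proof (rule lin_span[OF lin_\<rho> _ assms])
  fix x assume "x \<in> Low"
  then obtain n where "lowered n x" by blast
  thus "X Plus i r x \<in> span Low"
  proof (induction rule: lowered.induct)
    case base
    thus ?case by (simp add: Xp_v span_zero)
  next
    case (step n x j s)
    have "X Plus i r (X Minus j s x) = X Minus j s (X Plus i r x) + (if i = j then K i (r + s) x else 0)"
      using Xp_Xm[of i r j s x] by (simp only: diff_eq_eq add.commute)
    moreover have "(if i = j then K i (r + s) x else 0) \<in> span Low"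
      using K_lowered[OF step.hyps] L_sub by (auto simp: span_zero)
    ultimately show ?case by (simp only:) (intro span_add Xm_Low step.IH)
  qed
qed

lemma K_Low: "x \<in> span Low \<Longrightarrow> K i r x \<in> span Low"
proof (rule lin_span[OF lin_\<rho>, where A = Low])
  fix x assume "x \<in> Low"
  then obtain n where "lowered n x" by blast
  from K_lowered[OF this] show "K i r x \<in> span Low" using L_sub by (rule subsetD[rotated])
qed

text \<open>The span contains the cyclic vector \<open>v\<close> and is stable under every
  generator, hence under every word.\<close>

lemma span_Low: "span Low = UNIV"
proof -
  have gen: "\<rho> (gen g) x \<in> span Low" if "x \<in> span Low" for g x
  proof (cases g)
    case (Xi i r) thus ?thesis using K_Low that by simp
  next
    case (X \<epsilon> i r) thus ?thesis using Xp_Low Xm_Low that by (cases \<epsilon>) auto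
  qed
  have word: "\<rho> (prod_list (map gen gs)) v \<in> span Low" for gs
    by (induction gs) (auto simp: rho_1 Y.mult intro: gen span_base lowered.base)
  have "\<rho> p v \<in> span Low" for p
    by (subst free_alg_expand) (simp add: rho_sum rho_scalar, intro span_sum span_scale word)
  hence "range (\<lambda>p. \<rho> p v) \<subseteq> span Low" by (rule image_subsetI)
  thus ?thesis unfolding cyclic by (rule top_le)
qed

text \<open>Grouping an expansion of \<open>x\<close> by multidegree gives components of distinct
  weights, and only the one of weight \<open>\<nu>\<close> can survive.\<close>

lemma weight_vector_lowered:
  assumes "x \<in> wt \<nu>" "x \<noteq> 0"
  shows "\<exists>n. \<nu> = low_wt n \<and> x \<in> L n"
proof -
  have "x \<in> span Low" by (simp add: span_Low)
  then obtain t r where t: "finite t" "t \<subseteq> Low" "x = (\<Sum>b\<in>t. sc (r b) b)"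
    unfolding span_explicit by blast
  hence "\<forall>b\<in>t. \<exists>n. lowered n b" by blast
  from bchoice[OF this] obtain n where n: "\<And>b. b \<in> t \<Longrightarrow> lowered (n b) b" by blast
  define T where "T = n ` t"
  define h where "h = (\<lambda>m. \<Sum>b\<in>{b\<in>t. n b = m}. sc (r b) b)"
  have h: "h m \<in> L m" for m
    unfolding h_def
  proof (rule span_sum)
    fix b assume "b \<in> {b \<in> t. n b = m}"
    hence "lowered m b" using n[of b] by simp
    thus "sc (r b) b \<in> L m" by (intro span_scale) (simp add: span_base)
  qed
  have hw: "h m \<in> wt (low_wt m)" for m using h L_wt by (rule subsetD[rotated])
  have x: "x = (\<Sum>m\<in>T. h m)"
    unfolding t(3) T_def h_def by (rule sum.image_gen[OF t(1)])
  have fin: "finite T" using t(1) by (simp add: T_def)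
  show ?thesis
  proof (cases "\<exists>m\<in>T. \<nu> = low_wt m")
    case True
    then obtain m where m: "m \<in> T" "\<nu> = low_wt m" by blast
    \<comment> \<open>Subtracting \<open>x\<close> from the component of its own weight makes the
      family sum to zero.\<close>
    define k where "k = h(m := h m - x)"
    have "\<forall>s\<in>T. k s = 0"
    proof (rule weight_vectors_independent[OF fin])
      show "inj_on low_wt T" by (auto simp: inj_on_def low_wt_inj)
      have "h m - x \<in> wt (low_wt m)" using hw assms(1) m(2) by (simp add: subspace_diff[OF wt_subspace])
      thus "k s \<in> wt (low_wt s)" if "s \<in> T" for s
        using hw by (simp add: k_def)
      have "(\<Sum>s\<in>T. k s) = (\<Sum>s\<in>T. h s) - x"
        using m(1) fin by (simp add: k_def sum.remove[of T m] algebra_simps)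
      thus "(\<Sum>s\<in>T. k s) = 0" using x by simp
    qed
    hence "h m = x" using m(1) by (auto simp: k_def)
    thus ?thesis using h m(2) by blast
  next
    case False
    \<comment> \<open>The extra index \<open>None\<close> carries \<open>- x\<close>; here its
      weight differs from all others, so independence gives \<open>x = 0\<close>.\<close>
    define k where "k = case_option (- x) h"
    have "\<forall>s\<in>insert None (Some ` T). k s = 0"
    proof (rule weight_vectors_independent)
      show "inj_on (case_option \<nu> low_wt) (insert None (Some ` T))"
        using False by (auto simp: inj_on_def low_wt_inj)
      show "k s \<in> wt (case_option \<nu> low_wt s)" if "s \<in> insert None (Some ` T)" for s
        using that hw assms(1) by (auto simp: k_def subspace_neg[OF wt_subspace])
      show "(\<Sum>s\<in>insert None (Some ` T). k s) = 0"
        using fin x by (simp add: k_def sum.reindex)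
    qed (use fin in simp)
    hence "x = 0" by (simp add: k_def)
    thus ?thesis using assms(2) by simp
  qed
qed

lemma lowered_zero: "lowered n x \<Longrightarrow> n = (\<lambda>_. 0) \<Longrightarrow> x = v"
proof (induction rule: lowered.induct)
  case (step n x j s)
  from fun_cong[OF step.prems, of j] show ?case by simp
qed simp

lemma wt_lam: assumes "x \<in> wt lam" shows "\<exists>c. x = sc c v"
proof (cases "x = 0")
  case True
  thus ?thesis by (intro exI[of _ 0]) simp
next
  case False
  then obtain n where n: "lam = low_wt n" "x \<in> L n" using weight_vector_lowered[OF assms] by blast
  have "low_wt (\<lambda>_. 0) = lam" by (simp add: low_wt_def root_weight_def)
  hence "n = (\<lambda>_. 0)" using n(1) low_wt_inj by metis
  hence "x \<in> span {v}" using n(2) lowered_zero span_mono[of "{x. lowered n x}" "{v}"] by auto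
  thus ?thesis by (auto simp: span_singleton)
qed

definition weights :: "'i weight set" where
  "weights = {\<mu>. \<exists>x\<in>wt \<mu>. x \<noteq> 0}"

text \<open>Each raising step removes one factor of node \<open>i\<close> from the multidegree,
  which cannot become negative.\<close>

lemma Xp_nilpotent:
  assumes "x \<in> wt \<nu>" shows "\<exists>k. (X Plus i 0 ^^ k) x = 0"
proof (rule ccontr)
  assume *: "\<not> ?thesis"
  have ex: "\<exists>n. raise (int k) i \<nu> = low_wt n" for k
    using weight_vector_lowered[OF X_power_wt[OF assms, of k Plus i 0]] * by auto
  obtain n0 where n0: "\<nu> = low_wt n0" using ex[of 0] by auto
  let ?k = "Suc (n0 i)"
  obtain n where n: "raise (int ?k) i \<nu> = low_wt n" using ex by blast
  have "root_weight a (\<lambda>k. int (n k) + int ?k * simple_root i k) = root_weight a (\<lambda>k. int (n0 k))"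
  proof
    fix l
    have "raise (int ?k) i \<nu> l = low_wt n l" using n by simp
    moreover have "root_weight a (\<lambda>k. int ?k * simple_root i k) l = int ?k * a l i"
      using root_weight_simple_root[of a i] unfolding root_weight_def
      by (simp only: mult.left_commute[of _ "int ?k"] flip: sum_distrib_left) (simp only: fun_eq_iff)
    ultimately show "root_weight a (\<lambda>k. int (n k) + int ?k * simple_root i k) l = root_weight a (\<lambda>k. int (n0 k)) l"
      unfolding root_weight_add by (simp add: raise_def n0 low_wt_def)
  qed
  hence "(\<lambda>k. int (n k) + int ?k * simple_root i k) = (\<lambda>k. int (n0 k))" by (rule cartan.root_weight_inj)
  hence "int (n i) + int ?k * simple_root i i = int (n0 i)" by metis
  thus False by (simp add: simple_root_def)
qed

text \<open>Here the weights alone give no bound: nonzero lowered vectors have distinct weights, so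
  infinitely many would contradict finite dimension.\<close>

lemma Xm_nilpotent:
  assumes "x \<in> wt \<nu>" shows "\<exists>k. (X Minus i 0 ^^ k) x = 0"
proof (rule ccontr)
  let ?y = "\<lambda>k. (X Minus i 0 ^^ k) x"
  assume *: "\<not> ?thesis"
  have wt: "?y k \<in> wt (raise (- int k) i \<nu>)" for k
    using X_power_wt[OF assms, of k Minus i 0] by simp
  have inj_raise: "k = l" if "raise (- int k) i \<nu> = raise (- int l) i \<nu>" for k l
    using fun_cong[OF that, of i] by (simp add: raise_same)
  have ind: "\<forall>k\<in>S. sc (u k) (?y k) = 0" if "finite S" "(\<Sum>k\<in>S. sc (u k) (?y k)) = 0" for S u
  proof (rule weight_vectors_independent)
    show "inj_on (\<lambda>k. raise (- int k) i \<nu>) S" by (auto simp: inj_on_def inj_raise)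
    show "sc (u k) (?y k) \<in> wt (raise (- int k) i \<nu>)" for k
      by (intro subspace_scale wt_subspace wt)
  qed (use that in auto)
  have inj: "inj ?y"
  proof (rule injI, rule ccontr)
    fix k l assume kl: "?y k = ?y l" "k \<noteq> l"
    have "\<forall>m\<in>{k, l}. sc (if m = k then 1 else - 1) (?y m) = 0"
      using kl by (intro ind) auto
    thus False using * by auto
  qed
  obtain B where B: "finite B" "span B = UNIV" using finite_dim by blast
  let ?S = "?y ` {..card B}"
  have "independent ?S"
  proof
    assume "dependent ?S"
    then obtain u z where u: "(\<Sum>b\<in>?S. sc (u b) b) = 0" "z \<in> ?S" "u z \<noteq> 0"
      using dependent_finite[of ?S] by auto
    have "(\<Sum>k\<le>card B. sc (u (?y k)) (?y k)) = 0"
      using u(1) sum.reindex[OF inj_on_subset[OF inj subset_UNIV], of "\<lambda>b. sc (u b) b" "{..card B}"] by simp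
    hence "\<forall>k\<in>{..card B}. sc (u (?y k)) (?y k) = 0" by (intro ind) auto
    thus False using u(2,3) * by auto
  qed
  hence "card ?S \<le> card B" using independent_span_bound[OF B(1)] B(2) by auto
  thus False using card_image[OF inj_on_subset[OF inj subset_UNIV], of "{..card B}"] by simp
qed

lemma last_nonzero:
  assumes "\<exists>k. (T ^^ k) x = 0" "x \<noteq> 0"
  shows "\<exists>p. (T ^^ p) x \<noteq> 0 \<and> T ((T ^^ p) x) = 0"
proof -
  define k where "k = (LEAST k. (T ^^ k) x = 0)"
  have k: "(T ^^ k) x = 0" unfolding k_def using assms(1) by (metis (mono_tags) LeastI)
  then obtain p where p: "k = Suc p" using assms(2) by (cases k) auto
  have "(T ^^ p) x \<noteq> 0" using not_less_Least[of p "\<lambda>k. (T ^^ k) x = 0"] p k_def by auto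
  thus ?thesis using k p by auto
qed

text \<open>From a vector of weight \<open>\<nu>\<close> one goes to an end of its sl2-string, and
  \<open>sl2_string_nonzero\<close> ensures that walking back reaches the reflected weight. The sign
  of \<open>\<nu> i\<close> decides which end is used.\<close>

lemma weights_simple_reflection:
  assumes "\<nu> \<in> weights" shows "simple_reflection a i \<nu> \<in> weights"
proof -
  obtain x where x: "x \<in> wt \<nu>" "x \<noteq> 0" using assms by (auto simp: weights_def)
  have refl: "simple_reflection a i \<nu> = raise (- \<nu> i) i \<nu>"
    by (simp add: simple_reflection_def raise_def)
  show ?thesis
  proof (cases "\<nu> i \<ge> 0")
    case True
    from last_nonzero[OF Xp_nilpotent[OF x(1)] x(2)] obtain p where
      p: "(X Plus i 0 ^^ p) x \<noteq> 0" "X Plus i 0 ((X Plus i 0 ^^ p) x) = 0" by blast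
    define y where "y = (X Plus i 0 ^^ p) x"
    have y: "y \<in> wt (raise (int p) i \<nu>)" using X_power_wt[OF x(1), of p Plus i 0] by (simp add: y_def)
    have wy: "(X Minus i 0 ^^ q) y \<in> wt (raise (int p - int q) i \<nu>)" for q
      using X_power_wt[OF y, of q Minus i 0] by simp
    \<comment> \<open>The top of the string has weight \<open>\<nu> i + 2 * p\<close> at
      \<open>i\<close>, so \<open>p + \<nu> i\<close> steps down are within its length.\<close>
    have "(X Minus i 0 ^^ (p + nat (\<nu> i))) y \<noteq> 0"
    proof (rule sl2_string_nonzero[where E = "X Plus i 0" and H = "K i 0" and \<delta> = "of_int (d i)" and N = "nat (\<nu> i) + 2 * p"])
      show "X Plus i 0 (X Minus i 0 x) = X Minus i 0 (X Plus i 0 x) + K i 0 x" for x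
        using Xp_Xm[of i 0 i 0 x] by (simp add: diff_eq_eq add.commute)
      show "K i 0 ((X Minus i 0 ^^ q) y) = sc (of_int (d i) * (of_nat (nat (\<nu> i) + 2 * p) - 2 * of_nat q)) ((X Minus i 0 ^^ q) y)" for q
        using wt_K0[OF wy[of q], of i] True by (simp add: raise_same of_nat_nat algebra_simps)
    qed (use p y_def d_nz in \<open>auto simp: lin_\<rho>\<close>)
    moreover have "int p - int (p + nat (\<nu> i)) = - \<nu> i" using True by simp
    hence "(X Minus i 0 ^^ (p + nat (\<nu> i))) y \<in> wt (simple_reflection a i \<nu>)"
      using wy[of "p + nat (\<nu> i)"] by (simp only: refl)
    ultimately show ?thesis unfolding weights_def by blast
  next
    case False
    from last_nonzero[OF Xm_nilpotent[OF x(1)] x(2)] obtain p where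
      p: "(X Minus i 0 ^^ p) x \<noteq> 0" "X Minus i 0 ((X Minus i 0 ^^ p) x) = 0" by blast
    define y where "y = (X Minus i 0 ^^ p) x"
    have y: "y \<in> wt (raise (- int p) i \<nu>)" using X_power_wt[OF x(1), of p Minus i 0] by (simp add: y_def)
    have wy: "(X Plus i 0 ^^ q) y \<in> wt (raise (int q - int p) i \<nu>)" for q
      using X_power_wt[OF y, of q Plus i 0] by simp
    have "(X Plus i 0 ^^ (p + nat (- \<nu> i))) y \<noteq> 0"
    proof (rule sl2_string_nonzero[where E = "X Minus i 0" and H = "\<lambda>x. - K i 0 x" and \<delta> = "of_int (d i)" and N = "nat (- \<nu> i) + 2 * p"])
      show "X Minus i 0 (X Plus i 0 x) = X Plus i 0 (X Minus i 0 x) + - K i 0 x" for x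
        using Xp_Xm[of i 0 i 0 x] by (simp add: algebra_simps)
      show "- K i 0 ((X Plus i 0 ^^ q) y) = sc (of_int (d i) * (of_nat (nat (- \<nu> i) + 2 * p) - 2 * of_nat q)) ((X Plus i 0 ^^ q) y)" for q
        using wt_K0[OF wy[of q], of i] False
        by (simp add: raise_same of_nat_nat algebra_simps flip: scale_minus_left)
    qed (use p y_def d_nz in \<open>auto simp: lin_\<rho>\<close>)
    moreover have "int (p + nat (- \<nu> i)) - int p = - \<nu> i" using False by simp
    hence "(X Plus i 0 ^^ (p + nat (- \<nu> i))) y \<in> wt (simple_reflection a i \<nu>)"
      using wy[of "p + nat (- \<nu> i)"] by (simp only: refl)
    ultimately show ?thesis unfolding weights_def by blast
  qed
qed

lemma weights_weyl_word: "\<nu> \<in> weights \<Longrightarrow> weyl_word a js \<nu> \<in> weights"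
  by (induction js) (auto simp: weyl_word_Cons weights_simple_reflection)

text \<open>Undoing \<open>weyl_word a js\<close> would give the weight \<open>lam\<close> plus a
  nonzero root with nonnegative coordinates, but all weights are \<open>lam\<close> minus such
  combinations.\<close>

lemma extremal_raise_not_weight:
  assumes "reduced_expression a (j # js) w"
  shows "raise 1 j (weyl_word a js lam) \<notin> weights"
proof
  assume "raise 1 j (weyl_word a js lam) \<in> weights"
  hence "weyl_word a (rev js) (raise 1 j (weyl_word a js lam)) \<in> weights" by (rule weights_weyl_word)
  moreover have "raise 1 j \<mu> = (\<lambda>l. \<mu> l + root_weight a (simple_root j) l)" for \<mu>
    by (simp add: raise_def root_weight_simple_root)
  ultimately have "(\<lambda>l. lam l + root_weight a (fold (root_refl a) js (simple_root j)) l) \<in> weights"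
    by (simp only: weyl_word_add cartan.weyl_word_rev cartan.weyl_word_rev_root_weight)
  then obtain x where "x \<in> wt (\<lambda>l. lam l + root_weight a (fold (root_refl a) js (simple_root j)) l)" "x \<noteq> 0"
    by (auto simp: weights_def)
  then obtain n where "(\<lambda>l. lam l + root_weight a (fold (root_refl a) js (simple_root j)) l) = low_wt n"
    using weight_vector_lowered by blast
  hence "root_weight a (\<lambda>k. fold (root_refl a) js (simple_root j) k + int (n k)) = root_weight a (\<lambda>k. 0)"
    unfolding root_weight_add by (simp add: low_wt_def fun_eq_iff root_weight_def)
  hence "(\<lambda>k. fold (root_refl a) js (simple_root j) k + int (n k)) = (\<lambda>k. 0)" by (rule cartan.root_weight_inj)
  moreover obtain k where "fold (root_refl a) js (simple_root j) k \<noteq> 0"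
    using cartan.fold_root_refl_nonzero by blast
  ultimately show False using cartan.reduced_root_nonneg(1)[OF assms, of k]
    by (metis add_nonneg_eq_0_iff of_nat_0_le_iff)
qed

text \<open>The coordinate is the pairing of the dominant weight \<open>lam\<close> with a positive
  coroot.\<close>

lemma extremal_coordinate_nonneg:
  assumes "reduced_expression a (j # js) w"
  shows "weyl_word a js lam j \<ge> 0"
  unfolding weyl_word_coordinate
  by (intro sum_nonneg mult_nonneg_nonneg cartan.reduced_root_nonneg(2)[OF assms])
    (simp add: highest_weight_def)

end

section \<open>Eigenvalues on extremal weight vectors\<close>

text \<open>Leading differences are additive in products, which linearizes the system defining the \<open>A\<^sub>i\<close>.\<close>

definition leading_diff :: "nat \<Rightarrow> complex fps \<Rightarrow> complex fps \<Rightarrow> complex \<Rightarrow> bool" where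
  "leading_diff n F F' x \<longleftrightarrow> F $ 0 = 1 \<and> F' $ 0 = 1 \<and> (\<forall>k<n. F $ k = F' $ k) \<and> F $ n - F' $ n = x"

lemma leading_diff_refl: "F $ 0 = 1 \<Longrightarrow> leading_diff n F F 0"
  by (simp add: leading_diff_def)

lemma leading_diff_mult:
  assumes "n > 0" "leading_diff n F F' x" "leading_diff n G G' y"
  shows "leading_diff n (F * G) (F' * G') (x + y)"
proof -
  have "(F * G) $ k = (F' * G') $ k" if "k < n" for k
    unfolding fps_mult_nth using assms that by (intro sum.cong refl) (auto simp: leading_diff_def)
  moreover have "(F * G) $ n - (F' * G') $ n = x + y"
  proof -
    have "(F * G) $ n - (F' * G') $ n = (\<Sum>i=0..n. F $ i * G $ (n - i) - F' $ i * G' $ (n - i))"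
      by (simp add: fps_mult_nth sum_subtractf)
    also have "\<dots> = (\<Sum>i=0..n. (if i = 0 then y else 0) + (if i = n then x else 0))"
    proof (intro sum.cong refl)
      fix i assume "i \<in> {0..n}"
      then consider "i = 0" | "i = n" "i \<noteq> 0" | "0 < i" "i < n" by fastforce
      thus "F $ i * G $ (n - i) - F' $ i * G' $ (n - i) = (if i = 0 then y else 0) + (if i = n then x else 0)"
        by cases (use assms in \<open>auto simp: leading_diff_def\<close>)
    qed
    also have "\<dots> = x + y" by (simp add: sum.distrib add.commute)
    finally show ?thesis .
  qed
  ultimately show ?thesis using assms by (simp add: leading_diff_def)
qed

text \<open>\<open>shifted_u_inv c\<close> begins with \<open>X\<close>, so its power
  \<open>n\<close> has coefficient 1 at \<open>X ^ n\<close>; the shift changes only higher orders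
  of the difference.\<close>

lemma leading_diff_shift:
  assumes "leading_diff n F F' x"
  shows "leading_diff n (F oo shifted_u_inv c) (F' oo shifted_u_inv c) x"
proof -
  have "(F oo shifted_u_inv c) $ k = (F' oo shifted_u_inv c) $ k" if "k < n" for k
    unfolding fps_compose_nth using assms that by (intro sum.cong refl) (auto simp: leading_diff_def)
  moreover have "(F oo shifted_u_inv c) $ n - (F' oo shifted_u_inv c) $ n = x"
  proof -
    have top: "(shifted_u_inv c ^ n) $ n = 1"
    proof -
      define h where "h = Abs_fps (\<lambda>n. c ^ n)"
      have "shifted_u_inv c = fps_X * h"
        by (rule fps_ext) (simp add: h_def shifted_u_inv_def)
      thus ?thesis by (simp add: power_mult_distrib fps_X_power_mult_nth fps_power_zeroth h_def)
    qed
    have "(F oo shifted_u_inv c) $ n - (F' oo shifted_u_inv c) $ n = (\<Sum>i=0..n. (F $ i - F' $ i) * (shifted_u_inv c ^ i) $ n)"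
      by (simp add: fps_compose_nth sum_subtractf left_diff_distrib)
    also have "\<dots> = (\<Sum>i=0..n. if i = n then x else 0)"
      using assms by (intro sum.cong refl) (auto simp: leading_diff_def top)
    finally show ?thesis by simp
  qed
  ultimately show ?thesis using assms by (simp add: leading_diff_def)
qed

lemma leading_diff_prod_list:
  assumes "n > 0" "\<And>r. r \<in> set rs \<Longrightarrow> leading_diff n (F r) (F' r) x"
  shows "leading_diff n (prod_list (map F rs)) (prod_list (map F' rs)) (of_nat (length rs) * x)"
  using assms(2)
proof (induction rs)
  case (Cons r rs)
  have "leading_diff n (F r * prod_list (map F rs)) (F' r * prod_list (map F' rs)) (x + of_nat (length rs) * x)"
    using Cons by (intro leading_diff_mult assms(1)) auto
  thus ?case by (simp add: algebra_simps)
qed (simp add: leading_diff_refl)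

lemma leading_diff_prod:
  assumes "n > 0" "finite S" "\<And>r. r \<in> S \<Longrightarrow> leading_diff n (F r) (F' r) (x r)"
  shows "leading_diff n (prod F S) (prod F' S) (sum x S)"
  using assms(2,3)
  by (induction S rule: finite_induct) (auto simp: leading_diff_refl intro!: leading_diff_mult assms(1))

context simple_cartan_datum begin

text \<open>The defining equations of the \<open>A_i\<close> evaluated on a joint eigenvector:
  \<open>G\<close> holds the eigenvalues of the Cartan series, \<open>\<alpha>\<close> those of the
  \<open>A_i\<close>.\<close>

definition A_system :: "complex \<Rightarrow> ('i \<Rightarrow> complex fps) \<Rightarrow> ('i \<Rightarrow> complex fps) \<Rightarrow> bool" where
  "A_system hbar G \<alpha> \<longleftrightarrow> (\<forall>i. G i $ 0 = 1 \<and> \<alpha> i $ 0 = 1 \<and>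
     G i * (\<alpha> i * (\<alpha> i oo shifted_u_inv (hbar * of_int (d i)))) =
     (\<Prod>j\<in>-{i}. prod_list (map (\<lambda>r. \<alpha> j oo shifted_u_inv (hbar * of_int (d j) / 2 * of_int (2 * int r + a j i)))
        [1..<Suc (nat (- a j i))])))"

text \<open>At the first order where two solutions differ, the equations become linear, and the
  differences lie in the kernel of the transposed Cartan matrix.\<close>

lemma A_system_unique:
  assumes "A_system hbar G \<alpha>" "A_system hbar G \<beta>"
  shows "\<alpha> = \<beta>"
proof -
  have "\<forall>i. \<alpha> i $ n = \<beta> i $ n" for n
  proof (induction n rule: less_induct)
    case (less n)
    show ?case
    proof (cases "n = 0")
      case True
      thus ?thesis using assms by (simp add: A_system_def)
    next
      case False
      hence n: "n > 0" by simp
      define x where "x = (\<lambda>i. \<alpha> i $ n - \<beta> i $ n)"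
      have ld: "leading_diff n (\<alpha> i) (\<beta> i) (x i)" for i
        using assms less.IH by (simp add: A_system_def leading_diff_def x_def)
      have "(\<Sum>j\<in>UNIV. of_int (a j i) * x j) = 0" for i
      proof -
        let ?L = "\<lambda>\<alpha>. G i * (\<alpha> i * (\<alpha> i oo shifted_u_inv (hbar * of_int (d i))))"
        let ?R = "\<lambda>\<alpha>. (\<Prod>j\<in>-{i}. prod_list (map (\<lambda>r. \<alpha> j oo shifted_u_inv (hbar * of_int (d j) / 2 * of_int (2 * int r + a j i)))
          [1..<Suc (nat (- a j i))]))"
        have "leading_diff n (?L \<alpha>) (?L \<beta>) (0 + (x i + x i))"
          using assms by (intro leading_diff_mult[OF n] leading_diff_refl leading_diff_shift ld) (simp add: A_system_def)
        moreover have "leading_diff n (?R \<alpha>) (?R \<beta>) (\<Sum>j\<in>-{i}. of_nat (length [1..<Suc (nat (- a j i))]) * x j)"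
          by (intro leading_diff_prod leading_diff_prod_list n leading_diff_shift ld) simp
        ultimately have "0 + (x i + x i) = (\<Sum>j\<in>-{i}. of_nat (length [1..<Suc (nat (- a j i))]) * x j)"
          using assms by (simp add: A_system_def leading_diff_def)
        also have "\<dots> = (\<Sum>j\<in>-{i}. - (of_int (a j i) * x j))"
          using off_diag[of _ i] by (intro sum.cong refl) (simp add: of_nat_nat del: upt_Suc)
        finally have "of_int (a i i) * x i + (\<Sum>j\<in>-{i}. of_int (a j i) * x j) = 0"
          by (simp add: sum_negf diag)
        thus ?thesis by (simp add: sum.remove[of UNIV i] Compl_eq_Diff_UNIV)
      qed
      hence "x j = 0" for j by (rule cartan_kernel_trivial)
      thus ?thesis by (simp add: x_def)
    qed
  qed
  thus ?thesis by (simp add: fun_eq_iff fps_eq_iff)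
qed

lemma shift_prod_list_telescope:
  assumes "\<nu> \<noteq> 0"
  shows "prod_list (map (\<lambda>r. shift_fls (c + of_nat r * \<eta>) (shift_fls (- \<eta>) \<nu> / \<nu>)) [1..<Suc n])
     = shift_fls c \<nu> / shift_fls (c + of_nat n * \<eta>) \<nu>"
  using assms by (induction n) (auto simp: shift_fls_divide algebra_simps)

lemma fps_to_fls_prod_list: "fps_to_fls (prod_list xs) = prod_list (map fps_to_fls xs)"
  for xs :: "complex fps list"
  by (induction xs) (auto simp: fls_times_fps_to_fls)

text \<open>Passing to the reflected weight changes only the eigenvalue of \<open>A_j\<close>. In
  equation \<open>j\<close> this works because \<open>G' j\<close> is the inverse of
  \<open>G j\<close> shifted by \<open>hbar * d j\<close>; in equation \<open>i \<noteq> j\<close>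
  the shifted copies of \<open>G j\<close> telescope to the factor relating \<open>G' i\<close> to
  \<open>G i\<close>.\<close>

lemma A_system_step:
  assumes sys: "A_system hbar G \<alpha>" and "\<nu> \<noteq> 0"
    and Gj: "fps_to_fls (G j) = shift_fls (- (hbar * of_int (d j))) \<nu> / \<nu>"
    and G'0: "\<And>i. G' i $ 0 = 1"
    and G': "\<And>i. fps_to_fls (G' i) = fps_to_fls (G i) * shift_fls (hbar * of_int (d j) * of_int (a j i) / 2) \<nu>
                     / shift_fls (- (hbar * of_int (d j) * of_int (a j i) / 2)) \<nu>"
  shows "A_system hbar G' (\<alpha>(j := \<alpha> j * G j))"
  unfolding A_system_def
proof (intro allI conjI)
  fix i
  let ?\<beta> = "\<alpha>(j := \<alpha> j * G j)" and ?\<eta> = "hbar * of_int (d j)"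
  let ?p = "\<lambda>j r. shifted_u_inv (hbar * of_int (d j) / 2 * of_int (2 * int r + a j i))"
  show "G' i $ 0 = 1" by (rule G'0)
  show "?\<beta> i $ 0 = 1" using sys by (simp add: A_system_def)
  have eq: "fps_to_fls (G i * (\<alpha> i * (\<alpha> i oo shifted_u_inv (hbar * of_int (d i))))) =
     fps_to_fls (\<Prod>k\<in>-{i}. prod_list (map (\<lambda>r. \<alpha> k oo ?p k r) [1..<Suc (nat (- a k i))]))"
    using sys unfolding A_system_def by simp
  show "G' i * (?\<beta> i * (?\<beta> i oo shifted_u_inv (hbar * of_int (d i)))) =
     (\<Prod>k\<in>-{i}. prod_list (map (\<lambda>r. ?\<beta> k oo ?p k r) [1..<Suc (nat (- a k i))]))"
  proof (cases "i = j")
    case True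
    have "(\<Prod>k\<in>-{i}. prod_list (map (\<lambda>r. ?\<beta> k oo ?p k r) [1..<Suc (nat (- a k i))]))
        = (\<Prod>k\<in>-{i}. prod_list (map (\<lambda>r. \<alpha> k oo ?p k r) [1..<Suc (nat (- a k i))]))"
      using True by (intro prod.cong) auto
    moreover have "fps_to_fls (G' j * (?\<beta> j * (?\<beta> j oo shifted_u_inv ?\<eta>)))
        = fps_to_fls (G j * (\<alpha> j * (\<alpha> j oo shifted_u_inv ?\<eta>)))"
    proof -
      have "fps_to_fls (G' j * (?\<beta> j * (?\<beta> j oo shifted_u_inv ?\<eta>)))
        = fps_to_fls (\<alpha> j) * shift_fls ?\<eta> (fps_to_fls (\<alpha> j)) *
          (fps_to_fls (G' j) * fps_to_fls (G j) * shift_fls ?\<eta> (fps_to_fls (G j)))"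
        by (simp add: fls_times_fps_to_fls fps_compose_mult_distrib shift_fls_fps_to_fls mult_ac)
      also have "fps_to_fls (G' j) * fps_to_fls (G j) * shift_fls ?\<eta> (fps_to_fls (G j)) = fps_to_fls (G j)"
        unfolding G' Gj using assms(2) by (simp add: diag shift_fls_divide)
      finally show ?thesis by (simp add: fls_times_fps_to_fls shift_fls_fps_to_fls mult_ac)
    qed
    ultimately show ?thesis using eq True by (simp only: fps_to_fls_eq_iff)
  next
    case False
    define n where "n = nat (- a j i)"
    have n: "of_int (a j i) = - (of_nat n :: complex)"
      using off_diag[of j i] False by (simp add: n_def of_nat_nat)
    define Rest where "Rest = (\<Prod>k\<in>-{i}-{j}. prod_list (map (\<lambda>r. \<alpha> k oo ?p k r) [1..<Suc (nat (- a k i))]))"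
    have split: "(\<Prod>k\<in>-{i}. prod_list (map (\<lambda>r. F k oo ?p k r) [1..<Suc (nat (- a k i))]))
       = prod_list (map (\<lambda>r. F j oo ?p j r) [1..<Suc (nat (- a j i))]) *
         (\<Prod>k\<in>-{i}-{j}. prod_list (map (\<lambda>r. F k oo ?p k r) [1..<Suc (nat (- a k i))]))" for F
      using False by (intro prod.remove) auto
    have rest: "(\<Prod>k\<in>-{i}-{j}. prod_list (map (\<lambda>r. ?\<beta> k oo ?p k r) [1..<Suc (nat (- a k i))])) = Rest"
      unfolding Rest_def by (intro prod.cong) auto
    have "prod_list (map (\<lambda>r. (\<alpha> j * G j) oo ?p j r) xs)
        = prod_list (map (\<lambda>r. \<alpha> j oo ?p j r) xs) * prod_list (map (\<lambda>r. G j oo ?p j r) xs)" for xs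
      by (induction xs) (auto simp: fps_compose_mult_distrib)
    moreover have "fps_to_fls (prod_list (map (\<lambda>r. G j oo ?p j r) [1..<Suc (nat (- a j i))]))
        = shift_fls (?\<eta> * of_int (a j i) / 2) \<nu> / shift_fls (- (?\<eta> * of_int (a j i) / 2)) \<nu>"
    proof -
      have "fps_to_fls (G j oo ?p j r) = shift_fls (- (of_nat n * ?\<eta> / 2) + of_nat r * ?\<eta>) (shift_fls (- ?\<eta>) \<nu> / \<nu>)" for r
        unfolding Gj[symmetric] shift_fls_fps_to_fls
        by (simp add: n algebra_simps add_divide_distrib diff_divide_distrib)
      hence "fps_to_fls (prod_list (map (\<lambda>r. G j oo ?p j r) [1..<Suc n]))
        = prod_list (map (\<lambda>r. shift_fls (- (of_nat n * ?\<eta> / 2) + of_nat r * ?\<eta>) (shift_fls (- ?\<eta>) \<nu> / \<nu>)) [1..<Suc n])"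
        by (simp only: fps_to_fls_prod_list map_map comp_def)
      also have "\<dots> = shift_fls (- (of_nat n * ?\<eta> / 2)) \<nu> / shift_fls (- (of_nat n * ?\<eta> / 2) + of_nat n * ?\<eta>) \<nu>"
        by (rule shift_prod_list_telescope[OF assms(2)])
      also have "- (of_nat n * ?\<eta> / 2) + of_nat n * ?\<eta> = - (?\<eta> * of_int (a j i) / 2)"
        by (simp add: n field_simps)
      also have "- (of_nat n * ?\<eta> / 2) = ?\<eta> * of_int (a j i) / 2" by (simp add: n field_simps)
      finally show ?thesis by (simp add: n_def)
    qed
    ultimately have "fps_to_fls (\<Prod>k\<in>-{i}. prod_list (map (\<lambda>r. ?\<beta> k oo ?p k r) [1..<Suc (nat (- a k i))]))
       = fps_to_fls (prod_list (map (\<lambda>r. \<alpha> j oo ?p j r) [1..<Suc (nat (- a j i))]) * Rest) *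
         (shift_fls (?\<eta> * of_int (a j i) / 2) \<nu> / shift_fls (- (?\<eta> * of_int (a j i) / 2)) \<nu>)"
      unfolding split rest by (simp add: fls_times_fps_to_fls mult_ac del: upt_Suc)
    also have "\<dots> = fps_to_fls (G i * (\<alpha> i * (\<alpha> i oo shifted_u_inv (hbar * of_int (d i))))) *
         (shift_fls (?\<eta> * of_int (a j i) / 2) \<nu> / shift_fls (- (?\<eta> * of_int (a j i) / 2)) \<nu>)"
      unfolding eq split Rest_def ..
    also have "\<dots> = fps_to_fls (G' i * (\<alpha> i * (\<alpha> i oo shifted_u_inv (hbar * of_int (d i)))))"
      by (simp add: fls_times_fps_to_fls G' mult_ac)
    finally have "(\<Prod>k\<in>-{i}. prod_list (map (\<lambda>r. ?\<beta> k oo ?p k r) [1..<Suc (nat (- a k i))]))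
       = G' i * (\<alpha> i * (\<alpha> i oo shifted_u_inv (hbar * of_int (d i))))"
      by (simp only: fps_to_fls_eq_iff)
    moreover have "?\<beta> i = \<alpha> i" using False by simp
    ultimately show ?thesis by simp
  qed
qed

text \<open>Shifting by \<open>- hbar * d i\<close> moves factor \<open>k\<close> of the operator to
  factor \<open>k + 1\<close>, so the quotient telescopes to its two ends. The symmetrizer identity
  then expresses it through \<open>d j * a j i\<close>, the form produced by
  \<open>bottom_eigenvalue\<close>.\<close>

lemma tau_gen_quotient:
  fixes \<mu> :: "'i \<Rightarrow> complex fls" and hbar :: complex
  assumes "\<mu> i \<noteq> 0" "\<mu> j \<noteq> 0"
  defines "\<eta> \<equiv> hbar * of_int (d j)"
  shows "shift_fls (- (hbar * of_int (d i))) (tau_gen a d hbar j \<mu> i) / tau_gen a d hbar j \<mu> i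
     = shift_fls (- (hbar * of_int (d i))) (\<mu> i) / \<mu> i * shift_fls (\<eta> * of_int (a j i) / 2) (\<mu> j)
         / shift_fls (- (\<eta> * of_int (a j i) / 2)) (\<mu> j)"
proof -
  let ?\<theta> = "hbar * of_int (d i)"
  define e :: int where "e = (if i = j then - 1 else 1)"
  define n where "n = nat \<bar>a i j\<bar>"
  define t where "t = (\<lambda>k::nat. shift_fls (?\<theta> / 2 * of_int (\<bar>a i j\<bar> - 2 * int k)) (\<mu> j))"
  have t_nz: "t k \<noteq> 0" for k using assms(2) by (simp add: t_def)
  have st: "shift_fls (- ?\<theta>) (t k) = t (Suc k)" for k
    unfolding t_def shift_fls_shift_fls by (rule arg_cong[where f = "\<lambda>c. shift_fls c _"]) (simp add: field_simps)
  have tau: "tau_gen a d hbar j \<mu> i = \<mu> i * (\<Prod>k<n. t k powi e)"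
    by (simp add: tau_gen_def t_def n_def e_def)
  have spowi: "shift_fls c (f powi e) = shift_fls c f powi e" for c f
    by (simp add: e_def shift_fls_inverse power_int_minus)
  have "shift_fls (- ?\<theta>) (\<Prod>k<n. t k powi e) / (\<Prod>k<n. t k powi e) = (\<Prod>k<n. t (Suc k) powi e / t k powi e)"
    by (simp add: shift_fls_prod spowi st prod_dividef)
  also have "\<dots> = t n powi e / t 0 powi e"
    using t_nz by (induction n) auto
  finally have 0: "shift_fls (- ?\<theta>) (\<Prod>k<n. t k powi e) / (\<Prod>k<n. t k powi e) = t n powi e / t 0 powi e" .
  have 1: "shift_fls (- ?\<theta>) (tau_gen a d hbar j \<mu> i) / tau_gen a d hbar j \<mu> i
      = shift_fls (- ?\<theta>) (\<mu> i) / \<mu> i * (t n powi e / t 0 powi e)"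
    unfolding tau shift_fls_mult times_divide_times_eq[symmetric] 0 ..
  have sym: "of_int (d i) * of_int (a i j) = (of_int (d j) * of_int (a j i) :: complex)"
    using symmetrized[of i j] by (simp flip: of_int_mult)
  have "t n powi e / t 0 powi e = shift_fls (\<eta> * of_int (a j i) / 2) (\<mu> j) / shift_fls (- (\<eta> * of_int (a j i) / 2)) (\<mu> j)"
  proof (cases "i = j")
    case True
    thus ?thesis by (simp add: e_def t_def n_def diag \<eta>_def power_int_minus field_simps)
  next
    case False
    have "\<bar>a i j\<bar> = - a i j" using off_diag[OF False] by simp
    hence A: "\<bar>a i j\<bar> - 2 * int n = a i j" "\<bar>a i j\<bar> - 2 * int 0 = - a i j" by (simp_all add: n_def)
    have "?\<theta> * of_int (a i j) = \<eta> * of_int (a j i)" unfolding \<eta>_def using sym by (metis mult.assoc)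
    hence B: "?\<theta> / 2 * of_int (a i j) = \<eta> * of_int (a j i) / 2" by simp
    have "?\<theta> / 2 * of_int (\<bar>a i j\<bar> - 2 * int n) = \<eta> * of_int (a j i) / 2"
      "?\<theta> / 2 * of_int (\<bar>a i j\<bar> - 2 * int 0) = - (\<eta> * of_int (a j i) / 2)"
      by (simp_all only: A of_int_minus mult_minus_right B)
    thus ?thesis using False by (simp add: e_def t_def)
  qed
  with 1 show ?thesis by simp
qed

end

lemma tau_word_Nil [simp]: "tau_word a d hbar [] \<mu> = \<mu>"
  and tau_word_Cons: "tau_word a d hbar (j # js) \<mu> = tau_gen a d hbar j (tau_word a d hbar js \<mu>)"
  by (simp_all add: tau_word_def)

lemma monic_fls_tau_gen: "(\<And>i. monic_fls (\<mu> i)) \<Longrightarrow> monic_fls (tau_gen a d hbar j \<mu> i)"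
  unfolding tau_gen_def by (intro monic_fls_mult monic_fls_prod monic_fls_powi monic_fls_shift)

context drinfeld_rep begin

section \<open>Extremal vectors along reduced words\<close>

abbreviation "tw js \<equiv> tau_word a d hbar js (\<lambda>j. poly_in_u (P j))"

lemma monic_fls_tw: "monic_fls (tw js i)"
  by (induction js arbitrary: i) (simp_all add: monic_fls_poly_in_u monic tau_word_Cons monic_fls_tau_gen)

definition xi_eigenvalue :: "'v \<Rightarrow> 'i \<Rightarrow> complex fps \<Rightarrow> bool" where
  "xi_eigenvalue y i G \<longleftrightarrow> G $ 0 = 1 \<and> (\<forall>r. sc hbar (K i r y) = sc (G $ Suc r) y)"

text \<open>The induction invariant. The eigenvalues are expressed through the word, not through its
  Weyl group element, because independence of the word is a consequence drawn later.\<close>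

definition extremal_vector :: "'i list \<Rightarrow> 'v \<Rightarrow> bool" where
  "extremal_vector js y \<longleftrightarrow> y \<noteq> 0 \<and> y \<in> wt (weyl_word a js lam) \<and>
     (\<forall>x\<in>wt (weyl_word a js lam). \<exists>c. x = sc c y) \<and>
     (\<forall>i. \<exists>G. xi_eigenvalue y i G \<and> fps_to_fls G = shift_fls (- (hbar * of_int (d i))) (tw js i) / tw js i)"

lemma extremal_vector_Nil: "extremal_vector [] v"
  unfolding extremal_vector_def xi_eigenvalue_def
  using v_nz v_wt wt_lam highest_eigenvalue by simp blast

lemma extremal_step:
  assumes y: "extremal_vector js y" and red: "reduced_expression a (j # js) w"
  shows "\<exists>z. extremal_vector (j # js) z" and "\<exists>p. tw js j = poly_in_u p"
proof -
  define \<mu> where "\<mu> = weyl_word a js lam"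
  define m where "m = nat (\<mu> j)"
  have m: "\<mu> j = int m" using extremal_coordinate_nonneg[OF red] by (simp add: m_def \<mu>_def)
  from y obtain G where
    G: "\<And>i. xi_eigenvalue y i (G i)" "\<And>i. fps_to_fls (G i) = shift_fls (- (hbar * of_int (d i))) (tw js i) / tw js i"
    unfolding extremal_vector_def by metis
  define \<gamma> where "\<gamma> = (\<lambda>i r. inverse hbar * G i $ Suc r)"
  have K_y: "K i r y = sc (\<gamma> i r) y" for i r
  proof -
    have "sc hbar (K i r y) = sc (G i $ Suc r) y" using G(1) by (simp add: xi_eigenvalue_def)
    hence "sc (inverse hbar) (sc hbar (K i r y)) = sc (\<gamma> i r) y" by (simp add: \<gamma>_def)
    thus ?thesis using hbar by simp
  qed
  have G_eq: "Abs_fps (\<lambda>n. if n = 0 then 1 else hbar * \<gamma> i (n - 1)) = G i" for i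
    using G(1)[of i] hbar by (intro fps_ext) (auto simp: \<gamma>_def xi_eigenvalue_def)
  have not_weight: "raise 1 j \<mu> \<notin> weights"
    using extremal_raise_not_weight[OF red] by (simp add: \<mu>_def)
  have refl: "raise (- int m) j \<mu> = simple_reflection a j \<mu>"
    by (simp add: raise_def simple_reflection_def m)
  \<comment> \<open>Since \<open>\<mu> j = m\<close>, the reflection at \<open>j\<close> exchanges
    the positions \<open>m + 1\<close> steps below and one step above \<open>\<mu>\<close>.\<close>
  have bottom: "raise (- int (Suc m)) j \<mu> \<notin> weights"
  proof
    assume "raise (- int (Suc m)) j \<mu> \<in> weights"
    moreover have "simple_reflection a j (raise (- int (Suc m)) j \<mu>) = raise 1 j \<mu>"
      unfolding simple_reflection_def by (rule ext) (simp add: raise_same m, simp add: raise_def algebra_simps)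
    ultimately show False using weights_simple_reflection not_weight by metis
  qed
  interpret R: extremal_string sc "X Plus j" "X Minus j" "K j" "of_int (d j)" hbar
    "\<lambda>k. wt (raise (- int k) j \<mu>)" m y "\<gamma> j"
  proof
    show "lin (X Plus j r)" "lin (X Minus j r)" "lin (K j r)" for r by (rule lin_\<rho>)+
    show "hbar \<noteq> 0" by (rule hbar)
    show "of_int (d j) \<noteq> (0::complex)" by (rule d_nz)
    show "X Minus j (Suc r) (X Minus j s x) - X Minus j s (X Minus j (Suc r) x) -
          (X Minus j r (X Minus j (Suc s) x) - X Minus j (Suc s) (X Minus j r x)) =
          sc (- (hbar * of_int (d j))) (X Minus j r (X Minus j s x) + X Minus j s (X Minus j r x))" for r s x
      using X_X[of Minus j r j s x] by (simp add: cartan.diag)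
    show "X Plus j r (X Minus j s x) - X Minus j s (X Plus j r x) = K j (r + s) x" for r s x
      using Xp_Xm[of j r j s x] by simp
    show "subspace (wt (raise (- int k) j \<mu>))" for k by (rule wt_subspace)
    show "X Minus j r x \<in> wt (raise (- int (Suc k)) j \<mu>)" if "x \<in> wt (raise (- int k) j \<mu>)" for x k r
      using X_wt[OF that, of Minus j r] by simp
    show "X Plus j r x \<in> wt (raise (- int k) j \<mu>)" if "x \<in> wt (raise (- int (Suc k)) j \<mu>)" for x k r
      using X_wt[OF that, of Plus j r] by simp
    show "K j 0 x = sc (of_int (d j) * (of_nat m - 2 * of_nat k)) x" if "x \<in> wt (raise (- int k) j \<mu>)" for x k
      using wt_K0[OF that, of j] by (simp add: raise_same m)
    show "x = 0" if "x \<in> wt (raise (- int (Suc m)) j \<mu>)" for x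
      using bottom that unfolding weights_def by blast
    show "\<exists>c. x = sc c y" if "x \<in> wt (raise (- int 0) j \<mu>)" for x
      using y that by (simp add: extremal_vector_def \<mu>_def)
    show "y \<in> wt (raise (- int 0) j \<mu>)" "y \<noteq> 0"
      using y by (simp_all add: extremal_vector_def \<mu>_def)
    show "X Plus j r y = 0" for r
    proof -
      have "y \<in> wt \<mu>" using y by (simp add: extremal_vector_def \<mu>_def)
      from X_wt[OF this, of Plus j r] show ?thesis using not_weight unfolding weights_def by auto
    qed
    show "K j r y = sc (\<gamma> j r) y" for r by (rule K_y)
  qed
  have g: "R.g = G j" unfolding R.g_def by (rule G_eq)
  have \<nu>: "tw js j \<noteq> 0" "fps_to_fls R.g = shift_fls (- (hbar * of_int (d j))) (tw js j) / tw js j"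
    using monic_fls_nonzero[OF monic_fls_tw] G(2) g by simp_all
  show "\<exists>p. tw js j = poly_in_u p" using R.eigenvalue_polynomial[OF \<nu>] .
  have "\<exists>G'. xi_eigenvalue R.z i G' \<and> fps_to_fls G' = shift_fls (- (hbar * of_int (d i))) (tw (j # js) i) / tw (j # js) i" for i
  proof -
    have sym: "d i * a i j = d j * a j i" by (rule cartan.symmetrized)
    have "\<exists>G'. (\<forall>r. sc hbar (K i r R.z) = sc (G' $ Suc r) R.z) \<and> G' $ 0 = 1 \<and>
       fps_to_fls G' = fps_to_fls (Abs_fps (\<lambda>n. if n = 0 then 1 else hbar * \<gamma> i (n - 1))) *
         shift_fls (- of_int (- a j i) * (hbar * of_int (d j)) / 2) (tw js j) / shift_fls (of_int (- a j i) * (hbar * of_int (d j)) / 2) (tw js j)"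
    \<comment> \<open>The sign of \<open>Minus\<close> and \<open>d i * a i j = d j * a j i\<close>
      give \<open>N = - a j i\<close>, measured in units of the fixed node \<open>j\<close>.\<close>
    proof (rule R.bottom_eigenvalue[OF \<nu>, of "K i" "- a j i" "\<gamma> i"])
      show "lin (K i r)" for r by (rule lin_\<rho>)
      show "K i 0 (X Minus j s x) - X Minus j s (K i 0 x) = sc (of_int (d j) * of_int (- a j i)) (X Minus j s x)" for s x
        using K0_X[of i Minus j s x] unfolding sym by simp
      show "K i (Suc r) (X Minus j s x) - X Minus j s (K i (Suc r) x) - (K i r (X Minus j (Suc s) x) - X Minus j (Suc s) (K i r x))
          = sc (hbar * of_int (d j) * of_int (- a j i) / 2) (K i r (X Minus j s x) + X Minus j s (K i r x))" for r s x
        using K_X[of i r Minus j s x] unfolding sym by (simp add: mult.assoc)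
      show "K i r y = sc (\<gamma> i r) y" for r by (rule K_y)
    qed
    then obtain G' where G': "\<forall>r. sc hbar (K i r R.z) = sc (G' $ Suc r) R.z" "G' $ 0 = 1"
      "fps_to_fls G' = fps_to_fls (Abs_fps (\<lambda>n. if n = 0 then 1 else hbar * \<gamma> i (n - 1))) *
         shift_fls (- of_int (- a j i) * (hbar * of_int (d j)) / 2) (tw js j) / shift_fls (of_int (- a j i) * (hbar * of_int (d j)) / 2) (tw js j)"
      by blast
    have "fps_to_fls G' = shift_fls (- (hbar * of_int (d i))) (tw (j # js) i) / tw (j # js) i"
      unfolding G'(3) G_eq G(2) tau_word_Cons
        cartan.tau_gen_quotient[OF monic_fls_nonzero[OF monic_fls_tw] monic_fls_nonzero[OF monic_fls_tw]]
      by (simp add: mult_ac)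
    thus ?thesis using G'(1,2) unfolding xi_eigenvalue_def by blast
  qed
  moreover have "wt (weyl_word a (j # js) lam) = wt (raise (- int m) j \<mu>)"
    unfolding refl by (simp add: weyl_word_Cons \<mu>_def)
  ultimately have "extremal_vector (j # js) R.z"
    unfolding extremal_vector_def using R.z_nz R.z_S R.bottom_span by simp
  thus "\<exists>z. extremal_vector (j # js) z" by blast
qed

lemma extremal_vector_exists:
  assumes "reduced_expression a js w" shows "\<exists>y. extremal_vector js y"
  using assms
proof (induction js arbitrary: w)
  case Nil
  show ?case using extremal_vector_Nil by blast
next
  case (Cons j js)
  have "reduced_expression a js (weyl_word a js)"
    using reduced_expression_tail[of a "[j]" js w] Cons.prems by simp
  from Cons.IH[OF this] obtain y where "extremal_vector js y" by blast
  from extremal_step(1)[OF this Cons.prems] show ?case .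
qed

lemma xi_eigenvalue_unique:
  assumes "xi_eigenvalue y i G" "xi_eigenvalue (sc c y) i G'" "sc c y \<noteq> 0"
  shows "G = G'"
proof (rule fps_ext)
  fix n
  show "G $ n = G' $ n"
  proof (cases n)
    case 0
    thus ?thesis using assms by (simp add: xi_eigenvalue_def)
  next
    case (Suc r)
    have "sc (G' $ Suc r) (sc c y) = sc hbar (K i r (sc c y))"
      using assms(2) unfolding xi_eigenvalue_def by metis
    also have "\<dots> = sc c (sc hbar (K i r y))"
      by (simp add: linD[OF lin_\<rho>] mult.commute)
    also have "sc hbar (K i r y) = sc (G $ Suc r) y"
      using assms(1) unfolding xi_eigenvalue_def by metis
    also have "sc c (sc (G $ Suc r) y) = sc (G $ Suc r) (sc c y)"
      by (simp add: mult.commute)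
    finally have "sc (G' $ Suc r) (sc c y) = sc (G $ Suc r) (sc c y)" .
    thus ?thesis using Suc assms(3) by (metis scale_cancel_right)
  qed
qed

lemma tw_reduced_unique:
  assumes "reduced_expression a js w" "reduced_expression a ks w"
  shows "tw js = tw ks"
proof
  fix i
  have w: "weyl_word a ks = weyl_word a js" using assms by (simp add: reduced_expression_def)
  obtain y where y: "extremal_vector js y" using extremal_vector_exists[OF assms(1)] by blast
  obtain y' where y': "extremal_vector ks y'" using extremal_vector_exists[OF assms(2)] by blast
  have "y' \<in> wt (weyl_word a js lam)" "y' \<noteq> 0" using y' by (simp_all add: extremal_vector_def w)
  moreover have "\<forall>x\<in>wt (weyl_word a js lam). \<exists>c. x = sc c y" using y by (simp add: extremal_vector_def)
  ultimately obtain c where c: "y' = sc c y" "sc c y \<noteq> 0" by metis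
  obtain G where G: "xi_eigenvalue y i G" "fps_to_fls G = shift_fls (- (hbar * of_int (d i))) (tw js i) / tw js i"
    using y unfolding extremal_vector_def by blast
  obtain G' where G': "xi_eigenvalue y' i G'" "fps_to_fls G' = shift_fls (- (hbar * of_int (d i))) (tw ks i) / tw ks i"
    using y' unfolding extremal_vector_def by blast
  have "G = G'" using xi_eigenvalue_unique G(1) G'(1) c by blast
  thus "tw js i = tw ks i"
    using G(2) G'(2) hbar d_nz[of i] by (intro monic_fls_eqI[OF monic_fls_tw monic_fls_tw, of "- (hbar * of_int (d i))"]) auto
qed

lemma tau_eq_tw:
  assumes "reduced_expression a js (weyl_word a js)"
  shows "tau a d hbar (weyl_word a js) (\<lambda>j. poly_in_u (P j)) = tw js"
proof -
  have "reduced_expression a (SOME ks. reduced_expression a ks (weyl_word a js)) (weyl_word a js)"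
    by (rule someI[of "\<lambda>ks. reduced_expression a ks (weyl_word a js)", OF assms])
  from tw_reduced_unique[OF this assms] show ?thesis by (simp add: tau_def)
qed

section \<open>Eigenvalues of the series \<open>A_i\<close>\<close>

definition eig :: "'v \<Rightarrow> 'i yangian_gen free_alg fps \<Rightarrow> complex fps \<Rightarrow> bool" where
  "eig y F s \<longleftrightarrow> (\<forall>n. \<rho> (F $ n) y = sc (s $ n) y)"

lemma eig_1: "eig y 1 1"
  by (simp add: eig_def rho_1 rho_0)

lemma eig_mult: "eig y F s \<Longrightarrow> eig y G t \<Longrightarrow> eig y (F * G) (s * t)"
  by (simp add: eig_def fps_mult_nth rho_sum Y.mult linD[OF lin_\<rho>] scale_sum_left mult.commute)

lemma scalar_mult: "scalar c * scalar b = scalar (c * b)" and scalar_sum: "(\<Sum>x\<in>S. scalar (h x)) = scalar (sum h S)"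
  by (simp add: scalar_def mult_single,
      induction S rule: infinite_finite_induct, auto simp: scalar_def single_add)

lemma scalar_series_power: "(Abs_fps (\<lambda>n. scalar (p $ n)) ^ k) $ n = scalar ((p ^ k) $ n)"
proof (induction k arbitrary: n)
  case 0
  show ?case by (simp add: scalar_def)
next
  case (Suc k)
  show ?case by (simp add: fps_mult_nth Suc scalar_mult scalar_sum)
qed

lemma eig_shift: assumes "eig y F s" shows "eig y (shift_series c F) (s oo shifted_u_inv c)"
proof -
  have "\<rho> (scalar b) x = sc b x" for b x by (rule Y.scalar)
  thus ?thesis using assms
    by (simp add: eig_def shift_series_def fps_compose_nth scalar_series_power rho_sum Y.mult
        linD[OF lin_\<rho>] scale_sum_left mult.commute)
qed

lemma eig_prod_list:
  "(\<And>r. r \<in> set rs \<Longrightarrow> eig y (F r) (s r)) \<Longrightarrow> eig y (prod_list (map F rs)) (prod_list (map s rs))"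
  by (induction rs) (auto intro: eig_1 eig_mult)

text \<open>The eigenvalues commute, so the unspecified order of the operators disappears.\<close>

lemma eig_some_order_prod:
  assumes "finite S" "\<And>j. j \<in> S \<Longrightarrow> eig y (F j) (s j)"
  shows "eig y (some_order_prod F S) (prod s S)"
proof -
  define xs where "xs = (SOME xs. distinct xs \<and> set xs = S)"
  have xs: "distinct xs \<and> set xs = S"
    unfolding xs_def using finite_distinct_list[OF assms(1)] by (metis (mono_tags, lifting) someI_ex)
  have "eig y (prod_list (map F xs)) (prod_list (map s xs))"
    using assms(2) xs by (intro eig_prod_list) auto
  moreover have "prod_list (map s xs) = prod s S"
    using xs prod.distinct_set_conv_list[of xs s] by simp
  ultimately show ?thesis by (simp add: some_order_prod_def xs_def)
qed

lemma eig_unique: "eig y F s \<Longrightarrow> eig y F t \<Longrightarrow> y \<noteq> 0 \<Longrightarrow> s = t"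
  by (rule fps_ext) (metis eig_def scale_cancel_right)

lemma cartan_subalgebra_scalar:
  assumes "p \<in> cartan_subalgebra" "\<And>i r. \<exists>c. K i r y = sc c y"
  shows "\<exists>c. \<rho> p y = sc c y"
proof -
  have word: "\<exists>c. \<rho> (prod_list (map gen gs)) y = sc c y" if "set gs \<subseteq> {Xi i r | i r. True}" for gs
    using that
  proof (induction gs)
    case Nil
    show ?case by (intro exI[of _ 1]) (simp add: rho_1)
  next
    case (Cons g gs)
    then obtain c i r where "\<rho> (prod_list (map gen gs)) y = sc c y" "g = Xi i r" by auto
    moreover obtain b where "K i r y = sc b y" using assms(2) by blast
    ultimately show ?case by (intro exI[of _ "c * b"]) (simp add: Y.mult linD[OF lin_\<rho>])
  qed
  have "\<forall>w\<in>Poly_Mapping.keys p. \<exists>c. \<rho> (prod_list (map gen (letters w))) y = sc c y"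
  proof
    fix w assume "w \<in> Poly_Mapping.keys p"
    hence "set (letters w) \<subseteq> {Xi i r | i r. True}"
      using assms(1) unfolding cartan_subalgebra_def by blast
    thus "\<exists>c. \<rho> (prod_list (map gen (letters w))) y = sc c y" by (rule word)
  qed
  from bchoice[OF this] obtain c where c: "\<And>w. w \<in> Poly_Mapping.keys p \<Longrightarrow> \<rho> (prod_list (map gen (letters w))) y = sc (c w) y"
    by blast
  have "\<rho> p y = (\<Sum>w\<in>Poly_Mapping.keys p. sc (Poly_Mapping.lookup p w) (\<rho> (prod_list (map gen (letters w))) y))"
    by (subst (1) free_alg_expand) (simp add: rho_sum rho_scalar)
  also have "\<dots> = sc (\<Sum>w\<in>Poly_Mapping.keys p. Poly_Mapping.lookup p w * c w) y"
    by (simp add: c scale_sum_left)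
  finally show ?thesis by blast
qed

text \<open>Modulo the ideal the coefficients of \<open>A_i\<close> are polynomials in the Cartan
  generators, hence scalars on \<open>y\<close>; the defining relations then turn into scalar
  equations.\<close>

lemma A_eigenvalues:
  assumes A: "is_A_series a d hbar A" and y: "y \<noteq> 0" and G: "\<And>i. xi_eigenvalue y i (G i)"
  shows "\<exists>\<alpha>. (\<forall>i. eig y (A i) (\<alpha> i)) \<and> cartan.A_system hbar G \<alpha>"
proof -
  have Kc: "\<exists>c. K i r y = sc c y" for i r
  proof -
    have "sc (inverse hbar) (sc hbar (K i r y)) = sc (inverse hbar) (sc (G i $ Suc r) y)"
      using G by (simp add: xi_eigenvalue_def)
    hence "K i r y = sc (inverse hbar * G i $ Suc r) y" using hbar by simp
    thus ?thesis by blast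
  qed
  have "\<exists>c. \<rho> (A i $ n) y = sc c y" for i n
  proof -
    obtain p where "p \<in> cartan_subalgebra" "yangian_eq a d hbar (A i $ n) p"
      using A unfolding is_A_series_def by blast
    thus ?thesis using rho_eq cartan_subalgebra_scalar[OF _ Kc] by metis
  qed
  then obtain c where c: "\<And>i n. \<rho> (A i $ n) y = sc (c i n) y" by metis
  define \<alpha> where "\<alpha> = (\<lambda>i. Abs_fps (c i))"
  have \<alpha>: "eig y (A i) (\<alpha> i)" for i by (simp add: eig_def \<alpha>_def c)
  have "cartan.A_system hbar G \<alpha>"
    unfolding cartan.A_system_def
  proof (intro allI conjI)
    fix i
    show "G i $ 0 = 1" using G by (simp add: xi_eigenvalue_def)
    have "yangian_eq a d hbar (A i $ 0) 1" using A unfolding is_A_series_def by blast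
    from rho_eq[OF this, of y] have "sc (\<alpha> i $ 0) y = sc 1 y" using \<alpha>[of i] by (simp add: rho_1 eig_def)
    thus "\<alpha> i $ 0 = 1" using y by (metis scale_cancel_right)
    have xi: "eig y (xi_series hbar i) (G i)"
      unfolding eig_def
    proof
      fix n show "\<rho> (xi_series hbar i $ n) y = sc (G i $ n) y"
        using G[of i] by (cases n) (simp_all add: xi_series_def xi_eigenvalue_def rho_1 rho_scalar)
    qed
    let ?L = "xi_series hbar i * (A i * shift_series (hbar * of_int (d i)) (A i))"
    let ?R = "some_order_prod (\<lambda>j. prod_list (map
             (\<lambda>r. shift_series (hbar * of_int (d j) / 2 * of_int (2 * int r + a j i)) (A j))
             [1..<Suc (nat (- a j i))])) (- {i})"
    have L: "eig y ?L (G i * (\<alpha> i * (\<alpha> i oo shifted_u_inv (hbar * of_int (d i)))))"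
      by (intro eig_mult eig_shift xi \<alpha>)
    have "\<rho> (?L $ n) y = \<rho> (?R $ n) y" for n
      using A unfolding is_A_series_def by (intro rho_eq) blast
    hence "eig y ?R (G i * (\<alpha> i * (\<alpha> i oo shifted_u_inv (hbar * of_int (d i)))))"
      using L by (simp add: eig_def)
    moreover have "eig y ?R (\<Prod>j\<in>-{i}. prod_list (map (\<lambda>r. \<alpha> j oo shifted_u_inv (hbar * of_int (d j) / 2 * of_int (2 * int r + a j i)))
        [1..<Suc (nat (- a j i))]))"
      by (intro eig_some_order_prod eig_prod_list eig_shift \<alpha>) simp
    ultimately show "G i * (\<alpha> i * (\<alpha> i oo shifted_u_inv (hbar * of_int (d i)))) =
     (\<Prod>j\<in>-{i}. prod_list (map (\<lambda>r. \<alpha> j oo shifted_u_inv (hbar * of_int (d j) / 2 * of_int (2 * int r + a j i)))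
        [1..<Suc (nat (- a j i))]))"
      using eig_unique y by blast
  qed
  with \<alpha> show ?thesis by blast
qed

text \<open>The positions \<open>r\<close> start at 1, so \<open>js ! (r - 1)\<close> is the r-th
  letter and \<open>drop r js\<close> the word after it.\<close>

definition Q_prod :: "'i list \<Rightarrow> 'i \<Rightarrow> complex fls" where
  "Q_prod js i = (\<Prod>r | r \<in> {1..length js} \<and> js ! (r - 1) = i. tw (drop r js) i)"

lemma Q_prod_Cons: "Q_prod (j # js) i = (if i = j then tw js j else 1) * Q_prod js i"
proof -
  let ?S = "{r. r \<in> {1..length js} \<and> js ! (r - 1) = i}"
  have set: "{r. r \<in> {1..length (j # js)} \<and> (j # js) ! (r - 1) = i} = (if i = j then {1} else {}) \<union> Suc ` ?S"
  proof (intro set_eqI iffI)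
    fix r assume "r \<in> {r. r \<in> {1..length (j # js)} \<and> (j # js) ! (r - 1) = i}"
    hence r: "r \<in> {1..Suc (length js)}" "(j # js) ! (r - 1) = i" by auto
    show "r \<in> (if i = j then {1} else {}) \<union> Suc ` ?S"
    proof (cases "r = 1")
      case False
      then obtain q where "r = Suc q" "q > 0" using r(1) by (cases r) auto
      thus ?thesis using r by (cases q) auto
    qed (use r in auto)
  qed (auto split: if_splits simp: nth_Cons')
  have "Q_prod (j # js) i = (\<Prod>r\<in>(if i = j then {1} else {}) \<union> Suc ` ?S. tw (drop r (j # js)) i)"
    unfolding Q_prod_def set ..
  also have "\<dots> = (\<Prod>r\<in>(if i = j then {1} else {}). tw (drop r (j # js)) i) * (\<Prod>r\<in>Suc ` ?S. tw (drop r (j # js)) i)"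
    by (intro prod.union_disjoint) auto
  also have "(\<Prod>r\<in>Suc ` ?S. tw (drop r (j # js)) i) = Q_prod js i"
    unfolding Q_prod_def by (subst prod.reindex) (auto simp: comp_def)
  finally show ?thesis by simp
qed

text \<open>Prefixing a letter \<open>j\<close> multiplies the eigenvalue of \<open>A_j\<close> by
  \<open>G j = p(u + hbar * d j) / p(u)\<close> with \<open>p = tw js j\<close>, that is, it
  multiplies \<open>Q\<close> by \<open>p\<close>. The induction quantifies over the extremal
  vectors, as each word has its own.\<close>

lemma A_eigenvalue_extremal:
  assumes A: "is_A_series a d hbar A" and red: "reduced_expression a js w"
    and y: "extremal_vector js y" and \<alpha>0: "\<And>i. eig v (A i) (\<alpha>0 i)"
  shows "\<exists>\<alpha> Q. eig y (A i) \<alpha> \<and> lead_coeff Q = 1 \<and> poly_in_u Q = Q_prod js i \<and>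
    fps_to_fls \<alpha> = fps_to_fls (\<alpha>0 i) * (shift_fls (- (hbar * of_int (d i))) (poly_in_u Q) / poly_in_u Q)"
proof -
  let ?C = "\<lambda>js \<alpha>. \<forall>i. \<exists>Q. lead_coeff Q = 1 \<and> poly_in_u Q = Q_prod js i \<and>
    fps_to_fls (\<alpha> i) = fps_to_fls (\<alpha>0 i) * (shift_fls (- (hbar * of_int (d i))) (poly_in_u Q) / poly_in_u Q)"
  have "\<forall>y. extremal_vector js y \<longrightarrow> (\<exists>\<alpha>. (\<forall>i. eig y (A i) (\<alpha> i)) \<and> ?C js \<alpha>)"
    using red
  proof (induction js arbitrary: w)
    case Nil
    have "eig y (A i) (\<alpha>0 i)" if "extremal_vector [] y" for y i
    proof -
      have "y \<in> wt lam" using that by (simp add: extremal_vector_def)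
      then obtain c where "y = sc c v" using wt_lam by blast
      thus ?thesis using \<alpha>0[of i] by (simp add: eig_def linD[OF lin_\<rho>] mult.commute)
    qed
    moreover have "?C [] \<alpha>0" by (intro allI exI[of _ 1]) (simp add: Q_prod_def)
    ultimately show ?case by blast
  next
    case (Cons j js)
    have red: "reduced_expression a js (weyl_word a js)"
      using reduced_expression_tail[of a "[j]" js w] Cons.prems by simp
    obtain y where y: "extremal_vector js y" using extremal_vector_exists[OF red] by blast
    obtain p where p: "tw js j = poly_in_u p" using extremal_step(2)[OF y Cons.prems] by blast
    have pm: "lead_coeff p = 1" using monic_fls_tw[of js j] unfolding p monic_fls_poly_in_u .
    from Cons.IH[OF red] y obtain \<alpha> where \<alpha>: "\<And>i. eig y (A i) (\<alpha> i)" "?C js \<alpha>" by blast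
    from y obtain G where
      G: "\<And>i. xi_eigenvalue y i (G i)" "\<And>i. fps_to_fls (G i) = shift_fls (- (hbar * of_int (d i))) (tw js i) / tw js i"
      unfolding extremal_vector_def by metis
    \<comment> \<open>The induction hypothesis provides eigenvalues only; that they solve the system
      follows from the relations acting on \<open>y\<close> and uniqueness of eigenvalues.\<close>
    have "cartan.A_system hbar G \<alpha>"
    proof -
      have "y \<noteq> 0" using y by (simp add: extremal_vector_def)
      from A_eigenvalues[OF A this G(1)] obtain \<alpha>' where
        \<alpha>': "\<And>i. eig y (A i) (\<alpha>' i)" "cartan.A_system hbar G \<alpha>'" by blast
      have "\<alpha>' = \<alpha>" using eig_unique[OF \<alpha>'(1) \<alpha>(1) \<open>y \<noteq> 0\<close>] by (simp add: fun_eq_iff)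
      thus ?thesis using \<alpha>'(2) by simp
    qed
    note sys = this
    let ?\<beta> = "\<alpha>(j := \<alpha> j * G j)"
    have C: "?C (j # js) ?\<beta>"
    proof
      fix i
      obtain Q where Q: "lead_coeff Q = 1" "poly_in_u Q = Q_prod js i"
        "fps_to_fls (\<alpha> i) = fps_to_fls (\<alpha>0 i) * (shift_fls (- (hbar * of_int (d i))) (poly_in_u Q) / poly_in_u Q)"
        using \<alpha>(2) by blast
      show "\<exists>Q. lead_coeff Q = 1 \<and> poly_in_u Q = Q_prod (j # js) i \<and>
        fps_to_fls (?\<beta> i) = fps_to_fls (\<alpha>0 i) * (shift_fls (- (hbar * of_int (d i))) (poly_in_u Q) / poly_in_u Q)"
      proof (cases "i = j")
        case True
        have "lead_coeff (p * Q) = 1" using pm Q(1) by (simp add: lead_coeff_mult)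
        moreover have "poly_in_u (p * Q) = Q_prod (j # js) i"
          using True Q(2) p by (simp add: poly_in_u_mult Q_prod_Cons)
        moreover have "fps_to_fls (?\<beta> i) = fps_to_fls (\<alpha>0 i) * (shift_fls (- (hbar * of_int (d i))) (poly_in_u (p * Q)) / poly_in_u (p * Q))"
          using True Q(3) G(2)[of j] p
          by (simp add: fls_times_fps_to_fls poly_in_u_mult shift_fls_mult mult_ac)
        ultimately show ?thesis by blast
      next
        case False
        thus ?thesis using Q by (intro exI[of _ Q]) (simp add: Q_prod_Cons)
      qed
    qed
    show ?case
    proof (intro allI impI)
      fix z assume z: "extremal_vector (j # js) z"
      then obtain G' where
        G': "\<And>i. xi_eigenvalue z i (G' i)" "\<And>i. fps_to_fls (G' i) = shift_fls (- (hbar * of_int (d i))) (tw (j # js) i) / tw (j # js) i"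
        unfolding extremal_vector_def by metis
      have "z \<noteq> 0" using z by (simp add: extremal_vector_def)
      from A_eigenvalues[OF A this G'(1)] obtain \<beta> where
        \<beta>: "\<And>i. eig z (A i) (\<beta> i)" "cartan.A_system hbar G' \<beta>" by blast
      have "cartan.A_system hbar G' ?\<beta>"
      proof (rule cartan.A_system_step[OF sys])
        show nz: "tw js j \<noteq> 0" by (rule monic_fls_nonzero[OF monic_fls_tw])
        show "fps_to_fls (G j) = shift_fls (- (hbar * of_int (d j))) (tw js j) / tw js j" by (rule G(2))
        show "G' i $ 0 = 1" for i using G'(1) by (simp add: xi_eigenvalue_def)
        show "fps_to_fls (G' i) = fps_to_fls (G i) * shift_fls (hbar * of_int (d j) * of_int (a j i) / 2) (tw js j)
                     / shift_fls (- (hbar * of_int (d j) * of_int (a j i) / 2)) (tw js j)" for i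
          unfolding G'(2) G(2) tau_word_Cons
          by (rule cartan.tau_gen_quotient[OF monic_fls_nonzero[OF monic_fls_tw] monic_fls_nonzero[OF monic_fls_tw]])
      qed
      \<comment> \<open>The true eigenvalues on \<open>z\<close> and the predicted ones solve the
        same system.\<close>
      hence "\<beta> = ?\<beta>" using cartan.A_system_unique \<beta>(2) by blast
      thus "\<exists>\<alpha>. (\<forall>i. eig z (A i) (\<alpha> i)) \<and> ?C (j # js) \<alpha>" using \<beta>(1) C by blast
    qed
  qed
  thus ?thesis using y by blast
qed

lemma Q_poly_extremal:
  assumes A: "is_A_series a d hbar A" and red: "reduced_expression a js w"
  shows "poly_in_u (Q_poly d hbar P sc \<rho> A w i) = Q_prod js i"
proof -
  have w: "w = weyl_word a js" using red by (simp add: reduced_expression_def)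
  obtain G0 where "\<And>i. xi_eigenvalue v i (G0 i)"
    using extremal_vector_Nil unfolding extremal_vector_def by metis
  from A_eigenvalues[OF A v_nz this] obtain \<alpha>0 where
    \<alpha>0: "\<And>i. eig v (A i) (\<alpha>0 i)" and sys: "cartan.A_system hbar G0 \<alpha>0" by blast
  have \<alpha>00: "\<alpha>0 i $ 0 = 1" using sys by (simp add: cartan.A_system_def)
  have lA: "lambda_A d P sc \<rho> A i = \<alpha>0 i"
    unfolding lambda_A_def
  proof (rule the_equality)
    show "\<forall>x\<in>wt lam. \<forall>n. \<rho> (A i $ n) x = sc (\<alpha>0 i $ n) x"
    proof (intro ballI allI)
      fix x n assume "x \<in> wt lam"
      then obtain c where "x = sc c v" using wt_lam by blast
      thus "\<rho> (A i $ n) x = sc (\<alpha>0 i $ n) x"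
        using \<alpha>0[of i] by (simp add: eig_def linD[OF lin_\<rho>] mult.commute)
    qed
    fix l assume "\<forall>x\<in>wt lam. \<forall>n. \<rho> (A i $ n) x = sc (l $ n) x"
    hence "eig v (A i) l" using v_wt by (simp add: eig_def)
    thus "l = \<alpha>0 i" using eig_unique \<alpha>0 v_nz by blast
  qed
  obtain y where y: "extremal_vector js y" using extremal_vector_exists[OF red] by blast
  have y_nz: "y \<noteq> 0" and y_wt: "y \<in> wt (w lam)" using y by (simp_all add: extremal_vector_def w)
  from A_eigenvalue_extremal[OF A red y \<alpha>0] obtain \<alpha> Q where
    \<alpha>: "eig y (A i) \<alpha>" and Q: "lead_coeff Q = 1" "poly_in_u Q = Q_prod js i"
    "fps_to_fls \<alpha> = fps_to_fls (\<alpha>0 i) * (shift_fls (- (hbar * of_int (d i))) (poly_in_u Q) / poly_in_u Q)"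
    by blast
  let ?\<beta> = "inverse (\<alpha>0 i) * \<alpha>"
  have AV: "A_V d P sc \<rho> A i n x = sc (?\<beta> $ n) x" if "x \<in> wt (w lam)" for n x
  proof -
    obtain c where "x = sc c y" using y \<open>x \<in> wt (w lam)\<close> unfolding extremal_vector_def w by blast
    hence "\<rho> (A i $ k) x = sc (\<alpha> $ k) x" for k
      using \<alpha> by (simp add: eig_def linD[OF lin_\<rho>] mult.commute)
    thus ?thesis
      by (simp add: A_V_def lA fps_mult_nth scale_sum_left atLeast0AtMost)
  qed
  let ?q = "\<lambda>Q. poly_in_u (poly_shift (hbar * of_int (d i)) Q) / poly_in_u Q"
  have "inverse (\<alpha>0 i) * \<alpha>0 i = 1" using \<alpha>00 by (intro inverse_mult_eq_1) simp
  hence "fps_to_fls (inverse (\<alpha>0 i)) * fps_to_fls (\<alpha>0 i) = 1" by (simp flip: fls_times_fps_to_fls)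
  hence q: "?q Q = fps_to_fls ?\<beta>"
    unfolding fls_times_fps_to_fls Q(3) poly_in_u_poly_shift by (simp flip: mult.assoc)
  have "Q_poly d hbar P sc \<rho> A w i = Q"
    unfolding Q_poly_def
  proof (rule the_equality)
    show "lead_coeff Q = 1 \<and> (\<forall>x\<in>wt (w lam). \<forall>n. A_V d P sc \<rho> A i n x = sc (fls_nth (?q Q) (int n)) x)"
      using Q(1) AV unfolding q by simp
    fix Q' assume Q': "lead_coeff Q' = 1 \<and> (\<forall>x\<in>wt (w lam). \<forall>n. A_V d P sc \<rho> A i n x = sc (fls_nth (?q Q') (int n)) x)"
    have m: "monic_fls (poly_in_u Q')" "monic_fls (poly_in_u Q)" using Q' Q(1) by (simp_all add: monic_fls_poly_in_u)
    \<comment> \<open>The competitor is tested only at coefficients \<open>n \<ge> 0\<close>; its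
      quotient being a power series, these determine it.\<close>
    from eigenvalue_quotient[OF m(1), of "- (hbar * of_int (d i))"] obtain H where
      H: "fps_to_fls H = ?q Q'" unfolding poly_in_u_poly_shift by blast
    have "H = ?\<beta>"
    proof (rule fps_ext)
      fix n
      have "A_V d P sc \<rho> A i n y = sc (fls_nth (?q Q') (int n)) y" using Q' y_wt by blast
      hence "sc (?\<beta> $ n) y = sc (H $ n) y"
        unfolding AV[OF y_wt] H[symmetric] by (simp del: scale_cancel_right)
      thus "H $ n = ?\<beta> $ n" using y_nz by (metis scale_cancel_right)
    qed
    hence "?q Q' = ?q Q" using H q by simp
    hence "poly_in_u Q' = poly_in_u Q"
      unfolding poly_in_u_poly_shift
      using hbar d_nz[of i] by (intro monic_fls_eqI[OF m, of "- (hbar * of_int (d i))"]) auto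
    thus "Q' = Q" by simp
  qed
  thus ?thesis using Q(2) by simp
qed

end

theorem theorem5p2:
  fixes a :: "'i::finite \<Rightarrow> 'i \<Rightarrow> int" and d :: "'i \<Rightarrow> int" and hbar :: complex
    and P :: "'i \<Rightarrow> complex poly"
    and sc :: "complex \<Rightarrow> 'v::ab_group_add \<Rightarrow> 'v"
    and \<rho> :: "'i yangian_gen free_alg \<Rightarrow> 'v \<Rightarrow> 'v" and v :: 'v
    and A :: "'i \<Rightarrow> 'i yangian_gen free_alg fps"
    and w :: "'i weight \<Rightarrow> 'i weight" and js :: "'i list"
  assumes "simple_cartan_datum a d"
    and "hbar \<noteq> 0"
    and "is_A_series a d hbar A"
    and "\<And>j. lead_coeff (P j) = 1"
    and "drinfeld_module a d hbar P sc \<rho> v"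
    and "w \<in> weyl_group a"
    and "reduced_expression a js w"
  shows "(\<forall>i. poly_in_u (Q_poly d hbar P sc \<rho> A w i) =
            (\<Prod>r | r \<in> {1..length js} \<and> js ! (r - 1) = i.
               tau a d hbar (weyl_word a (drop r js)) (\<lambda>j. poly_in_u (P j)) i)) \<and>
         (\<forall>r \<in> {1..length js}. \<exists>p. lead_coeff p = 1 \<and>
            tau a d hbar (weyl_word a (drop r js)) (\<lambda>j. poly_in_u (P j)) (js ! (r - 1)) = poly_in_u p)"
proof -
  interpret cartan: simple_cartan_datum a d by (rule assms(1))
  interpret Y: yangian_module a d hbar sc \<rho> using assms(5) by (simp add: drinfeld_module_def)
  \<comment> \<open>Linearity of one operator contains the vector space axioms for \<open>sc\<close>
    that the next interpretation requires.\<close>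
  interpret l: Vector_Spaces.linear sc sc "\<rho> 0" by (rule Y.linear)
  interpret drinfeld_rep a d hbar sc \<rho> P v
  proof unfold_locales
    show "hbar \<noteq> 0" "\<And>j. lead_coeff (P j) = 1" by (rule assms)+
    note dm = assms(5)[unfolded drinfeld_module_def finite_dim_irreducible_def]
    show "\<exists>B. finite B \<and> l.vs1.span B = UNIV" "v \<noteq> 0" "range (\<lambda>p. \<rho> p v) = UNIV"
      using dm by simp_all
    show "\<rho> (x_series hbar Plus i $ n) v = 0" for i n using dm by simp
    show "\<rho> (xi_series hbar i $ n) v =
        sc (fls_nth (poly_in_u (poly_shift (hbar * of_int (d i)) (P i)) / poly_in_u (P i)) (int n)) v" for i n
      using dm by simp
  qed
  have red: "reduced_expression a (drop r js) (weyl_word a (drop r js))" for r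
    using reduced_expression_tail[of a "take r js" "drop r js" w] assms(7) by simp
  have tau: "tau a d hbar (weyl_word a (drop r js)) (\<lambda>j. poly_in_u (P j)) = tw (drop r js)" for r
    using tau_eq_tw[OF red] .
  show ?thesis
    unfolding tau
  proof (intro conjI allI ballI)
    fix i
    show "poly_in_u (Q_poly d hbar P sc \<rho> A w i) =
        (\<Prod>r | r \<in> {1..length js} \<and> js ! (r - 1) = i. tw (drop r js) i)"
      using Q_poly_extremal[OF assms(3,7)] by (simp add: Q_prod_def)
  next
    fix r assume r: "r \<in> {1..length js}"
    let ?j = "js ! (r - 1)"
    \<comment> \<open>The suffix starting with the r-th letter is itself reduced, so
      \<open>extremal_step\<close> applies with this letter in front of the word of
      \<open>w_r\<close>.\<close>
    have "drop (r - 1) js = ?j # drop r js"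
    proof -
      have "r - 1 < length js" "Suc (r - 1) = r" using r by auto
      thus ?thesis using Cons_nth_drop_Suc[of "r - 1" js] by simp
    qed
    hence "reduced_expression a (?j # drop r js) (weyl_word a (drop (r - 1) js))"
      using red[of "r - 1"] by simp
    moreover obtain y where "extremal_vector (drop r js) y"
      using extremal_vector_exists[OF red] by blast
    ultimately obtain p where p: "tw (drop r js) ?j = poly_in_u p" using extremal_step(2) by blast
    have "lead_coeff p = 1" using monic_fls_tw[of "drop r js" ?j] unfolding p monic_fls_poly_in_u .
    with p show "\<exists>p. lead_coeff p = 1 \<and> tw (drop r js) ?j = poly_in_u p" by blast
  qed
qed

end
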